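(* Let $(X_t)_{t\ge0}$ be a (true) submartingale of class $(\Sigma)$ defined on a filtered probability space $(\Omega,\mathcal{F},\mathbb{P},(\mathcal{F}_t)_{t\ge0})$, and let $g:=\sup\{t\ge0: X_t=0\}$. (1) If the filtered probability space satisfies property (P), then there exists a unique $\sigma$-finite measure $\mathcal{Q}$ on $(\Omega,\mathcal{F})$ such that $\mathcal{Q}[g=\infty]=0$ and, for any bounded stopping time $T$ and all bounded $\mathcal{F}_T$-measurable random variables $F_T$, $$\mathcal{Q}\left[F_T\,\mathbf{1}_{g\le T}\right]=\mathbb{E}_{\mathbb{P}}\left[F_TX_T\right].$$ (2) If $X$ is of class $(D)$ and the filtered probability space satisfies the usual assumptions or property (P), then for any stopping time $T$, $$X_T=\mathbb{E}_{\mathbb{P}}\left[X_\infty\mathbf{1}_{g\le T}\mid\mathcal{F}_T\right]\quad \mathbb{P}\text{-a.s.},$$ where $X_\infty$ is the $\mathbb{P}$-a.s. limit of $X_t$ as $t\to\infty$.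
   Context: Property (P). Let $(\Omega,\mathcal{F},(\mathcal{F}_t)_{t\ge0})$ be a filtered measurable space such that $\mathcal{F}=\bigvee_{t\ge0}\mathcal{F}_t$ is the $\sigma$-algebra generated by all $\mathcal{F}_t$, $t\ge 0$. It satisfies property (P) if $\mathcal{F}_t=\mathcal{G}_{t+}:=\bigcap_{s>t}\mathcal{G}_s$ for all $t\ge0$, where $(\mathcal{G}_t)_{t\ge0}$ is a filtration such that: (1) for all $t\ge0$, $\mathcal{G}_t$ is generated by a countable number of sets; (2) for all $t\ge0$, there exist a Polish space $\Omega_t$ and a surjective map $\pi_t:\Omega\to\Omega_t$ such that $\mathcal{G}_t$ is the $\sigma$-algebra of inverse images by $\pi_t$ of Borel sets of $\Omega_t$, and such that for all $B\in\mathcal{G}_t$ and $\omega\in\Omega$, $\pi_t(\omega)\in\pi_t(B)$ implies $\omega\in B$; (3) if $(\omega_n)_{n\ge0}$ is a sequence of elements of $\Omega$ such that $\bigcap_{n=0}^N A_n(\omega_n)\neq\emptyset$ for all $N\ge0$, where $A_n(\omega_n)$ denotes the intersection of all sets in $\mathcal{G}_n$ containing $\omega_n$, then $\bigcap_{n=0}^\infty A_n(\omega_n)\neq\emptyset$. The filtration $(\mathcal{F}_t)$ is then right-continuous; it is not assumed to be complete. Class $(\Sigma)$. A nonnegative submartingale $(X_t)_{t\ge0}$ is of class $(\Sigma)$ if $X_t=N_t+A_t$, where $(N_t)$ and $(A_t)$ are $(\mathcal{F}_t)$-adapted, $(N_t)_{t\ge0}$ is a càdlàg martingale, $(A_t)_{t\ge0}$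 is a continuous increasing process with $A_0=0$, and the measure $(dA_t)$ is carried by the set $\{t\ge0: X_t=0\}$. Class $(D)$: the family $(X_T)$, $T$ ranging over all a.s. finite stopping times, is uniformly integrable. The usual assumptions: the filtration is right-continuous and complete. Conventions: for a measure $\mathcal{Q}$ and a function $F$, $\mathcal{Q}[F]$ denotes $\int F\,d\mathcal{Q}$, and $\mathcal{Q}[\Lambda]$ the measure of the event $\Lambda$. $\sup\emptyset=0$. Events involving $g$ are understood as measurable with respect to the completion of $\mathcal{F}$ under the measure considered. On $\{T=\infty\}$, $X_T:=X_\infty$. *)

theory Defs
  imports "HOL-Probability.Probability"
begin

section \<open>Filtrations and stopping times in continuous time\<close>

text \<open>
  Times are reals \<open>t \<ge> 0\<close>; filtrations and processes are families indexed by \<^typ>\<open>real\<close> of which only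
  the members with nonnegative index matter. As usual in the library, a sub-\<open>\<sigma>\<close>-algebra is a
  measure space of which only the space and the measurable sets matter.

  Stopping times take values in \<open>[0, \<infinity>]\<close>, i.e. in \<^typ>\<open>ennreal\<close>. To use the library notions
  \<^const>\<open>filtration\<close>, \<^const>\<open>stopping_time\<close> and \<^const>\<open>filtration.pre_sigma\<close>, whose time type is the
  type of values of the stopping times, a filtration is extended to \<open>[0, \<infinity>]\<close> by
  \<open>F\<^sub>\<infinity> = \<Or>\<^sub>t F\<^sub>t\<close>. At time \<open>\<infinity>\<close> the condition for a stopping time is void, and the one in
  \<^const>\<open>filtration.pre_sigma\<close> says \<open>A \<in> F\<^sub>\<infinity>\<close>.
\<close>

definition sigma_infinity :: "'a set \<Rightarrow> (real \<Rightarrow> 'a measure) \<Rightarrow> 'a measure" where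
  "sigma_infinity \<Omega> F = sigma \<Omega> (\<Union>t\<in>{0..}. sets (F t))"

definition extend_filtration :: "'a set \<Rightarrow> (real \<Rightarrow> 'a measure) \<Rightarrow> ennreal \<Rightarrow> 'a measure" where
  "extend_filtration \<Omega> F t = (if t = \<infinity> then sigma_infinity \<Omega> F else F (enn2real t))"

definition real_filtration :: "'a set \<Rightarrow> (real \<Rightarrow> 'a measure) \<Rightarrow> bool" where
  "real_filtration \<Omega> F \<longleftrightarrow> filtration \<Omega> (extend_filtration \<Omega> F)"

locale filtered_prob_space = prob_space M for M :: "'a measure" +
  fixes F :: "real \<Rightarrow> 'a measure"
  assumes real_filtration: "real_filtration (space M) F"
    and sets_F_subset: "\<And>t. 0 \<le> t \<Longrightarrow> sets (F t) \<subseteq> sets M"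

definition is_stopping_time :: "'a measure \<Rightarrow> (real \<Rightarrow> 'a measure) \<Rightarrow> ('a \<Rightarrow> ennreal) \<Rightarrow> bool" where
  "is_stopping_time M F T \<longleftrightarrow> stopping_time (extend_filtration (space M) F) T"

definition sigma_at :: "'a measure \<Rightarrow> (real \<Rightarrow> 'a measure) \<Rightarrow> ('a \<Rightarrow> ennreal) \<Rightarrow> 'a measure" where
  "sigma_at M F T = filtration.pre_sigma (space M) (extend_filtration (space M) F) T"

definition bounded_time :: "'a measure \<Rightarrow> ('a \<Rightarrow> ennreal) \<Rightarrow> bool" where
  "bounded_time M T \<longleftrightarrow> (\<exists>c::real. \<forall>\<omega>\<in>space M. T \<omega> \<le> ennreal c)"

definition value_at :: "(real \<Rightarrow> 'a \<Rightarrow> real) \<Rightarrow> ('a \<Rightarrow> real) \<Rightarrow> ('a \<Rightarrow> ennreal) \<Rightarrow> 'a \<Rightarrow> real" where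
  "value_at X Xinf T \<omega> = (if T \<omega> = \<infinity> then Xinf \<omega> else X (enn2real (T \<omega>)) \<omega>)"

definition usual_assumptions :: "'a measure \<Rightarrow> (real \<Rightarrow> 'a measure) \<Rightarrow> bool" where
  "usual_assumptions M F \<longleftrightarrow>
     (\<forall>t\<ge>0. sets (F t) = (\<Inter>s\<in>{t<..}. sets (F s))) \<and>
     complete_measure M \<and> null_sets M \<subseteq> sets (F 0)"


section \<open>Property (P)\<close>

definition polish_topology :: "'a topology \<Rightarrow> bool" where
  "polish_topology S \<longleftrightarrow> completely_metrizable_space S \<and> separable_space S"

definition borel_sets_of :: "'a topology \<Rightarrow> 'a set set" where
  "borel_sets_of S = sigma_sets (topspace S) {U. openin S U}"

definition atom_at :: "'a measure \<Rightarrow> 'a \<Rightarrow> 'a set" where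
  "atom_at G \<omega> = \<Inter>{B \<in> sets G. \<omega> \<in> B}"

text \<open>
  The Polish spaces \<open>\<Omega>\<^sub>t\<close> are topologies on subsets of the type of the points of \<open>\<Omega>\<close>. This is no
  restriction: \<open>\<pi>\<^sub>t\<close> maps \<open>\<Omega>\<close> onto \<open>\<Omega>\<^sub>t\<close>, so \<open>\<Omega>\<^sub>t\<close> is in bijection with a subset of \<open>\<Omega>\<close>, to which
  its topology can be transported.
\<close>

definition property_P :: "'a measure \<Rightarrow> (real \<Rightarrow> 'a measure) \<Rightarrow> bool" where
  "property_P M F \<longleftrightarrow>
     sets M = sets (sigma_infinity (space M) F) \<and>
     (\<exists>G :: real \<Rightarrow> 'a measure.
        real_filtration (space M) G \<and>
        (\<forall>t\<ge>0. sets (F t) = (\<Inter>s\<in>{t<..}. sets (G s))) \<and>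
        (\<forall>t\<ge>0. \<exists>\<C>. countable \<C> \<and> \<C> \<subseteq> Pow (space M) \<and> sets (G t) = sigma_sets (space M) \<C>) \<and>
        (\<forall>t\<ge>0. \<exists>(S :: 'a topology) \<pi>.
            polish_topology S \<and> \<pi> ` space M = topspace S \<and>
            sets (G t) = {\<pi> -` B \<inter> space M | B. B \<in> borel_sets_of S} \<and>
            (\<forall>B\<in>sets (G t). \<forall>\<omega>\<in>space M. \<pi> \<omega> \<in> \<pi> ` B \<longrightarrow> \<omega> \<in> B)) \<and>
        (\<forall>\<omega> :: nat \<Rightarrow> 'a.
            (\<forall>n. \<omega> n \<in> space M) \<longrightarrow>
            (\<forall>N. (\<Inter>n\<in>{..N}. atom_at (G (real n)) (\<omega> n)) \<noteq> {}) \<longrightarrow>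
            (\<Inter>n. atom_at (G (real n)) (\<omega> n)) \<noteq> {}))"


section \<open>Submartingales, class \<open>(\<Sigma>)\<close> and class \<open>(D)\<close>\<close>

definition adapted :: "(real \<Rightarrow> 'a measure) \<Rightarrow> (real \<Rightarrow> 'a \<Rightarrow> real) \<Rightarrow> bool" where
  "adapted F X \<longleftrightarrow> (\<forall>t\<ge>0. X t \<in> borel_measurable (F t))"

definition martingale :: "'a measure \<Rightarrow> (real \<Rightarrow> 'a measure) \<Rightarrow> (real \<Rightarrow> 'a \<Rightarrow> real) \<Rightarrow> bool" where
  "martingale M F X \<longleftrightarrow> adapted F X \<and> (\<forall>t\<ge>0. integrable M (X t)) \<and>
     (\<forall>s t. 0 \<le> s \<and> s \<le> t \<longrightarrow> (AE \<omega> in M. real_cond_exp M (F s) (X t) \<omega> = X s \<omega>))"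

definition submartingale :: "'a measure \<Rightarrow> (real \<Rightarrow> 'a measure) \<Rightarrow> (real \<Rightarrow> 'a \<Rightarrow> real) \<Rightarrow> bool" where
  "submartingale M F X \<longleftrightarrow> adapted F X \<and> (\<forall>t\<ge>0. integrable M (X t)) \<and>
     (\<forall>s t. 0 \<le> s \<and> s \<le> t \<longrightarrow> (AE \<omega> in M. X s \<omega> \<le> real_cond_exp M (F s) (X t) \<omega>))"

definition cadlag :: "(real \<Rightarrow> real) \<Rightarrow> bool" where
  "cadlag f \<longleftrightarrow> (\<forall>t\<ge>0. (f \<longlongrightarrow> f t) (at_right t)) \<and> (\<forall>t>0. \<exists>l. (f \<longlongrightarrow> l) (at_left t))"

text \<open>
  The Lebesgue-Stieltjes measure of an increasing function on \<open>[0, \<infinity>)\<close>, as a measure on the whole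
  line: extending the function by its value at \<open>0\<close> puts no mass on \<open>(-\<infinity>, 0]\<close>.
\<close>

definition stieltjes :: "(real \<Rightarrow> real) \<Rightarrow> real measure" where
  "stieltjes a = interval_measure (\<lambda>t. a (max 0 t))"

definition class_Sigma :: "'a measure \<Rightarrow> (real \<Rightarrow> 'a measure) \<Rightarrow> (real \<Rightarrow> 'a \<Rightarrow> real) \<Rightarrow> bool" where
  "class_Sigma M F X \<longleftrightarrow>
     submartingale M F X \<and> (\<forall>t\<ge>0. \<forall>\<omega>\<in>space M. 0 \<le> X t \<omega>) \<and>
     (\<exists>N A.
        (\<forall>t\<ge>0. \<forall>\<omega>\<in>space M. X t \<omega> = N t \<omega> + A t \<omega>) \<and>
        martingale M F N \<and> (\<forall>\<omega>\<in>space M. cadlag (\<lambda>t. N t \<omega>)) \<and>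
        adapted F A \<and>
        (\<forall>\<omega>\<in>space M. A 0 \<omega> = 0 \<and> continuous_on {0..} (\<lambda>t. A t \<omega>) \<and> mono_on {0..} (\<lambda>t. A t \<omega>)) \<and>
        (AE \<omega> in M. AE t in stieltjes (\<lambda>t. A t \<omega>). t \<in> {t. 0 \<le> t \<and> X t \<omega> = 0}))"

definition uniformly_integrable :: "'a measure \<Rightarrow> ('a \<Rightarrow> real) set \<Rightarrow> bool" where
  "uniformly_integrable M \<Y> \<longleftrightarrow> \<Y> \<subseteq> borel_measurable M \<and>
     ((\<lambda>K::real. SUP Y\<in>\<Y>. \<integral>\<^sup>+\<omega>. ennreal \<bar>Y \<omega>\<bar> * indicator {\<omega>. K < \<bar>Y \<omega>\<bar>} \<omega> \<partial>M) \<longlongrightarrow> 0) at_top"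

text \<open>For an a.s. finite \<open>T\<close> the value of \<open>X\<^sub>T\<close> on the null event \<open>{T = \<infinity>}\<close> is irrelevant; it is set to \<open>0\<close>.\<close>

definition class_D :: "'a measure \<Rightarrow> (real \<Rightarrow> 'a measure) \<Rightarrow> (real \<Rightarrow> 'a \<Rightarrow> real) \<Rightarrow> bool" where
  "class_D M F X \<longleftrightarrow>
     uniformly_integrable M
       {value_at X (\<lambda>_. 0) T | T. is_stopping_time M F T \<and> (AE \<omega> in M. T \<omega> \<noteq> \<infinity>)}"

text \<open>In \<^typ>\<open>ennreal\<close> the supremum of the empty set is \<open>0\<close>.\<close>

definition last_zero :: "(real \<Rightarrow> 'a \<Rightarrow> real) \<Rightarrow> 'a \<Rightarrow> ennreal" where
  "last_zero X \<omega> = (SUP t\<in>{t. 0 \<le> t \<and> X t \<omega> = 0}. ennreal t)"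

text \<open>
  \<open>{g = \<infinity>}\<close> and \<open>{g \<le> T}\<close> need not be measurable for \<open>Q\<close>, hence the completion. Measurability of
  \<open>{g = \<infinity>}\<close> and integrability are part of the condition, since in the library the measure
  of a nonmeasurable set and the integral of a nonintegrable function are \<open>0\<close>. The former is built
  into \<^const>\<open>null_sets\<close>, the latter into \<^const>\<open>has_bochner_integral\<close>. \<open>X\<^sub>T\<close> is evaluated with
  a dummy value at \<open>T = \<infinity>\<close>, which does not occur for bounded \<open>T\<close>.
\<close>

definition represents :: "'a measure \<Rightarrow> (real \<Rightarrow> 'a measure) \<Rightarrow> (real \<Rightarrow> 'a \<Rightarrow> real) \<Rightarrow> 'a measure \<Rightarrow> bool" where
  "represents M F X Q \<longleftrightarrow>
     {\<omega> \<in> space M. last_zero X \<omega> = \<infinity>} \<in> null_sets (completion Q) \<and>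
     (\<forall>T f. is_stopping_time M F T \<longrightarrow> bounded_time M T \<longrightarrow>
        f \<in> borel_measurable (sigma_at M F T) \<longrightarrow> (\<exists>K. \<forall>\<omega>\<in>space M. \<bar>f \<omega>\<bar> \<le> K) \<longrightarrow>
        integrable M (\<lambda>\<omega>. f \<omega> * value_at X (\<lambda>_. 0) T \<omega>) \<and>
        has_bochner_integral (completion Q)
          (\<lambda>\<omega>. f \<omega> * indicator {\<omega>. last_zero X \<omega> \<le> T \<omega>} \<omega>)
          (\<integral>\<omega>. f \<omega> * value_at X (\<lambda>_. 0) T \<omega> \<partial>M))"

end

theory Submission
  imports Defs
begin

text \<open>
  For a time \<open>q\<close> let \<open>T q\<close> be the first time from \<open>q\<close> on at which \<open>X\<close> comes arbitrarily close to \<open>0\<close>. The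
  measure \<open>dA\<close> does not charge \<open>(q, T q)\<close>, so optional stopping for \<open>N\<close> shows first that
  \<open>X (T q) = 0\<close> almost surely on \<open>{T q < \<infinity>}\<close> (no measurable projection is needed to handle \<open>g\<close>), and then
  that \<open>X s 1{T q > s}\<close>, \<open>s \<ge> q\<close>, is a martingale started at \<open>X q\<close>.

  Under property (P) this martingale is the density process of a finite measure \<open>Q q\<close>, which lives on
  \<open>{T q = \<infinity>} = {g \<le> q}\<close>; these measures increase with \<open>q\<close> and \<open>Q\<close> is their supremum. Conversely
  a representing measure is absolutely continuous with respect to \<open>P\<close> on every \<open>F t\<close>, and its trace on
  \<open>{T q = \<infinity>}\<close> is determined on the \<open>\<pi>\<close>-system \<open>\<Union>t. F t\<close>. If \<open>X\<close> is of class (D), the measure with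
  density \<open>X\<^sub>\<infinity>\<close> plays the role of \<open>Q\<close>. In both cases the formula for a stopping time \<open>T\<close> follows from the
  one for constant times by approximating \<open>T\<close> from the right.
\<close>

section \<open>Uniform integrability\<close>

text \<open>Three obstacles shape the argument. First, \<open>T q\<close> is a limit of times at
  which \<open>X\<close> is small, so \<open>X\<close> may have left limit 0 there and still jump
  upwards. But \<open>X\<close> is at most \<open>1 / (n + 1)\<close> at the times of near-zeros,
  \<open>A\<close> does not move between these times and \<open>T q\<close>, and so optional
  stopping carries the bound over in expectation: the jump is almost surely absent. Second,
  \<open>g\<close> looks into the future, and \<open>{g \<le> t}\<close> need not be measurable. It
  is replaced by the event that \<open>T q = \<infinity>\<close> for all rational
  \<open>q > t\<close>, where \<open>T q\<close> is computed from rational times. Third,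
  \<open>Q\<close> may be singular to \<open>P\<close> on the full \<sigma>-algebra, so a
  \<open>P\<close>-null set cannot simply be discarded under \<open>Q\<close>. The exceptional set
  in question is therefore written as a countable union of events, each belonging to some
  \<open>F t\<close>, where \<open>P\<close>-null implies \<open>Q\<close>-null.\<close>

lemma integrable_excess:
  fixes f :: "'a \<Rightarrow> real"
  assumes "integrable M f" "0 \<le> K"
  shows "integrable M (\<lambda>x. max (\<bar>f x\<bar> - K) 0)"
  by (rule Bochner_Integration.integrable_bound[OF assms(1)]) (use assms in auto)

lemma (in finite_measure) integral_tail_tendsto_zero:
  fixes f :: "'a \<Rightarrow> real"
  assumes f: "integrable M f" and "0 < e"
  shows "\<exists>K\<ge>0. (\<integral>x. max (\<bar>f x\<bar> - K) 0 \<partial>M) \<le> e"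
proof -
  have [measurable]: "f \<in> borel_measurable M" using f by auto
  have "(\<lambda>n. \<integral>x. max (\<bar>f x\<bar> - real n) 0 \<partial>M) \<longlonglongrightarrow> (\<integral>x. 0 \<partial>M)"
  proof (rule integral_dominated_convergence[where w="\<lambda>x. \<bar>f x\<bar>"])
    show "AE x in M. (\<lambda>n. max (\<bar>f x\<bar> - real n) 0) \<longlonglongrightarrow> 0"
    proof (rule AE_I2)
      fix x
      obtain n0 :: nat where n0: "\<bar>f x\<bar> \<le> real n0" using real_arch_simple by blast
      show "(\<lambda>n. max (\<bar>f x\<bar> - real n) 0) \<longlonglongrightarrow> 0"
        by (rule tendsto_eventually) (use n0 in \<open>auto intro!: eventually_sequentiallyI[of n0]\<close>)
    qed
  qed (use f in \<open>auto intro!: AE_I2\<close>)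
  then have "eventually (\<lambda>n. (\<integral>x. max (\<bar>f x\<bar> - real n) 0 \<partial>M) < e) sequentially"
    using \<open>0 < e\<close> by (intro order_tendstoD) auto
  then obtain n where "(\<integral>x. max (\<bar>f x\<bar> - real n) 0 \<partial>M) < e"
    by (auto simp: eventually_sequentially)
  then show ?thesis by (intro exI[of _ "real n"]) auto
qed

text \<open>Uniform integrability is phrased with the excess
  \<open>max (\<bar>Y\<bar> - K) 0\<close> rather than with the integral over
  \<open>{\<bar>Y\<bar> > K}\<close>. The excess is continuous in \<open>Y\<close>, so Fatou's lemma
  carries the bound to the limit, and it is exactly the error of clipping at level \<open>K\<close>.
  The clipped functions converge by dominated convergence.\<close>

lemma (in finite_measure) vitali_convergence:
  fixes Y :: "nat \<Rightarrow> 'a \<Rightarrow> real"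
  assumes Y: "\<And>k. integrable M (Y k)" and Z[measurable]: "Z \<in> borel_measurable M"
    and lim: "AE x in M. (\<lambda>k. Y k x) \<longlonglongrightarrow> Z x"
    and ui: "\<And>e. 0 < e \<Longrightarrow> \<exists>K\<ge>0. \<forall>k. (\<integral>x. max (\<bar>Y k x\<bar> - K) 0 \<partial>M) \<le> e"
  shows "integrable M Z" "(\<lambda>k. \<integral>x. Y k x \<partial>M) \<longlonglongrightarrow> (\<integral>x. Z x \<partial>M)"
proof -
  have Ym[measurable]: "Y k \<in> borel_measurable M" for k using Y[of k] by auto
  have tail: "(\<integral>\<^sup>+x. ennreal (max (\<bar>Z x\<bar> - K) 0) \<partial>M) \<le> ennreal e"
    if K: "0 \<le> K" "\<And>k. (\<integral>x. max (\<bar>Y k x\<bar> - K) 0 \<partial>M) \<le> e" for K e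
  proof -
    have "(\<integral>\<^sup>+x. ennreal (max (\<bar>Z x\<bar> - K) 0) \<partial>M)
        = (\<integral>\<^sup>+x. liminf (\<lambda>k. ennreal (max (\<bar>Y k x\<bar> - K) 0)) \<partial>M)"
    proof (rule nn_integral_cong_AE, use lim in eventually_elim)
      fix x assume "(\<lambda>k. Y k x) \<longlonglongrightarrow> Z x"
      then have "(\<lambda>k. ennreal (max (\<bar>Y k x\<bar> - K) 0)) \<longlonglongrightarrow> ennreal (max (\<bar>Z x\<bar> - K) 0)"
        by (intro tendsto_intros tendsto_ennrealI)
      then show "ennreal (max (\<bar>Z x\<bar> - K) 0) = liminf (\<lambda>k. ennreal (max (\<bar>Y k x\<bar> - K) 0))"
        by (simp add: lim_imp_Liminf)
    qed
    also have "\<dots> \<le> liminf (\<lambda>k. \<integral>\<^sup>+x. ennreal (max (\<bar>Y k x\<bar> - K) 0) \<partial>M)"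
      by (rule nn_integral_liminf) auto
    also have "\<dots> \<le> liminf (\<lambda>k. ennreal e)"
    proof (rule Liminf_mono, rule always_eventually, rule allI)
      fix k
      have "(\<integral>\<^sup>+x. ennreal (max (\<bar>Y k x\<bar> - K) 0) \<partial>M) = ennreal (\<integral>x. max (\<bar>Y k x\<bar> - K) 0 \<partial>M)"
        by (rule nn_integral_eq_integral[OF integrable_excess[OF Y K(1)]]) auto
      then show "(\<integral>\<^sup>+x. ennreal (max (\<bar>Y k x\<bar> - K) 0) \<partial>M) \<le> ennreal e"
        using K(2)[of k] by (simp add: ennreal_leI)
    qed
    finally show ?thesis by (simp add: Liminf_const)
  qed
  have int_tailZ: "integrable M (\<lambda>x. max (\<bar>Z x\<bar> - K) 0)"
    if K: "0 \<le> K" "\<And>k. (\<integral>x. max (\<bar>Y k x\<bar> - K) 0 \<partial>M) \<le> e" for K e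
    using tail[OF K] by (intro integrableI_bounded) (auto simp: less_top[symmetric] top_unique)
  show int_Z: "integrable M Z"
  proof -
    obtain K where K: "0 \<le> K" "\<And>k. (\<integral>x. max (\<bar>Y k x\<bar> - K) 0 \<partial>M) \<le> 1" using ui[of 1] by auto
    have "integrable M (\<lambda>x. K + max (\<bar>Z x\<bar> - K) 0)" using int_tailZ[OF K] by simp
    then show ?thesis by (rule Bochner_Integration.integrable_bound) (use K(1) in auto)
  qed
  show "(\<lambda>k. \<integral>x. Y k x \<partial>M) \<longlonglongrightarrow> (\<integral>x. Z x \<partial>M)"
  proof (rule LIMSEQ_I)
    fix r :: real assume "0 < r"
    then obtain K where K: "0 \<le> K" "\<And>k. (\<integral>x. max (\<bar>Y k x\<bar> - K) 0 \<partial>M) \<le> r / 4" using ui[of "r/4"] by auto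
    \<comment> \<open>Three errors of size \<open>r / 4\<close> occur: clipping \<open>Y k\<close>,
      clipping \<open>Z\<close>, and the difference of the clipped integrals. Together they stay
      below \<open>r\<close>.\<close>
    define cl where "cl x = max (- K) (min K x)" for x :: real
    have cl_diff: "\<bar>x - cl x\<bar> = max (\<bar>x\<bar> - K) 0" for x using K(1) by (auto simp: cl_def max_def min_def)
    have cl_bd: "\<bar>cl x\<bar> \<le> K" for x using K(1) by (auto simp: cl_def max_def min_def)
    have [measurable]: "cl \<in> borel_measurable borel" unfolding cl_def by measurable
    have int_cl: "integrable M (\<lambda>x. cl (f x))" if [measurable]: "f \<in> borel_measurable M" for f
      by (rule integrable_const_bound[where B=K]) (use cl_bd in auto)
    have diff: "\<bar>(\<integral>x. f x \<partial>M) - (\<integral>x. cl (f x) \<partial>M)\<bar> \<le> (\<integral>x. max (\<bar>f x\<bar> - K) 0 \<partial>M)"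
      if "integrable M f" for f
    proof -
      have "(\<integral>x. f x \<partial>M) - (\<integral>x. cl (f x) \<partial>M) = (\<integral>x. f x - cl (f x) \<partial>M)"
        using that int_cl[of f] by simp
      also have "\<bar>\<dots>\<bar> \<le> (\<integral>x. \<bar>f x - cl (f x)\<bar> \<partial>M)" by (rule integral_abs_bound)
      finally show ?thesis by (simp add: cl_diff)
    qed
    have "(\<lambda>k. \<integral>x. cl (Y k x) \<partial>M) \<longlonglongrightarrow> (\<integral>x. cl (Z x) \<partial>M)"
    proof (rule integral_dominated_convergence[where w="\<lambda>_. K"])
      show "AE x in M. (\<lambda>k. cl (Y k x)) \<longlonglongrightarrow> cl (Z x)"
        using lim by eventually_elim (auto simp: cl_def intro!: tendsto_intros)
    qed (use cl_bd in auto)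
    then obtain k0 where k0: "\<And>k. k \<ge> k0 \<Longrightarrow> \<bar>(\<integral>x. cl (Y k x) \<partial>M) - (\<integral>x. cl (Z x) \<partial>M)\<bar> < r / 4"
      using \<open>0 < r\<close> by (metis LIMSEQ_D real_norm_def zero_less_divide_iff zero_less_numeral)
    have "(\<integral>x. max (\<bar>Z x\<bar> - K) 0 \<partial>M) \<le> r / 4"
      using tail[OF K] \<open>0 < r\<close> nn_integral_eq_integral[OF int_tailZ[OF K]]
      by (simp add: ennreal_le_iff)
    then have *: "\<bar>(\<integral>x. Z x \<partial>M) - (\<integral>x. cl (Z x) \<partial>M)\<bar> \<le> r / 4" using diff[OF int_Z] by simp
    show "\<exists>k0. \<forall>k\<ge>k0. norm ((\<integral>x. Y k x \<partial>M) - (\<integral>x. Z x \<partial>M)) < r"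
    proof (intro exI[of _ k0] allI impI)
      fix k assume "k \<ge> k0"
      from k0[OF this] diff[OF Y[of k]] K(2)[of k] * \<open>0 < r\<close>
      show "norm ((\<integral>x. Y k x \<partial>M) - (\<integral>x. Z x \<partial>M)) < r"
        by (simp add: abs_if split: if_splits)
    qed
  qed
qed

section \<open>Approximation of times\<close>

lemma right_continuous_sequentially:
  fixes f :: "real \<Rightarrow> real"
  assumes "(f \<longlongrightarrow> f t) (at_right t)" "\<And>k. t \<le> s k" "s \<longlonglongrightarrow> t"
  shows "(\<lambda>k. f (s k)) \<longlonglongrightarrow> f t"
proof -
  have "at t within {t..} = at_right t"
    unfolding at_within_def by (rule arg_cong2[where f=inf]) auto
  then have "continuous (at t within {t..}) f"
    using assms(1) by (simp add: continuous_within)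
  then show ?thesis
    using assms(2,3) unfolding continuous_within_sequentially by (auto simp: o_def)
qed

text \<open>The least multiple of \<open>1 / (k + 1)\<close> strictly above \<open>x\<close>. Being
  strict even at grid points, it has half-open cells \<open>[v, u)\<close> as preimages, and these
  can be expressed by events of the form \<open>{T < t}\<close>. The grids are not nested in
  \<open>k\<close>; only convergence from the right is used.\<close>

definition next_grid :: "nat \<Rightarrow> real \<Rightarrow> real" where
  "next_grid k x = (of_int \<lfloor>real (Suc k) * x\<rfloor> + 1) / real (Suc k)"

lemma next_grid_gt: "x < next_grid k x"
proof -
  have "real (Suc k) * x < of_int \<lfloor>real (Suc k) * x\<rfloor> + 1" by linarith
  then show ?thesis unfolding next_grid_def by (subst pos_less_divide_eq) (simp_all add: mult.commute)
qed

lemma next_grid_le: "next_grid k x \<le> x + 1 / real (Suc k)"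
proof -
  have "of_int \<lfloor>real (Suc k) * x\<rfloor> / real (Suc k) \<le> (real (Suc k) * x) / real (Suc k)"
    by (rule divide_right_mono) auto
  then show ?thesis unfolding next_grid_def add_divide_distrib by simp
qed

lemma next_grid_tendsto: "(\<lambda>k. next_grid k x) \<longlonglongrightarrow> x"
proof (rule tendsto_sandwich[where f="\<lambda>_. x" and h="\<lambda>k. x + 1 / real (Suc k)"])
  show "(\<lambda>k. x + 1 / real (Suc k)) \<longlonglongrightarrow> x"
    using tendsto_add[OF tendsto_const[of x] LIMSEQ_inverse_real_of_nat] by (simp add: inverse_eq_divide)
qed (auto intro!: always_eventually less_imp_le next_grid_gt next_grid_le simp del: of_nat_Suc)

lemma next_grid_Rats: "next_grid k x \<in> \<rat>"
  unfolding next_grid_def by auto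

lemma next_grid_eq_iff:
  "next_grid k x = (of_int i + 1) / real (Suc k) \<longleftrightarrow> of_int i / real (Suc k) \<le> x \<and> x < (of_int i + 1) / real (Suc k)"
proof -
  have "next_grid k x = (of_int i + 1) / real (Suc k) \<longleftrightarrow> \<lfloor>real (Suc k) * x\<rfloor> = i"
    unfolding next_grid_def by (simp add: field_simps)
  also have "\<dots> \<longleftrightarrow> of_int i \<le> real (Suc k) * x \<and> real (Suc k) * x < of_int i + 1"
    by (simp add: floor_eq_iff)
  finally show ?thesis by (simp add: field_simps)
qed

definition grid_set :: "nat \<Rightarrow> real \<Rightarrow> real set" where
  "grid_set k c = (\<lambda>i::int. (of_int i + 1) / real (Suc k)) ` {0..\<lfloor>real (Suc k) * c\<rfloor>}"

lemma finite_grid_set [simp]: "finite (grid_set k c)"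
  by (simp add: grid_set_def)

lemma next_grid_in_grid_set:
  assumes "0 \<le> x" "x \<le> c"
  shows "next_grid k x \<in> grid_set k c"
  unfolding grid_set_def next_grid_def
  by (rule image_eqI[of _ _ "\<lfloor>real (Suc k) * x\<rfloor>"])
     (use assms in \<open>auto intro!: floor_mono mult_left_mono\<close>)

text \<open>Rounding up overshoots \<open>c\<close> by at most one mesh width, hence by at most 1:
  this is the origin of the horizon \<open>c + 1\<close> in later statements about times bounded by
  \<open>c\<close>. The third, sharper bound gives measurability at any time after
  \<open>c\<close>.\<close>

lemma grid_set_bounds:
  assumes "u \<in> grid_set k c"
  shows "0 < u" "u \<le> c + 1" "u \<le> c + 1 / real (Suc k)"
proof -
  obtain i :: int where i: "0 \<le> i" "i \<le> \<lfloor>real (Suc k) * c\<rfloor>" "u = (of_int i + 1) / real (Suc k)"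
    using assms by (auto simp: grid_set_def)
  then have "of_int i \<le> real (Suc k) * c" by linarith
  then have "of_int i / real (Suc k) \<le> (real (Suc k) * c) / real (Suc k)"
    by (intro divide_right_mono) auto
  then show "u \<le> c + 1 / real (Suc k)"
    unfolding i(3) add_divide_distrib by simp
  moreover have "1 / real (Suc k) \<le> 1" by simp
  ultimately show "u \<le> c + 1" by linarith
  show "0 < u" using i by simp
qed

section \<open>Truncation of extended times to bounded real times\<close>

definition cut_time :: "real \<Rightarrow> ennreal \<Rightarrow> real" where
  "cut_time c x = enn2real (min x (ennreal c))"

lemma ennreal_cut_time: "ennreal (cut_time c x) = min x (ennreal c)"
proof -
  have "min x (ennreal c) < top" by (simp add: min_less_iff_disj)
  then show ?thesis unfolding cut_time_def by (simp add: less_top)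
qed

lemma cut_time_nonneg: "0 \<le> cut_time c x"
  by (simp add: cut_time_def)

lemma cut_time_le: "0 \<le> c \<Longrightarrow> cut_time c x \<le> c"
  using ennreal_cut_time[of c x] by (metis ennreal_le_iff min.cobounded2)

text \<open>Up to time \<open>c\<close> truncation leaves the event \<open>{T < t}\<close> alone,
  and after \<open>c\<close> it makes the event trivial. So truncated times inherit the
  measurability of these events.\<close>

lemma cut_time_less_iff:
  assumes "0 \<le> c" "0 \<le> t"
  shows "cut_time c x < t \<longleftrightarrow> c < t \<or> x < ennreal t"
proof -
  have "cut_time c x < t \<longleftrightarrow> min x (ennreal c) < ennreal t"
    using ennreal_cut_time[of c x] assms cut_time_nonneg[of c x] by (metis ennreal_less_iff)
  also have "\<dots> \<longleftrightarrow> c < t \<or> x < ennreal t"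
    using assms by (auto simp: min_less_iff_disj ennreal_less_iff)
  finally show ?thesis .
qed

lemma cut_time_mono: "x \<le> y \<Longrightarrow> cut_time c x \<le> cut_time c y"
  unfolding cut_time_def by (intro enn2real_mono min.mono) (auto simp: min_less_iff_disj)

lemma cut_time_ennreal: "0 \<le> x \<Longrightarrow> x \<le> c \<Longrightarrow> cut_time c (ennreal x) = x"
  by (simp add: cut_time_def min_def ennreal_leI)

lemma cut_time_eq: "0 \<le> c \<Longrightarrow> ennreal c \<le> x \<Longrightarrow> cut_time c x = c"
  by (simp add: cut_time_def min_absorb2)

lemma cut_time_le_imp_eq: "x \<le> ennreal c \<Longrightarrow> cut_time c x = enn2real x"
  by (simp add: cut_time_def min_absorb1)

lemma ennreal_eq_top_iff_less_nat: "x = \<infinity> \<longleftrightarrow> (\<forall>n. ennreal (real n) < x)"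
proof
  assume *: "\<forall>n. ennreal (real n) < x"
  show "x = \<infinity>"
  proof (rule ccontr)
    assume "x \<noteq> \<infinity>"
    then obtain n where "x < of_nat n"
      using ennreal_Ex_less_of_nat[of x] by (auto simp: less_top)
    then show False using * by (metis ennreal_of_nat_eq_real_of_nat less_asym)
  qed
qed simp

section \<open>Optional stopping\<close>

context filtered_prob_space
begin

lemma space_F: "0 \<le> t \<Longrightarrow> space (F t) = space M"
  using filtration.space_F[OF real_filtration[unfolded real_filtration_def], of "ennreal t"]
  by (simp add: extend_filtration_def)

lemma sets_F_mono:
  assumes "0 \<le> s" "s \<le> t"
  shows "sets (F s) \<subseteq> sets (F t)"
proof -
  have "sets (extend_filtration (space M) F (ennreal s)) \<subseteq> sets (extend_filtration (space M) F (ennreal t))"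
    by (rule filtration.sets_F_mono[OF real_filtration[unfolded real_filtration_def]])
       (simp add: assms ennreal_leI)
  then show ?thesis using assms by (simp add: extend_filtration_def)
qed

lemma space_in_sets_F: "0 \<le> t \<Longrightarrow> space M \<in> sets (F t)"
  using sets.top[of "F t"] by (simp add: space_F)

lemma subalgebra_F: "0 \<le> t \<Longrightarrow> subalgebra M (F t)"
  using sets_F_subset space_F by (auto simp: subalgebra_def)

lemma measurable_F_M: "f \<in> borel_measurable (F t) \<Longrightarrow> 0 \<le> t \<Longrightarrow> f \<in> borel_measurable M"
  using measurable_from_subalg[OF subalgebra_F] .

lemma measurable_F_mono:
  "f \<in> borel_measurable (F s) \<Longrightarrow> 0 \<le> s \<Longrightarrow> s \<le> t \<Longrightarrow> f \<in> borel_measurable (F t)"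
  by (rule measurable_from_subalg[of "F t" "F s"]) (use sets_F_mono space_F in \<open>auto simp: subalgebra_def\<close>)

section \<open>Martingales stopped at times with finitely many values\<close>

lemma integrable_bounded_mult:
  fixes h f :: "'a \<Rightarrow> real"
  assumes "integrable M f" "h \<in> borel_measurable M" "\<And>\<omega>. \<omega> \<in> space M \<Longrightarrow> \<bar>h \<omega>\<bar> \<le> C"
  shows "integrable M (\<lambda>\<omega>. h \<omega> * f \<omega>)"
proof (rule Bochner_Integration.integrable_bound)
  show "integrable M (\<lambda>\<omega>. C * \<bar>f \<omega>\<bar>)" using assms(1) by auto
  show "AE \<omega> in M. norm (h \<omega> * f \<omega>) \<le> norm (C * \<bar>f \<omega>\<bar>)"
    by (rule AE_I2) (use assms(3) in \<open>fastforce simp: abs_mult intro!: mult_right_mono\<close>)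
qed (use assms in auto)

lemma martingale_integral_mult:
  assumes N: "martingale M F N" and st: "0 \<le> s" "s \<le> t"
    and h: "h \<in> borel_measurable (F s)" "\<And>\<omega>. \<omega> \<in> space M \<Longrightarrow> \<bar>h \<omega>\<bar> \<le> C"
  shows "(\<integral>\<omega>. h \<omega> * N t \<omega> \<partial>M) = (\<integral>\<omega>. h \<omega> * N s \<omega> \<partial>M)"
proof -
  interpret S: finite_measure_subalgebra M "F s"
    by unfold_locales (rule subalgebra_F[OF st(1)])
  have Nt: "integrable M (N t)" using N st by (auto simp: martingale_def)
  have hM: "h \<in> borel_measurable M" using measurable_F_M[OF h(1) st(1)] .
  have "(\<integral>\<omega>. h \<omega> * N t \<omega> \<partial>M) = (\<integral>\<omega>. h \<omega> * real_cond_exp M (F s) (N t) \<omega> \<partial>M)"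
    by (rule S.real_cond_exp_intg(2)[symmetric])
       (use integrable_bounded_mult[OF Nt hM h(2)] h(1) Nt in auto)
  also have "\<dots> = (\<integral>\<omega>. h \<omega> * N s \<omega> \<partial>M)"
  proof (rule integral_cong_AE)
    have "N s \<in> borel_measurable M" using N st by (auto simp: martingale_def)
    then show "(\<lambda>\<omega>. h \<omega> * N s \<omega>) \<in> borel_measurable M" using hM by auto
    have "AE \<omega> in M. real_cond_exp M (F s) (N t) \<omega> = N s \<omega>" using N st by (auto simp: martingale_def)
    then show "AE \<omega> in M. h \<omega> * real_cond_exp M (F s) (N t) \<omega> = h \<omega> * N s \<omega>" by eventually_elim simp
  qed (use hM in auto)
  finally show ?thesis .
qed

lemma simple_stopped_measurable:
  assumes N: "\<And>u. u \<in> J \<Longrightarrow> N u \<in> borel_measurable M'" and J: "finite J"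
    and S: "\<And>\<omega>. \<omega> \<in> space M' \<Longrightarrow> S \<omega> \<in> J" "\<And>u. u \<in> J \<Longrightarrow> {\<omega>\<in>space M'. S \<omega> = u} \<in> sets M'"
  shows "(\<lambda>\<omega>. N (S \<omega>) \<omega> :: real) \<in> borel_measurable M'"
proof -
  have "(\<lambda>\<omega>. \<Sum>u\<in>J. indicator {\<omega>\<in>space M'. S \<omega> = u} \<omega> * N u \<omega>) \<in> borel_measurable M'"
    using N S(2) by (intro borel_measurable_sum borel_measurable_times borel_measurable_indicator)
  moreover have "(\<Sum>u\<in>J. indicator {\<omega>\<in>space M'. S \<omega> = u} \<omega> * N u \<omega>) = N (S \<omega>) \<omega>" if "\<omega> \<in> space M'" for \<omega>
    using S(1)[OF that] that J by (subst sum.remove[of _ "S \<omega>"]) (auto intro!: sum.neutral)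
  ultimately show ?thesis by (subst measurable_cong[symmetric]) auto
qed

text \<open>Splitting \<open>h\<close> along the values of \<open>S\<close> reduces the claim to
  constant times: each piece is \<open>F u\<close>-measurable, so the martingale property moves
  \<open>N u\<close> to \<open>N c\<close>. The condition on the pieces says that \<open>h\<close>
  is known at time \<open>S\<close>. General bounded \<open>h\<close> are allowed because
  indicators, signs and slopes are all inserted later.\<close>

lemma martingale_simple_stopping:
  assumes N: "martingale M F N" and J: "finite J" "\<And>u. u \<in> J \<Longrightarrow> 0 \<le> u \<and> u \<le> c"
    and S: "\<And>\<omega>. \<omega> \<in> space M \<Longrightarrow> S \<omega> \<in> J"
    and h: "\<And>\<omega>. \<omega> \<in> space M \<Longrightarrow> \<bar>h \<omega>\<bar> \<le> C"
    and hS: "\<And>u. u \<in> J \<Longrightarrow> (\<lambda>\<omega>. h \<omega> * indicator {\<omega>. S \<omega> = u} \<omega>) \<in> borel_measurable (F u)"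
  shows "integrable M (\<lambda>\<omega>. h \<omega> * N (S \<omega>) \<omega>)"
    and "(\<integral>\<omega>. h \<omega> * N (S \<omega>) \<omega> \<partial>M) = (\<integral>\<omega>. h \<omega> * N c \<omega> \<partial>M)"
proof -
  let ?h = "\<lambda>u \<omega>. h \<omega> * indicator {\<omega>. S \<omega> = u} \<omega>"
  have hM: "?h u \<in> borel_measurable M" if "u \<in> J" for u
    using measurable_F_M[OF hS[OF that]] J(2)[OF that] by auto
  have C0: "0 \<le> C" using h not_empty by fastforce
  have hb: "\<bar>?h u \<omega>\<bar> \<le> C" if "\<omega> \<in> space M" for u \<omega>
    using h[OF that] C0 by (auto split: split_indicator)
  have int: "integrable M (\<lambda>\<omega>. ?h u \<omega> * N v \<omega>)" if "u \<in> J" "0 \<le> v" for u v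
    by (rule integrable_bounded_mult[OF _ hM[OF that(1)] hb]) (use N that in \<open>auto simp: martingale_def\<close>)
  have sum_S: "(\<Sum>u\<in>J. ?h u \<omega> * f u) = h \<omega> * f (S \<omega>)" if "\<omega> \<in> space M" for \<omega> and f :: "real \<Rightarrow> real"
    using S[OF that] J(1) by (subst sum.remove[of _ "S \<omega>"]) (auto intro!: sum.neutral)
  have "integrable M (\<lambda>\<omega>. \<Sum>u\<in>J. ?h u \<omega> * N u \<omega>)"
    using int J by auto
  then show "integrable M (\<lambda>\<omega>. h \<omega> * N (S \<omega>) \<omega>)"
    by (rule Bochner_Integration.integrable_cong[THEN iffD1, rotated 2]) (auto simp: sum_S)
  have "(\<integral>\<omega>. h \<omega> * N (S \<omega>) \<omega> \<partial>M) = (\<integral>\<omega>. (\<Sum>u\<in>J. ?h u \<omega> * N u \<omega>) \<partial>M)"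
    by (rule Bochner_Integration.integral_cong) (auto simp: sum_S)
  also have "\<dots> = (\<Sum>u\<in>J. \<integral>\<omega>. ?h u \<omega> * N u \<omega> \<partial>M)"
    using int J by (intro Bochner_Integration.integral_sum) auto
  also have "\<dots> = (\<Sum>u\<in>J. \<integral>\<omega>. ?h u \<omega> * N c \<omega> \<partial>M)"
    using J(2) by (intro sum.cong refl martingale_integral_mult[OF N _ _ hS hb, symmetric]) auto
  also have "\<dots> = (\<integral>\<omega>. (\<Sum>u\<in>J. ?h u \<omega> * N c \<omega>) \<partial>M)"
    by (rule Bochner_Integration.integral_sum[symmetric]) (use int J(2) in force)
  also have "\<dots> = (\<integral>\<omega>. h \<omega> * N c \<omega> \<partial>M)"
    by (rule Bochner_Integration.integral_cong) (auto simp: sum_S)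
  finally show "(\<integral>\<omega>. h \<omega> * N (S \<omega>) \<omega> \<partial>M) = (\<integral>\<omega>. h \<omega> * N c \<omega> \<partial>M)" .
qed

text \<open>Duality: with \<open>h\<close> the sign of \<open>N S\<close> where
  \<open>\<bar>N S\<bar> > K\<close> and 0 elsewhere, the excess of \<open>N S\<close> equals
  \<open>h * N S - K * \<bar>h\<bar>\<close>. Simple stopping replaces \<open>N S\<close> by
  \<open>N c\<close> here, and \<open>h * N c - K * \<bar>h\<bar>\<close> never exceeds the excess
  of \<open>N c\<close>.\<close>

lemma martingale_simple_stopping_tail:
  assumes N: "martingale M F N" and J: "finite J" "\<And>u. u \<in> J \<Longrightarrow> 0 \<le> u \<and> u \<le> c" and c: "0 \<le> c"
    and S: "\<And>\<omega>. \<omega> \<in> space M \<Longrightarrow> S \<omega> \<in> J" "\<And>u. u \<in> J \<Longrightarrow> {\<omega>\<in>space M. S \<omega> = u} \<in> sets (F u)"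
    and K: "0 \<le> K"
  shows "(\<integral>\<omega>. max (\<bar>N (S \<omega>) \<omega>\<bar> - K) 0 \<partial>M) \<le> (\<integral>\<omega>. max (\<bar>N c \<omega>\<bar> - K) 0 \<partial>M)"
proof -
  define h where "h \<omega> = (if K < \<bar>N (S \<omega>) \<omega>\<bar> then sgn (N (S \<omega>) \<omega>) else 0)" for \<omega>
  have Nu: "N u \<in> borel_measurable (F u)" if "u \<in> J" for u
    using N J(2)[OF that] by (auto simp: martingale_def adapted_def)
  have hS: "(\<lambda>\<omega>. h \<omega> * indicator {\<omega>. S \<omega> = u} \<omega>) \<in> borel_measurable (F u)" if "u \<in> J" for u
  proof -
    have [measurable]: "{\<omega>\<in>space M. S \<omega> = u} \<in> sets (F u)" "N u \<in> borel_measurable (F u)"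
      using S(2)[OF that] Nu[OF that] by auto
    have "(\<lambda>\<omega>. (if K < \<bar>N u \<omega>\<bar> then sgn (N u \<omega>) else 0) * indicator {\<omega>\<in>space M. S \<omega> = u} \<omega>) \<in> borel_measurable (F u)"
      by measurable
    then show ?thesis
      by (rule measurable_cong[THEN iffD1, rotated])
         (use J(2)[OF that] in \<open>auto simp: h_def space_F split: split_indicator\<close>)
  qed
  have hb: "\<bar>h \<omega>\<bar> \<le> 1" for \<omega> by (auto simp: h_def sgn_if)
  have hab: "(\<lambda>\<omega>. \<bar>h \<omega>\<bar> * indicator {\<omega>. S \<omega> = u} \<omega>) \<in> borel_measurable (F u)" if "u \<in> J" for u
    using borel_measurable_abs[OF hS[OF that]] by (simp add: abs_mult)
  note OS = martingale_simple_stopping[OF N J S(1) hb hS]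
  have Nc: "integrable M (N c)" using N c by (auto simp: martingale_def)
  have "(\<lambda>\<omega>. N (S \<omega>) \<omega>) \<in> borel_measurable M"
    by (rule simple_stopped_measurable[OF _ J(1) S(1)])
       (use S(2) J(2) sets_F_subset measurable_F_M Nu in blast)+
  then have hM: "h \<in> borel_measurable M" unfolding h_def by measurable
  have int_h: "integrable M (\<lambda>\<omega>. K * \<bar>h \<omega>\<bar>)"
    by (rule integrable_const_bound[where B=K]) (use hb K hM mult_left_le in \<open>auto simp: abs_mult\<close>)
  have int_hN: "integrable M (\<lambda>\<omega>. h \<omega> * N c \<omega>)" by (rule integrable_bounded_mult[OF Nc hM hb])
  have "(\<integral>\<omega>. max (\<bar>N (S \<omega>) \<omega>\<bar> - K) 0 \<partial>M) = (\<integral>\<omega>. h \<omega> * N (S \<omega>) \<omega> - K * \<bar>h \<omega>\<bar> \<partial>M)"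
    by (rule Bochner_Integration.integral_cong) (use K in \<open>auto simp: h_def sgn_if\<close>)
  also have "\<dots> = (\<integral>\<omega>. h \<omega> * N c \<omega> - K * \<bar>h \<omega>\<bar> \<partial>M)"
    using OS int_h int_hN by simp
  also have "\<dots> \<le> (\<integral>\<omega>. max (\<bar>N c \<omega>\<bar> - K) 0 \<partial>M)"
  proof (rule integral_mono)
    show "integrable M (\<lambda>\<omega>. max (\<bar>N c \<omega>\<bar> - K) 0)"
      by (rule integrable_excess[OF Nc K])
    show "h \<omega> * N c \<omega> - K * \<bar>h \<omega>\<bar> \<le> max (\<bar>N c \<omega>\<bar> - K) 0" for \<omega>
      using K by (auto simp: h_def sgn_if)
  qed (use int_h int_hN in auto)
  finally show ?thesis .
qed

text \<open>
  The strict inequality makes hitting times of open sets stopping times without any assumption on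
  the filtration.
\<close>

definition weak_stopping :: "('a \<Rightarrow> real) \<Rightarrow> real \<Rightarrow> bool" where
  "weak_stopping T c \<longleftrightarrow> (\<forall>\<omega>\<in>space M. 0 \<le> T \<omega> \<and> T \<omega> \<le> c) \<and>
     (\<forall>t\<ge>0. {\<omega>\<in>space M. T \<omega> < t} \<in> sets (F t))"

text \<open>The cell that is rounded up to \<open>u\<close> is half open, so the event is a
  difference of \<open>{T < u}\<close> and \<open>{T < v}\<close> with \<open>v\<close> the
  preceding grid point. The condition on \<open>\<Lambda>\<close>, which recurs below, says that
  \<open>\<Lambda>\<close> is known immediately after \<open>T\<close>.\<close>

lemma weak_stopping_grid:
  assumes T: "weak_stopping T c" and L: "\<And>t. 0 \<le> t \<Longrightarrow> {\<omega>\<in>\<Lambda>. T \<omega> < t} \<in> sets (F t)"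
    and u: "u \<in> grid_set k c"
  shows "{\<omega>\<in>\<Lambda>. next_grid k (T \<omega>) = u} \<in> sets (F u)"
proof -
  obtain i :: int where i: "0 \<le> i" "u = (of_int i + 1) / real (Suc k)"
    using u by (auto simp: grid_set_def)
  define v where "v = of_int i / real (Suc k)"
  have v: "0 \<le> v" "v \<le> u" using i by (auto simp: v_def divide_right_mono)
  have "{\<omega>\<in>\<Lambda>. next_grid k (T \<omega>) = u} = {\<omega>\<in>\<Lambda>. T \<omega> < u} - {\<omega>\<in>\<Lambda>. T \<omega> < v}"
    unfolding i(2) next_grid_eq_iff v_def by auto
  also have "\<dots> \<in> sets (F u)"
    using L[of u] L[of v] v sets_F_mono[of v u] by auto
  finally show ?thesis .
qed

lemma grid_indicator_measurable:
  assumes T: "weak_stopping T c" and L: "\<And>t. 0 \<le> t \<Longrightarrow> {\<omega>\<in>\<Lambda>. T \<omega> < t} \<in> sets (F t)"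
    and u: "u \<in> grid_set k c"
  shows "(\<lambda>\<omega>. indicator \<Lambda> \<omega> * indicator {\<omega>. next_grid k (T \<omega>) = u} \<omega> :: real) \<in> borel_measurable (F u)"
proof -
  have "{\<omega>\<in>\<Lambda>. next_grid k (T \<omega>) = u} \<in> sets (F u)" by (rule weak_stopping_grid[OF T L u])
  then have "(indicator {\<omega>\<in>\<Lambda>. next_grid k (T \<omega>) = u} :: 'a \<Rightarrow> real) \<in> borel_measurable (F u)" by simp
  also have "indicator {\<omega>\<in>\<Lambda>. next_grid k (T \<omega>) = u} =
      (\<lambda>\<omega>. indicator \<Lambda> \<omega> * indicator {\<omega>. next_grid k (T \<omega>) = u} \<omega> :: real)"
    by (auto split: split_indicator)
  finally show ?thesis .
qed

text \<open>Approximation from the right looks beyond \<open>T\<close>, but only by one mesh width.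
  Once that is below \<open>s - c\<close>, all grid values are at most \<open>s\<close>, and
  right-continuity takes the limit inside \<open>F s\<close>.\<close>

lemma weak_stopping_value_measurable_after:
  assumes T: "weak_stopping T c" and c: "0 \<le> c" "c < s" and N: "adapted F N"
    and rc: "\<And>\<omega> t. \<omega> \<in> space M \<Longrightarrow> 0 \<le> t \<Longrightarrow> ((\<lambda>t. N t \<omega>) \<longlongrightarrow> N t \<omega>) (at_right t)"
  shows "(\<lambda>\<omega>. N (T \<omega>) \<omega>) \<in> borel_measurable (F s)"
proof -
  obtain k0 where k0: "1 / real (Suc k0) < s - c" using nat_approx_posE[of "s - c"] c by auto
  have sp: "space (F s) = space M" using c by (intro space_F) auto
  show ?thesis
  proof (rule borel_measurable_LIMSEQ_real)
    fix k
    let ?k = "k + k0"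
    show "(\<lambda>\<omega>. N (next_grid ?k (T \<omega>)) \<omega>) \<in> borel_measurable (F s)"
    proof (rule simple_stopped_measurable[where N=N and S="\<lambda>\<omega>. next_grid ?k (T \<omega>)", OF _ finite_grid_set[of ?k c]])
      fix u assume u: "u \<in> grid_set ?k c"
      have "1 / real (Suc ?k) \<le> 1 / real (Suc k0)" by (simp add: frac_le)
      then have ub: "0 < u" "u \<le> s" using grid_set_bounds[OF u] k0 by linarith+
      show "N u \<in> borel_measurable (F s)"
        by (rule measurable_F_mono[of _ u]) (use N ub in \<open>auto simp: adapted_def\<close>)
      have "{\<omega>\<in>space M. next_grid ?k (T \<omega>) = u} \<in> sets (F u)"
        by (rule weak_stopping_grid[OF T _ u]) (use T in \<open>auto simp: weak_stopping_def\<close>)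
      then show "{\<omega>\<in>space (F s). next_grid ?k (T \<omega>) = u} \<in> sets (F s)"
        using sets_F_mono[of u s] ub by (auto simp: sp)
    next
      fix \<omega> assume "\<omega> \<in> space (F s)"
      then show "next_grid ?k (T \<omega>) \<in> grid_set ?k c"
        using T by (intro next_grid_in_grid_set) (auto simp: sp weak_stopping_def)
    qed
  next
    fix \<omega> assume "\<omega> \<in> space (F s)"
    then have "\<omega> \<in> space M" "0 \<le> T \<omega>" using T sp by (auto simp: weak_stopping_def)
    then show "(\<lambda>k. N (next_grid (k + k0) (T \<omega>)) \<omega>) \<longlonglongrightarrow> N (T \<omega>) \<omega>"
      by (intro right_continuous_sequentially[where f="\<lambda>t. N t \<omega>"] rc
          LIMSEQ_ignore_initial_segment[OF next_grid_tendsto] less_imp_le[OF next_grid_gt])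
  qed
qed

lemma weak_stopping_value_measurable:
  assumes T: "weak_stopping T c" and c: "0 \<le> c" and N: "adapted F N"
    and rc: "\<And>\<omega> t. \<omega> \<in> space M \<Longrightarrow> 0 \<le> t \<Longrightarrow> ((\<lambda>t. N t \<omega>) \<longlongrightarrow> N t \<omega>) (at_right t)"
  shows "(\<lambda>\<omega>. N (T \<omega>) \<omega>) \<in> borel_measurable (F (c + 1))"
  by (rule weak_stopping_value_measurable_after[OF T c _ N rc]) simp_all

text \<open>At the grid times approaching \<open>T\<close> from the right, the expectation does not
  depend on \<open>k\<close>. The limit exists by \<open>vitali_convergence\<close>, since
  \<open>martingale_simple_stopping_tail\<close> bounds all excesses by that of the single
  integrable variable \<open>N (c + 1)\<close>.\<close>

theorem optional_stopping:
  assumes N: "martingale M F N"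
    and rc: "\<And>\<omega> t. \<omega> \<in> space M \<Longrightarrow> 0 \<le> t \<Longrightarrow> ((\<lambda>t. N t \<omega>) \<longlongrightarrow> N t \<omega>) (at_right t)"
    and T: "weak_stopping T c" and c: "0 \<le> c"
    and L: "\<Lambda> \<in> sets M" "\<And>t. 0 \<le> t \<Longrightarrow> {\<omega>\<in>\<Lambda>. T \<omega> < t} \<in> sets (F t)"
  shows "integrable M (\<lambda>\<omega>. indicator \<Lambda> \<omega> * N (T \<omega>) \<omega>)"
    and "(\<integral>\<omega>. indicator \<Lambda> \<omega> * N (T \<omega>) \<omega> \<partial>M) = (\<integral>\<omega>. indicator \<Lambda> \<omega> * N (c + 1) \<omega> \<partial>M)"
proof -
  let ?S = "\<lambda>k \<omega>. next_grid k (T \<omega>)"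
  let ?Y = "\<lambda>k \<omega>. indicator \<Lambda> \<omega> * N (?S k \<omega>) \<omega>"
  have ad: "adapted F N" using N by (auto simp: martingale_def)
  have Lsp: "\<Lambda> \<subseteq> space M" using L(1) sets.sets_into_space by auto
  have J: "0 \<le> u \<and> u \<le> c + 1" if "u \<in> grid_set k c" for u k
    using grid_set_bounds[OF that] by auto
  have SJ: "?S k \<omega> \<in> grid_set k c" if "\<omega> \<in> space M" for k \<omega>
    using that T by (intro next_grid_in_grid_set) (auto simp: weak_stopping_def)
  have Su: "{\<omega>\<in>space M. ?S k \<omega> = u} \<in> sets (F u)" if "u \<in> grid_set k c" for u k
    by (rule weak_stopping_grid[OF T _ that]) (use T in \<open>auto simp: weak_stopping_def\<close>)
  have hS: "(\<lambda>\<omega>. indicator \<Lambda> \<omega> * indicator {\<omega>. ?S k \<omega> = u} \<omega> :: real) \<in> borel_measurable (F u)"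
    if "u \<in> grid_set k c" for u k
    by (rule grid_indicator_measurable[OF T L(2) that])
  have Ym: "integrable M (?Y k)" "(\<integral>\<omega>. ?Y k \<omega> \<partial>M) = (\<integral>\<omega>. indicator \<Lambda> \<omega> * N (c + 1) \<omega> \<partial>M)" for k
    by (rule martingale_simple_stopping[OF N finite_grid_set J SJ _ hS, where C=1]; simp split: split_indicator)+
  have NT: "(\<lambda>\<omega>. N (T \<omega>) \<omega>) \<in> borel_measurable M"
    using weak_stopping_value_measurable[OF T c ad rc] c by (auto intro: measurable_F_M[of _ "c + 1"])
  have NSi: "integrable M (\<lambda>\<omega>. N (?S k \<omega>) \<omega>)" for k
  proof -
    have "integrable M (\<lambda>\<omega>. (1::real) * N (?S k \<omega>) \<omega>)"
    proof (rule martingale_simple_stopping(1)[OF N finite_grid_set J SJ])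
      fix u assume u: "u \<in> grid_set k c"
      have "(indicator {\<omega>\<in>space M. ?S k \<omega> = u} :: 'a \<Rightarrow> real) \<in> borel_measurable (F u)" using Su[OF u] by simp
      then show "(\<lambda>\<omega>. 1 * indicator {\<omega>. ?S k \<omega> = u} \<omega> :: real) \<in> borel_measurable (F u)"
        by (rule measurable_cong[THEN iffD1, rotated])
           (use J[OF u] in \<open>auto simp: space_F split: split_indicator\<close>)
    qed auto
    then show ?thesis by simp
  qed
  have Nc: "integrable M (N (c + 1))" using N c by (auto simp: martingale_def)
  have Zm: "(\<lambda>\<omega>. indicator \<Lambda> \<omega> * N (T \<omega>) \<omega>) \<in> borel_measurable M" using NT L(1) by auto
  have lim: "AE \<omega> in M. (\<lambda>k. ?Y k \<omega>) \<longlonglongrightarrow> indicator \<Lambda> \<omega> * N (T \<omega>) \<omega>"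
    proof (rule AE_I2)
      fix \<omega> assume \<omega>: "\<omega> \<in> space M"
      then have "0 \<le> T \<omega>" using T by (auto simp: weak_stopping_def)
      then show "(\<lambda>k. ?Y k \<omega>) \<longlonglongrightarrow> indicator \<Lambda> \<omega> * N (T \<omega>) \<omega>"
        by (intro tendsto_intros right_continuous_sequentially[where f="\<lambda>t. N t \<omega>"] rc \<omega>
            next_grid_tendsto less_imp_le[OF next_grid_gt])
    qed
  have ui: "\<exists>K\<ge>0. \<forall>k. (\<integral>\<omega>. max (\<bar>?Y k \<omega>\<bar> - K) 0 \<partial>M) \<le> e" if "0 < e" for e
  proof -
    from that obtain K where K: "0 \<le> K" "(\<integral>\<omega>. max (\<bar>N (c + 1) \<omega>\<bar> - K) 0 \<partial>M) \<le> e"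
      using integral_tail_tendsto_zero[OF Nc] by blast
    have "(\<integral>\<omega>. max (\<bar>?Y k \<omega>\<bar> - K) 0 \<partial>M) \<le> e" for k
    proof -
      have "(\<integral>\<omega>. max (\<bar>?Y k \<omega>\<bar> - K) 0 \<partial>M) \<le> (\<integral>\<omega>. max (\<bar>N (?S k \<omega>) \<omega>\<bar> - K) 0 \<partial>M)"
      proof (rule integral_mono)
        show "integrable M (\<lambda>\<omega>. max (\<bar>?Y k \<omega>\<bar> - K) 0)"
          by (rule integrable_excess[OF Ym(1) K(1)])
        show "integrable M (\<lambda>\<omega>. max (\<bar>N (?S k \<omega>) \<omega>\<bar> - K) 0)"
          by (rule integrable_excess[OF NSi K(1)])
      qed (use K in \<open>auto split: split_indicator\<close>)
      also have "\<dots> \<le> (\<integral>\<omega>. max (\<bar>N (c + 1) \<omega>\<bar> - K) 0 \<partial>M)"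
        by (rule martingale_simple_stopping_tail[OF N finite_grid_set J _ SJ Su K(1)]) (use c in auto)
      finally show ?thesis using K by simp
    qed
    then show "\<exists>K\<ge>0. \<forall>k. (\<integral>\<omega>. max (\<bar>?Y k \<omega>\<bar> - K) 0 \<partial>M) \<le> e" using K by blast
  qed
  note V = vitali_convergence[OF Ym(1) Zm lim ui]
  show "integrable M (\<lambda>\<omega>. indicator \<Lambda> \<omega> * N (T \<omega>) \<omega>)" by (rule V)
  show "(\<integral>\<omega>. indicator \<Lambda> \<omega> * N (T \<omega>) \<omega> \<partial>M) = (\<integral>\<omega>. indicator \<Lambda> \<omega> * N (c + 1) \<omega> \<partial>M)"
    using LIMSEQ_unique[OF V(2)] unfolding Ym(2) by auto
qed

lemma weak_stopping_cut_time:
  assumes c: "0 \<le> c" and \<tau>: "\<And>t. 0 \<le> t \<Longrightarrow> {\<omega>\<in>space M. \<tau> \<omega> < ennreal t} \<in> sets (F t)"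
  shows "weak_stopping (\<lambda>\<omega>. cut_time c (\<tau> \<omega>)) c"
  unfolding weak_stopping_def
proof (intro conjI allI impI ballI)
  fix t :: real assume t: "0 \<le> t"
  have "{\<omega>\<in>space M. cut_time c (\<tau> \<omega>) < t} = (if c < t then space (F t) else {\<omega>\<in>space M. \<tau> \<omega> < ennreal t})"
    using cut_time_less_iff[OF c t] t by (auto simp: space_F)
  then show "{\<omega>\<in>space M. cut_time c (\<tau> \<omega>) < t} \<in> sets (F t)" using \<tau>[OF t] by auto
qed (use c in \<open>auto simp: cut_time_nonneg cut_time_le\<close>)

lemma cut_time_sets:
  assumes c: "0 \<le> c" and L: "\<Lambda> \<in> sets (F c)"
    and \<tau>: "\<And>t. 0 \<le> t \<Longrightarrow> t \<le> c \<Longrightarrow> {\<omega>\<in>\<Lambda>. \<tau> \<omega> < ennreal t} \<in> sets (F t)" and t: "0 \<le> t"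
  shows "{\<omega>\<in>\<Lambda>. cut_time c (\<tau> \<omega>) < t} \<in> sets (F t)"
proof (cases "c < t")
  case True
  then have "{\<omega>\<in>\<Lambda>. cut_time c (\<tau> \<omega>) < t} = \<Lambda>" using cut_time_less_iff[OF c t] by auto
  then show ?thesis using L sets_F_mono[OF c, of t] True by auto
next
  case False
  then have "{\<omega>\<in>\<Lambda>. cut_time c (\<tau> \<omega>) < t} = {\<omega>\<in>\<Lambda>. \<tau> \<omega> < ennreal t}" using cut_time_less_iff[OF c t] by auto
  then show ?thesis using \<tau>[OF t] False by auto
qed

lemma weak_stopping_space: "weak_stopping T c \<Longrightarrow> 0 \<le> t \<Longrightarrow> {\<omega>\<in>space M. T \<omega> < t} \<in> sets (F t)"
  by (auto simp: weak_stopping_def)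

lemma weak_stopping_measurable:
  assumes T: "weak_stopping T c" shows "T \<in> borel_measurable M"
proof (rule borel_measurableI_less)
  fix t
  show "{\<omega>\<in>space M. T \<omega> < t} \<in> sets M"
  proof (cases "0 \<le> t")
    case True
    then show ?thesis using weak_stopping_space[OF T True] sets_F_subset[OF True] by auto
  next
    case False
    then have "\<not> T \<omega> < t" if "\<omega> \<in> space M" for \<omega> using T that by (force simp: weak_stopping_def)
    then have "{\<omega>\<in>space M. T \<omega> < t} = {}" by auto
    then show ?thesis by (simp only: sets.empty_sets)
  qed
qed

section \<open>Stopping times with values in the extended half-line\<close>

lemma filtration_extended: "filtration (space M) (extend_filtration (space M) F)"
  using real_filtration by (simp add: real_filtration_def)

lemma stopping_time_le_sets:
  assumes "is_stopping_time M F T" "0 \<le> t"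
  shows "{\<omega>\<in>space M. T \<omega> \<le> ennreal t} \<in> sets (F t)"
  using stopping_timeD[OF assms(1)[unfolded is_stopping_time_def], of "ennreal t"] assms(2)
  by (simp add: pred_def extend_filtration_def space_F)

lemma stopping_time_less_sets:
  assumes "is_stopping_time M F T" "0 \<le> t"
  shows "{\<omega>\<in>space M. T \<omega> < ennreal t} \<in> sets (F t)"
  using filtration.stopping_time_less_const[OF filtration_extended assms(1)[unfolded is_stopping_time_def], of "ennreal t"] assms(2)
  by (simp add: pred_def extend_filtration_def space_F)

lemma sets_sigma_at:
  assumes "is_stopping_time M F T"
  shows "sets (sigma_at M F T) = {\<Lambda>. \<forall>t. {\<omega>\<in>\<Lambda>. T \<omega> \<le> t} \<in> sets (extend_filtration (space M) F t)}"
  unfolding sigma_at_def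
  by (rule filtration.sets_pre_sigma[OF filtration_extended assms[unfolded is_stopping_time_def]])

lemma space_sigma_at: "space (sigma_at M F T) = space M"
  unfolding sigma_at_def by (rule filtration.space_pre_sigma[OF filtration_extended])

lemma UN_sets_F_subset: "(\<Union>t\<in>{0..}. sets (F t)) \<subseteq> Pow (space M)"
proof (rule UN_least)
  fix t :: real assume "t \<in> {0..}"
  then show "sets (F t) \<subseteq> Pow (space M)" using sets.space_closed[of "F t"] space_F[of t] by simp
qed

lemma sets_sigma_infinity: "sets (sigma_infinity (space M) F) = sigma_sets (space M) (\<Union>t\<in>{0..}. sets (F t))"
  unfolding sigma_infinity_def using UN_sets_F_subset by simp

lemma space_sigma_infinity: "space (sigma_infinity (space M) F) = space M"
  unfolding sigma_infinity_def
  by (rule space_measure_of[OF UN_sets_F_subset])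

lemma sets_sigma_infinity_subset: "sets (sigma_infinity (space M) F) \<subseteq> sets M"
  unfolding sets_sigma_infinity by (intro sets.sigma_sets_subset) (use sets_F_subset in auto)

lemma sets_F_sigma_infinity: "0 \<le> t \<Longrightarrow> sets (F t) \<subseteq> sets (sigma_infinity (space M) F)"
  unfolding sets_sigma_infinity by auto

lemma sigma_at_sigma_infinity:
  assumes "is_stopping_time M F T" "\<Lambda> \<in> sets (sigma_at M F T)"
  shows "\<Lambda> \<in> sets (sigma_infinity (space M) F)"
  using assms(2) unfolding sets_sigma_at[OF assms(1)]
  by (auto simp: extend_filtration_def dest!: spec[of _ \<infinity>])

lemma subalgebra_sigma_at:
  assumes "is_stopping_time M F T"
  shows "subalgebra M (sigma_at M F T)"
  unfolding subalgebra_def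
  using space_sigma_at sigma_at_sigma_infinity[OF assms] sets_sigma_infinity_subset by blast

lemma sigma_at_less_sets:
  assumes T: "is_stopping_time M F T" and L: "\<Lambda> \<in> sets (sigma_at M F T)" and t: "0 \<le> t"
  shows "{\<omega>\<in>\<Lambda>. T \<omega> < ennreal t} \<in> sets (F t)"
proof -
  have "{\<omega>\<in>\<Lambda>. T \<omega> \<le> ennreal t} \<in> sets (extend_filtration (space M) F (ennreal t))"
    using L unfolding sets_sigma_at[OF T] by auto
  then have 1: "{\<omega>\<in>\<Lambda>. T \<omega> \<le> ennreal t} \<in> sets (F t)" using t by (simp add: extend_filtration_def)
  have "\<Lambda> \<subseteq> space M" using sets.sets_into_space[OF L] by (simp add: space_sigma_at)
  then have "{\<omega>\<in>\<Lambda>. T \<omega> < ennreal t} = {\<omega>\<in>\<Lambda>. T \<omega> \<le> ennreal t} \<inter> {\<omega>\<in>space M. T \<omega> < ennreal t}"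
    by (auto intro: less_imp_le)
  then show ?thesis using 1 stopping_time_less_sets[OF T t] by auto
qed

lemma stopping_time_measurable_sigma_at:
  assumes "is_stopping_time M F T"
  shows "T \<in> borel_measurable (sigma_at M F T)"
  unfolding sigma_at_def
  by (rule filtration.measurable_stopping_time_pre_sigma[OF filtration_extended assms[unfolded is_stopping_time_def]])

lemma is_stopping_time_const: "is_stopping_time M F (\<lambda>_. t)"
  unfolding is_stopping_time_def by (rule stopping_time_const)

lemma sets_sigma_at_const:
  assumes t: "0 \<le> t" and L: "\<Lambda> \<in> sets (F t)"
  shows "\<Lambda> \<in> sets (sigma_at M F (\<lambda>_. ennreal t))"
  unfolding sets_sigma_at[OF is_stopping_time_const]
proof (intro CollectI allI)
  fix u
  have "\<Lambda> \<in> sets (extend_filtration (space M) F (ennreal t))" using L t by (simp add: extend_filtration_def)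
  then show "{\<omega>\<in>\<Lambda>. ennreal t \<le> u} \<in> sets (extend_filtration (space M) F u)"
    using filtration.sets_F_mono[OF filtration_extended, of "ennreal t" u] by (cases "ennreal t \<le> u") auto
qed

lemma measure_eq_on_filtration:
  assumes gen: "sets M = sets (sigma_infinity (space M) F)"
    and R: "sets R1 = sets M" "sets R2 = sets M" "emeasure R1 (space M) \<noteq> \<infinity>"
    and eq: "\<And>t \<Lambda>. 0 \<le> t \<Longrightarrow> \<Lambda> \<in> sets (F t) \<Longrightarrow> emeasure R1 \<Lambda> = emeasure R2 \<Lambda>"
  shows "R1 = R2"
proof (rule measure_eqI_generator_eq)
  let ?E = "\<Union>t\<in>{0..}. sets (F t)"
  show "Int_stable ?E"
  proof (rule Int_stableI)
    fix a b assume "a \<in> ?E" "b \<in> ?E"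
    then obtain s t where st: "0 \<le> s" "a \<in> sets (F s)" "0 \<le> t" "b \<in> sets (F t)" by auto
    then have "a \<inter> b \<in> sets (F (max s t))"
      using sets_F_mono[of s "max s t"] sets_F_mono[of t "max s t"] by (intro sets.Int) auto
    then show "a \<inter> b \<in> ?E" using st by (intro UN_I[of "max s t"]) auto
  qed
  show "?E \<subseteq> Pow (space M)" by (rule UN_sets_F_subset)
  show "sets R1 = sigma_sets (space M) ?E" "sets R2 = sigma_sets (space M) ?E"
    using R gen sets_sigma_infinity by auto
  show "range (\<lambda>_::nat. space M) \<subseteq> ?E" using sets.top[of "F 0"] space_F[of 0] by fastforce
qed (use R eq in auto)

end

section \<open>Convergence of martingales bounded in \<open>L\<^sup>1\<close>\<close>

text \<open>Strictly convex with linear growth, so its expectation exists along any integrable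
  martingale. Its derivative \<open>x / sqrt1 x\<close> lies in \<open>[-1, 1]\<close> and may
  therefore serve as the multiplier \<open>h\<close> in the stopping theorem.\<close>

definition sqrt1 :: "real \<Rightarrow> real" where "sqrt1 x = sqrt (1 + x\<^sup>2)"

lemma sqrt1_pos: "0 < sqrt1 x"
  by (simp add: sqrt1_def add_pos_nonneg)

lemma sqrt1_square: "(sqrt1 x)\<^sup>2 = 1 + x\<^sup>2"
  by (simp add: sqrt1_def)

lemma sqrt1_ge: "\<bar>x\<bar> \<le> sqrt1 x" "1 \<le> sqrt1 x"
  by (auto simp: sqrt1_def intro!: real_le_rsqrt)

lemma sqrt1_le: "sqrt1 x \<le> 1 + \<bar>x\<bar>"
  unfolding sqrt1_def by (rule real_le_lsqrt) (auto simp: power2_eq_square algebra_simps)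

lemma sqrt1_lipschitz: "sqrt1 y \<le> sqrt1 x + \<bar>y - x\<bar>"
proof (rule power2_le_imp_le)
  have "y\<^sup>2 = x\<^sup>2 + 2 * x * (y - x) + (y - x)\<^sup>2" by (simp add: power2_eq_square algebra_simps)
  also have "2 * x * (y - x) \<le> 2 * (sqrt1 x * \<bar>y - x\<bar>)"
    using mult_right_mono[OF sqrt1_ge(1)[of x], of "\<bar>y - x\<bar>"] abs_ge_self[of "x * (y - x)"]
    by (simp add: abs_mult)
  finally show "(sqrt1 y)\<^sup>2 \<le> (sqrt1 x + \<bar>y - x\<bar>)\<^sup>2"
    unfolding power2_sum sqrt1_square by (simp add: algebra_simps)
qed (simp add: less_imp_le[OF sqrt1_pos])

text \<open>The Bregman divergence of \<open>sqrt1\<close>: the height of the graph at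
  \<open>y\<close> above the tangent at \<open>x\<close>. Along a martingale the tangent term
  integrates to 0, so the expected gap is the increment of the expectation of
  \<open>sqrt1\<close>.\<close>

definition sqrt1_gap :: "real \<Rightarrow> real \<Rightarrow> real" where
  "sqrt1_gap x y = sqrt1 y - sqrt1 x - x / sqrt1 x * (y - x)"

lemma sqrt1_gap_lower:
  "(x - y)\<^sup>2 / (2 * (sqrt1 x)\<^sup>2 * sqrt1 y) \<le> sqrt1_gap x y"
proof -
  define a b where "a = sqrt1 x" and "b = sqrt1 y"
  have ab: "0 < a" "0 < b" "a\<^sup>2 = 1 + x\<^sup>2" "b\<^sup>2 = 1 + y\<^sup>2"
    using sqrt1_pos sqrt1_square by (auto simp: a_def b_def)
  \<comment> \<open>Lagrange's identity for the vectors \<open>(1, x)\<close> and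
    \<open>(1, y)\<close>. It gives the Cauchy-Schwarz bound on \<open>1 + x * y\<close> and, after
    factoring the difference of squares, a lower bound on \<open>a * b - (1 + x * y)\<close>, which
    is \<open>a\<close> times the gap.\<close>
  have id: "(a * b)\<^sup>2 - (1 + x * y)\<^sup>2 = (x - y)\<^sup>2"
    unfolding power_mult_distrib ab by (simp add: power2_eq_square algebra_simps)
  have "\<bar>1 + x * y\<bar>\<^sup>2 \<le> (a * b)\<^sup>2" using id zero_le_power2[of "x - y"] unfolding power2_abs by linarith
  then have le: "\<bar>1 + x * y\<bar> \<le> a * b" by (rule power2_le_imp_le) (use ab in auto)
  have "(x - y)\<^sup>2 = (a * b - (1 + x * y)) * (a * b + (1 + x * y))"
    unfolding id[symmetric] by (simp add: power2_eq_square algebra_simps)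
  also have "\<dots> \<le> (a * b - (1 + x * y)) * (2 * (a * b))"
    by (rule mult_left_mono) (use le in auto)
  finally have "(x - y)\<^sup>2 / (2 * a\<^sup>2 * b) \<le> (a * b - (1 + x * y)) * (2 * (a * b)) / (2 * a\<^sup>2 * b)"
    by (rule divide_right_mono) (use ab in auto)
  also have "\<dots> = (a * b - (1 + x * y)) / a" using ab(1,2) by (simp add: power2_eq_square)
  also have "\<dots> = b - a - x / a * (y - x)"
  proof -
    have "(a * b - (1 + x * y)) = (b - a) * a - x * (y - x)"
      using ab(3) by (simp add: power2_eq_square algebra_simps)
    then show ?thesis using ab(1) by (simp add: diff_divide_distrib)
  qed
  finally show ?thesis by (simp add: sqrt1_gap_def a_def b_def)
qed

lemma sqrt1_gap_nonneg: "0 \<le> sqrt1_gap x y"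
  using sqrt1_gap_lower[of x y] sqrt1_pos[of y] by (smt (verit) divide_nonneg_nonneg mult_nonneg_nonneg zero_le_power2)

text \<open>With \<open>r\<close> the distance of \<open>x\<close> and \<open>y\<close>, the
  Lipschitz bound \<open>sqrt1 y \<le> 1 + K + r\<close> leaves \<open>r^2 / (1 + K + r)\<close>,
  which increases in \<open>r\<close>. Its value at \<open>r = e\<close> is thus a bound uniform in
  \<open>y\<close>.\<close>

lemma sqrt1_gap_far:
  assumes x: "\<bar>x\<bar> \<le> K" and e: "0 < e" "e \<le> \<bar>y - x\<bar>"
  shows "e\<^sup>2 / (2 * (1 + K)\<^sup>2 * (1 + K + e)) \<le> sqrt1_gap x y"
proof -
  define r where "r = \<bar>y - x\<bar>"
  have K: "0 \<le> K" and r: "0 < r" "e \<le> r" using x e by (auto simp: r_def)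
  have a: "0 < sqrt1 x" "sqrt1 x \<le> 1 + K" using sqrt1_pos[of x] sqrt1_le[of x] x by auto
  have b: "0 < sqrt1 y" "sqrt1 y \<le> 1 + K + r" using sqrt1_pos[of y] sqrt1_lipschitz[of y x] a by (auto simp: r_def)
  have "e\<^sup>2 * (1 + K + r) \<le> r\<^sup>2 * (1 + K + e)"
  proof -
    have "e\<^sup>2 * (1 + K) \<le> r\<^sup>2 * (1 + K)" by (rule mult_right_mono) (use r e K in \<open>auto intro!: power_mono\<close>)
    moreover have "e\<^sup>2 * r \<le> r\<^sup>2 * e"
      using mult_left_mono[of e r "e * r"] r e by (simp add: power2_eq_square mult.commute mult.left_commute)
    ultimately show ?thesis by (simp add: algebra_simps)
  qed
  then have "e\<^sup>2 / (1 + K + e) \<le> r\<^sup>2 / (1 + K + r)" using K e r by (simp add: divide_simps mult.commute)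
  then have "e\<^sup>2 / (1 + K + e) / (2 * (1 + K)\<^sup>2) \<le> r\<^sup>2 / (1 + K + r) / (2 * (1 + K)\<^sup>2)"
    by (rule divide_right_mono) simp
  then have "e\<^sup>2 / (2 * (1 + K)\<^sup>2 * (1 + K + e)) \<le> r\<^sup>2 / (2 * (1 + K)\<^sup>2 * (1 + K + r))"
    by (simp add: mult.commute)
  also have "\<dots> \<le> r\<^sup>2 / (2 * (sqrt1 x)\<^sup>2 * sqrt1 y)"
    by (rule divide_left_mono) (use a b in \<open>auto intro!: mult_mono power_mono\<close>)
  also have "r\<^sup>2 = (x - y)\<^sup>2" by (simp add: r_def power2_commute)
  finally show ?thesis using sqrt1_gap_lower[of x y] by simp
qed

lemma continuous_on_sqrt1: "continuous_on S sqrt1"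
  unfolding sqrt1_def by (intro continuous_intros)

lemma [measurable]: "sqrt1 \<in> borel_measurable borel"
  by (rule borel_measurable_continuous_onI[OF continuous_on_sqrt1])

lemma sqrt1_slope_bound: "\<bar>x / sqrt1 x\<bar> \<le> 1"
  using sqrt1_ge(1)[of x] sqrt1_pos[of x] by (simp add: abs_divide)

context filtered_prob_space
begin

lemma sqrt1_integrable: "integrable M f \<Longrightarrow> integrable M (\<lambda>\<omega>. sqrt1 (f \<omega>))"
proof (rule Bochner_Integration.integrable_bound[where f="\<lambda>\<omega>. 1 + \<bar>f \<omega>\<bar>"])
  show "AE \<omega> in M. norm (sqrt1 (f \<omega>)) \<le> norm (1 + \<bar>f \<omega>\<bar>)"
    using sqrt1_le sqrt1_pos by (intro AE_I2) (simp add: less_imp_le)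
qed auto

text \<open>
  The convex function \<^term>\<open>sqrt1\<close> replaces the square for a martingale that is only bounded in
  \<open>L\<^sup>1\<close>: its expected increments control the oscillation of the martingale, because
  \<^const>\<open>sqrt1_gap\<close> is bounded below away from the diagonal.
\<close>

lemma martingale_oscillation:
  assumes N: "martingale M F N" and s: "0 \<le> s" and J: "finite J" "\<And>u. u \<in> J \<Longrightarrow> s \<le> u \<and> u \<le> c"
    and c: "s \<le> c" and e: "0 < e" and K: "0 \<le> K"
  shows "prob {\<omega>\<in>space M. \<bar>N s \<omega>\<bar> \<le> K \<and> (\<exists>u\<in>J. e < \<bar>N u \<omega> - N s \<omega>\<bar>)} * (e\<^sup>2 / (2 * (1 + K)\<^sup>2 * (1 + K + e)))
    \<le> (\<integral>\<omega>. sqrt1 (N c \<omega>) \<partial>M) - (\<integral>\<omega>. sqrt1 (N s \<omega>) \<partial>M)"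
proof -
  define hit where "hit u \<omega> \<longleftrightarrow> e < \<bar>N u \<omega> - N s \<omega>\<bar>" for u \<omega>
  \<comment> \<open>The first observation time with a large displacement, with default
    \<open>c\<close>. Whether \<open>S = u\<close> depends only on the values of \<open>N\<close> up
    to \<open>u\<close>.\<close>
  define S where "S \<omega> = Min (insert c {u\<in>J. hit u \<omega>})" for \<omega>
  let ?J = "insert c J"
  have J': "finite ?J" "\<And>u. u \<in> ?J \<Longrightarrow> 0 \<le> u \<and> u \<le> c" "\<And>u. u \<in> ?J \<Longrightarrow> s \<le> u \<and> 0 \<le> u"
    using J s c by (auto intro: order_trans)
  have fin: "finite (insert c {u\<in>J. hit u \<omega>})" for \<omega> using J(1) by auto
  have S_in: "S \<omega> \<in> insert c {u\<in>J. hit u \<omega>}" for \<omega> unfolding S_def using fin by (intro Min_in) auto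
  then have SJ: "S \<omega> \<in> ?J" for \<omega> by blast
  have S_le: "S \<omega> \<le> u" if "u \<in> J" "hit u \<omega>" for u \<omega>
    unfolding S_def using fin that by (intro Min_le) auto
  have S_eq: "S \<omega> = u \<longleftrightarrow> (u = c \<or> hit u \<omega>) \<and> (\<forall>v\<in>{v\<in>J. v < u}. \<not> hit v \<omega>)" if u: "u \<in> ?J" for u \<omega>
  proof
    assume "S \<omega> = u"
    then show "(u = c \<or> hit u \<omega>) \<and> (\<forall>v\<in>{v\<in>J. v < u}. \<not> hit v \<omega>)" using S_in[of \<omega>] S_le[of _ \<omega>] by force
  next
    assume *: "(u = c \<or> hit u \<omega>) \<and> (\<forall>v\<in>{v\<in>J. v < u}. \<not> hit v \<omega>)"
    show "S \<omega> = u" unfolding S_def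
      using * u J by (intro Min_eqI fin) (auto simp: not_less[symmetric] dest: J(2))
  qed
  have Nu: "N u \<in> borel_measurable (F u)" "integrable M (N u)" if "0 \<le> u" for u
    using N that by (auto simp: martingale_def adapted_def)
  have Nm: "N v \<in> borel_measurable (F u)" if "0 \<le> v" "v \<le> u" for u v
    by (rule measurable_F_mono[OF Nu(1)[OF that(1)] that])
  have hit_sets: "{\<omega>\<in>space (F u). hit v \<omega>} \<in> sets (F u)" if "s \<le> v" "v \<le> u" for u v
  proof -
    have [measurable]: "N v \<in> borel_measurable (F u)" "N s \<in> borel_measurable (F u)"
      using that s by (auto intro!: Nm)
    show ?thesis unfolding hit_def by measurable
  qed
  have S_sets: "{\<omega>\<in>space M. S \<omega> = u} \<in> sets (F u)" if u: "u \<in> ?J" for u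
  proof -
    have "0 \<le> u" "s \<le> u" using J'(3)[OF u] by auto
    have "{\<omega>\<in>space (F u). S \<omega> = u} =
      (if u = c then space (F u) else {\<omega>\<in>space (F u). hit u \<omega>}) - (\<Union>v\<in>{v\<in>J. v < u}. {\<omega>\<in>space (F u). hit v \<omega>})"
      unfolding S_eq[OF u] by auto
    also have "\<dots> \<in> sets (F u)"
      using hit_sets[of u u] \<open>s \<le> u\<close> J by (intro sets.Diff sets.finite_UN) (auto intro!: hit_sets)
    finally show ?thesis using space_F[OF \<open>0 \<le> u\<close>] by simp
  qed
  have ind_S: "(\<lambda>\<omega>. f \<omega> * indicator {\<omega>. S \<omega> = u} \<omega>) \<in> borel_measurable (F u)"
    if u: "u \<in> ?J" and f: "f \<in> borel_measurable (F u)" for f :: "'a \<Rightarrow> real" and u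
  proof -
    have "(\<lambda>\<omega>. f \<omega> * indicator {\<omega>\<in>space M. S \<omega> = u} \<omega>) \<in> borel_measurable (F u)"
      using f S_sets[OF u] by auto
    then show ?thesis
      by (rule measurable_cong[THEN iffD1, rotated])
         (use J'(3)[OF u] in \<open>auto simp: space_F split: split_indicator\<close>)
  qed
  let ?slope = "\<lambda>x. x / sqrt1 x"
  have NS_meas: "(\<lambda>\<omega>. N (S \<omega>) \<omega>) \<in> borel_measurable M"
  proof (rule simple_stopped_measurable[where N=N and S=S, OF _ J'(1) SJ])
    fix u assume u: "u \<in> ?J"
    show "N u \<in> borel_measurable M" using Nu(2)[of u] J'(3)[OF u] by auto
    show "{\<omega>\<in>space M. S \<omega> = u} \<in> sets M" using S_sets[OF u] J'(3)[OF u] sets_F_subset[of u] by auto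
  qed
  have NS_int: "integrable M (\<lambda>\<omega>. N (S \<omega>) \<omega>)"
    using martingale_simple_stopping(1)[where S=S and h="\<lambda>_. 1" and C=1, OF N J'(1,2) SJ] ind_S[of _ "\<lambda>_. 1"]
    by simp
  have c0: "0 \<le> c" using s c by simp
  have h1: "integrable M (\<lambda>\<omega>. ?slope (N (S \<omega>) \<omega>) * N (S \<omega>) \<omega>)"
    "(\<integral>\<omega>. ?slope (N (S \<omega>) \<omega>) * N (S \<omega>) \<omega> \<partial>M) = (\<integral>\<omega>. ?slope (N (S \<omega>) \<omega>) * N c \<omega> \<partial>M)"
  proof -
    have "(\<lambda>\<omega>. ?slope (N (S \<omega>) \<omega>) * indicator {\<omega>. S \<omega> = u} \<omega>) \<in> borel_measurable (F u)" if u: "u \<in> ?J" for u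
    proof -
      have "(\<lambda>\<omega>. ?slope (N u \<omega>) * indicator {\<omega>. S \<omega> = u} \<omega>) \<in> borel_measurable (F u)"
        by (rule ind_S[OF u]) (use Nu(1)[of u] J'(3)[OF u] in auto)
      also have "(\<lambda>\<omega>. ?slope (N u \<omega>) * indicator {\<omega>. S \<omega> = u} \<omega>) = (\<lambda>\<omega>. ?slope (N (S \<omega>) \<omega>) * indicator {\<omega>. S \<omega> = u} \<omega>)"
        by (auto split: split_indicator)
      finally show ?thesis .
    qed
    from martingale_simple_stopping[OF N J'(1,2) SJ sqrt1_slope_bound this]
    show "integrable M (\<lambda>\<omega>. ?slope (N (S \<omega>) \<omega>) * N (S \<omega>) \<omega>)"
      "(\<integral>\<omega>. ?slope (N (S \<omega>) \<omega>) * N (S \<omega>) \<omega> \<partial>M) = (\<integral>\<omega>. ?slope (N (S \<omega>) \<omega>) * N c \<omega> \<partial>M)" by blast+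
  qed
  have slope_s: "(\<lambda>\<omega>. ?slope (N s \<omega>)) \<in> borel_measurable (F u)" if "s \<le> u" for u
    using Nm[OF s that] by auto
  have hs: "(\<lambda>\<omega>. ?slope (N s \<omega>) * indicator {\<omega>. S \<omega> = u} \<omega>) \<in> borel_measurable (F u)" if "u \<in> ?J" for u
    by (rule ind_S[OF that slope_s]) (use J'(3)[OF that] in auto)
  note h2 = martingale_simple_stopping[where S=S, OF N J'(1,2) SJ sqrt1_slope_bound hs]
  have h3: "(\<integral>\<omega>. ?slope (N s \<omega>) * N c \<omega> \<partial>M) = (\<integral>\<omega>. ?slope (N s \<omega>) * N s \<omega> \<partial>M)"
    by (rule martingale_integral_mult[OF N s c slope_s sqrt1_slope_bound]) simp
  have i1: "integrable M (\<lambda>\<omega>. ?slope (N (S \<omega>) \<omega>) * N c \<omega>)"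
    by (rule integrable_bounded_mult[OF Nu(2)[OF c0] _ sqrt1_slope_bound]) (use NS_meas in measurable)
  have i2: "integrable M (\<lambda>\<omega>. ?slope (N s \<omega>) * N s \<omega>)"
    by (rule integrable_bounded_mult[OF Nu(2)[OF s] _ sqrt1_slope_bound]) (use Nu(2)[OF s] in measurable)
  note ints = sqrt1_integrable[OF NS_int] sqrt1_integrable[OF Nu(2)[OF s]] sqrt1_integrable[OF Nu(2)[OF c0]]
  \<comment> \<open>From \<open>S\<close> to \<open>c\<close> convexity alone is used: the slope at
    \<open>N S\<close> is known at time \<open>S\<close>, so the tangent term vanishes by simple
    stopping.\<close>
  have "0 \<le> (\<integral>\<omega>. sqrt1_gap (N (S \<omega>) \<omega>) (N c \<omega>) \<partial>M)"
    by (rule integral_nonneg_AE) (simp add: sqrt1_gap_nonneg)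
  also have "\<dots> = (\<integral>\<omega>. sqrt1 (N c \<omega>) - sqrt1 (N (S \<omega>) \<omega>) - (?slope (N (S \<omega>) \<omega>) * N c \<omega> - ?slope (N (S \<omega>) \<omega>) * N (S \<omega>) \<omega>) \<partial>M)"
    by (intro Bochner_Integration.integral_cong) (auto simp: sqrt1_gap_def right_diff_distrib)
  also have "\<dots> = (\<integral>\<omega>. sqrt1 (N c \<omega>) \<partial>M) - (\<integral>\<omega>. sqrt1 (N (S \<omega>) \<omega>) \<partial>M)"
    using ints h1 i1 by simp
  finally have up: "(\<integral>\<omega>. sqrt1 (N (S \<omega>) \<omega>) \<partial>M) \<le> (\<integral>\<omega>. sqrt1 (N c \<omega>) \<partial>M)" by simp
  \<comment> \<open>From \<open>s\<close> to \<open>S\<close> the tangent is taken at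
    \<open>N s\<close>, known at time \<open>s\<close>. This gap carries the quantitative bound on
    the event that a displacement occurs.\<close>
  have gap_eq: "sqrt1_gap (N s \<omega>) (N (S \<omega>) \<omega>) =
      sqrt1 (N (S \<omega>) \<omega>) - sqrt1 (N s \<omega>) - (?slope (N s \<omega>) * N (S \<omega>) \<omega> - ?slope (N s \<omega>) * N s \<omega>)" for \<omega>
    by (simp add: sqrt1_gap_def right_diff_distrib)
  have gap_int: "integrable M (\<lambda>\<omega>. sqrt1_gap (N s \<omega>) (N (S \<omega>) \<omega>))"
    unfolding gap_eq using ints h2 i2 by simp
  have gap: "(\<integral>\<omega>. sqrt1_gap (N s \<omega>) (N (S \<omega>) \<omega>) \<partial>M) = (\<integral>\<omega>. sqrt1 (N (S \<omega>) \<omega>) \<partial>M) - (\<integral>\<omega>. sqrt1 (N s \<omega>) \<partial>M)"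
    unfolding gap_eq using ints h2 h3 i2 by simp
  let ?D = "e\<^sup>2 / (2 * (1 + K)\<^sup>2 * (1 + K + e))"
  let ?O = "{\<omega>\<in>space M. \<bar>N s \<omega>\<bar> \<le> K \<and> (\<exists>u\<in>J. hit u \<omega>)}"
  have O_sets: "?O \<in> sets M"
  proof -
    have "{\<omega>\<in>space M. hit u \<omega>} \<in> sets M" if "u \<in> J" for u
      using hit_sets[of u u] J(2)[OF that] sets_F_subset[of u] space_F[of u] s by auto
    then have "(\<Union>u\<in>J. {\<omega>\<in>space M. hit u \<omega>}) \<in> sets M" using J(1) by auto
    moreover have "{\<omega>\<in>space M. \<bar>N s \<omega>\<bar> \<le> K} \<in> sets M" using Nu(2)[OF s] by measurable
    ultimately have "{\<omega>\<in>space M. \<bar>N s \<omega>\<bar> \<le> K} \<inter> (\<Union>u\<in>J. {\<omega>\<in>space M. hit u \<omega>}) \<in> sets M" by blast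
    also have "{\<omega>\<in>space M. \<bar>N s \<omega>\<bar> \<le> K} \<inter> (\<Union>u\<in>J. {\<omega>\<in>space M. hit u \<omega>}) = ?O" by auto
    finally show ?thesis .
  qed
  have "prob ?O * ?D = (\<integral>\<omega>. indicator ?O \<omega> * ?D \<partial>M)" using O_sets by simp
  also have "\<dots> \<le> (\<integral>\<omega>. sqrt1_gap (N s \<omega>) (N (S \<omega>) \<omega>) \<partial>M)"
  proof (rule integral_mono[OF _ gap_int])
    show "integrable M (\<lambda>\<omega>. indicator ?O \<omega> * ?D)"
      by (intro integrable_mult_left integrable_real_indicator) (use O_sets in \<open>auto simp: emeasure_eq_measure\<close>)
    fix \<omega>
    show "indicator ?O \<omega> * ?D \<le> sqrt1_gap (N s \<omega>) (N (S \<omega>) \<omega>)"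
    proof (cases "\<omega> \<in> ?O")
      case True
      then obtain u where u: "u \<in> J" "hit u \<omega>" by auto
      \<comment> \<open>Even when \<open>S\<close> takes the default value this is a hit: a hit at
        \<open>u\<close> forces \<open>S \<le> u \<le> c\<close>, so \<open>S = c\<close> means
        \<open>u = c\<close>.\<close>
      have "hit (S \<omega>) \<omega>" using S_in[of \<omega>] S_le[OF u] J(2)[OF u(1)] u by (cases "S \<omega> = c") auto
      then have "?D \<le> sqrt1_gap (N s \<omega>) (N (S \<omega>) \<omega>)"
        using True e by (intro sqrt1_gap_far) (auto simp: hit_def)
      then show ?thesis using True by simp
    next
      case False
      then show ?thesis using sqrt1_gap_nonneg by simp
    qed
  qed
  finally show ?thesis using gap up by (simp add: hit_def)
qed

text \<open>The expectation \<open>v\<close> of \<open>sqrt1 (N t)\<close> increases and is bounded,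
  so its increments after \<open>s\<close> become small, and by
  \<open>martingale_oscillation\<close> so does the probability of a displacement larger than
  \<open>e\<close> after \<open>s\<close>. Hence almost every path is Cauchy at infinity.\<close>

theorem martingale_convergence:
  assumes N: "martingale M F N"
    and rc: "\<And>\<omega> t. \<omega> \<in> space M \<Longrightarrow> 0 \<le> t \<Longrightarrow> ((\<lambda>t. N t \<omega>) \<longlongrightarrow> N t \<omega>) (at_right t)"
    and bd: "\<And>t. 0 \<le> t \<Longrightarrow> (\<integral>\<omega>. \<bar>N t \<omega>\<bar> \<partial>M) \<le> C"
  shows "AE \<omega> in M. \<exists>l. ((\<lambda>t. N t \<omega>) \<longlongrightarrow> l) at_top"
proof -
  have Ni: "integrable M (N t)" if "0 \<le> t" for t using N that by (auto simp: martingale_def)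
  have Nm [measurable]: "N t \<in> borel_measurable M" if "0 \<le> t" for t using Ni[OF that] by auto
  have C0: "0 \<le> C" by (rule order_trans[OF integral_nonneg_AE bd[of 0]]) simp_all
  define v where "v t = (\<integral>\<omega>. sqrt1 (N t \<omega>) \<partial>M)" for t
  have v_mono: "v s \<le> v t" if "0 \<le> s" "s \<le> t" for s t
  proof -
    \<comment> \<open>With no observation times the event is empty, and the oscillation bound
      reduces to the monotonicity of \<open>v\<close>. The constants 1 are arbitrary.\<close>
    have "0 \<le> prob {\<omega>\<in>space M. \<bar>N s \<omega>\<bar> \<le> 1 \<and> (\<exists>u\<in>{}. 1 < \<bar>N u \<omega> - N s \<omega>\<bar>)} * (1\<^sup>2 / (2 * (1 + 1)\<^sup>2 * (1 + 1 + 1)))"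
      by simp
    also have "\<dots> \<le> v t - v s"
      unfolding v_def by (rule martingale_oscillation[OF N]) (use that in auto)
    finally show ?thesis by simp
  qed
  have v_bd: "v t \<le> 1 + C" if "0 \<le> t" for t
  proof -
    have "v t \<le> (\<integral>\<omega>. 1 + \<bar>N t \<omega>\<bar> \<partial>M)"
      unfolding v_def by (rule integral_mono[OF sqrt1_integrable]) (use Ni[OF that] sqrt1_le in auto)
    also have "\<dots> = 1 + (\<integral>\<omega>. \<bar>N t \<omega>\<bar> \<partial>M)" using Ni[OF that] by (simp add: prob_space)
    finally show ?thesis using bd[OF that] by simp
  qed
  have "incseq (\<lambda>n. v (real n))" by (auto simp: incseq_def intro: v_mono)
  moreover have "Bseq (\<lambda>n. v (real n))"
    by (rule BseqI'[of _ "1 + C"])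
       (use v_bd in \<open>auto simp: v_def abs_of_nonneg less_imp_le[OF sqrt1_pos] integral_nonneg_AE\<close>)
  ultimately obtain L where L: "(\<lambda>n. v (real n)) \<longlonglongrightarrow> L" "\<And>n. v (real n) \<le> L"
    using incseq_convergent[of "\<lambda>n. v (real n)" "1 + C"] v_bd by auto
  have v_L: "v t \<le> L" if "0 \<le> t" for t
  proof -
    obtain n :: nat where "t \<le> real n" using real_arch_simple by blast
    then show ?thesis using v_mono[OF that] L(2)[of n] order_trans by blast
  qed
  define far where "far s e = {\<omega>\<in>space M. \<exists>u\<in>{u\<in>\<rat>. s \<le> u}. e < \<bar>N u \<omega> - N s \<omega>\<bar>}" for s e
  have cQ: "countable {u\<in>\<rat>. s \<le> (u::real)}" for s by (rule countable_subset[OF _ countable_rat]) auto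
  have far_sets: "far s e \<in> sets M" if "0 \<le> s" for s e
  proof -
    have "far s e = (\<Union>u\<in>{u\<in>\<rat>. s \<le> u}. {\<omega>\<in>space M. e < \<bar>N u \<omega> - N s \<omega>\<bar>})" by (auto simp: far_def)
    also have "\<dots> \<in> sets M"
    proof (rule sets.countable_UN''[OF cQ])
      fix u assume "u \<in> {u\<in>\<rat>. s \<le> u}"
      then have [measurable]: "N u \<in> borel_measurable M" "N s \<in> borel_measurable M" using that by auto
      show "{\<omega>\<in>space M. e < \<bar>N u \<omega> - N s \<omega>\<bar>} \<in> sets M" by measurable
    qed
    finally show ?thesis .
  qed
  have far_bd: "prob (far s e) \<le> C / K + (L - v s) / (e\<^sup>2 / (2 * (1 + K)\<^sup>2 * (1 + K + e)))"
    if s: "0 \<le> s" and e: "0 < e" and K: "0 < K" for s e K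
  proof -
    let ?D = "e\<^sup>2 / (2 * (1 + K)\<^sup>2 * (1 + K + e))"
    have D: "0 < ?D" using e K by simp
    obtain q0 where "q0 \<in> \<rat>" "s < q0" using Rats_dense_in_real[of s "s + 1"] by auto
    then have ne: "{u\<in>\<rat>. s \<le> u} \<noteq> {}" by (auto intro: less_imp_le)
    \<comment> \<open>Initial pieces of an enumeration: the bound for finitely many times, uniform
      in the set, passes to all rationals from \<open>s\<close> on.\<close>
    define J where "J m = from_nat_into {u\<in>\<rat>. s \<le> u} ` {..m}" for m :: nat
    define B where "B m = {\<omega>\<in>space M. \<bar>N s \<omega>\<bar> \<le> K \<and> (\<exists>u\<in>J m. e < \<bar>N u \<omega> - N s \<omega>\<bar>)}" for m
    have Js: "s \<le> u" "u \<in> \<rat>" if "u \<in> J m" for u m using that from_nat_into[OF ne] by (auto simp: J_def)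
    have B_sets: "B m \<in> sets M" for m
    proof -
      have "B m = {\<omega>\<in>space M. \<bar>N s \<omega>\<bar> \<le> K} \<inter> (\<Union>u\<in>J m. {\<omega>\<in>space M. e < \<bar>N u \<omega> - N s \<omega>\<bar>})" by (auto simp: B_def)
      also have "\<dots> \<in> sets M"
      proof (intro sets.Int sets.finite_UN)
        have [measurable]: "N s \<in> borel_measurable M" using s by auto
        show "{\<omega>\<in>space M. \<bar>N s \<omega>\<bar> \<le> K} \<in> sets M" by measurable
        fix u assume "u \<in> J m"
        then have [measurable]: "N u \<in> borel_measurable M" using Js[of u m] s by auto
        show "{\<omega>\<in>space M. e < \<bar>N u \<omega> - N s \<omega>\<bar>} \<in> sets M" by measurable
      qed (simp add: J_def)
      finally show ?thesis .
    qed
    have B_bd: "prob (B m) \<le> (L - v s) / ?D" for m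
    proof -
      have fJ: "finite (J m)" by (simp add: J_def)
      have mJ: "s \<le> u \<and> u \<le> Max (insert s (J m))" if "u \<in> J m" for u
        using Js(1)[OF that] Max_ge[of "insert s (J m)" u] that fJ by simp
      have sJ: "s \<le> Max (insert s (J m))" using Max_ge[of "insert s (J m)" s] fJ by simp
      have "prob (B m) * ?D \<le> v (Max (insert s (J m))) - v s"
        unfolding B_def v_def
        by (rule martingale_oscillation[OF N s fJ mJ sJ e]) (use K in auto)
      also have "\<dots> \<le> L - v s" using v_L[OF order_trans[OF s sJ]] by simp
      finally show ?thesis by (simp only: pos_le_divide_eq[OF D])
    qed
    have inc: "incseq B" by (auto simp: incseq_def B_def J_def)
    have "(\<lambda>m. prob (B m)) \<longlonglongrightarrow> prob (\<Union>m. B m)" by (rule finite_Lim_measure_incseq) (use B_sets inc in auto)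
    then have UB: "prob (\<Union>m. B m) \<le> (L - v s) / ?D" by (rule LIMSEQ_le_const2) (use B_bd in auto)
    have "far s e \<subseteq> (\<Union>m. B m) \<union> {\<omega>\<in>space M. K \<le> \<bar>N s \<omega>\<bar>}"
    proof
      fix \<omega> assume "\<omega> \<in> far s e"
      then obtain u where u: "\<omega> \<in> space M" "u \<in> {u\<in>\<rat>. s \<le> u}" "e < \<bar>N u \<omega> - N s \<omega>\<bar>" by (auto simp: far_def)
      have "from_nat_into {u\<in>\<rat>. s \<le> u} (to_nat_on {u\<in>\<rat>. s \<le> u} u) = u"
        by (rule from_nat_into_to_nat_on[OF cQ u(2)])
      then have "u \<in> J (to_nat_on {u\<in>\<rat>. s \<le> u} u)" unfolding J_def by (rule image_eqI[OF sym]) simp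
      then have "\<omega> \<in> B (to_nat_on {u\<in>\<rat>. s \<le> u} u)" if "\<bar>N s \<omega>\<bar> \<le> K"
        using u that unfolding B_def by blast
      then show "\<omega> \<in> (\<Union>m. B m) \<union> {\<omega>\<in>space M. K \<le> \<bar>N s \<omega>\<bar>}" using u(1) by (cases "\<bar>N s \<omega>\<bar> \<le> K") auto
    qed
    then have "prob (far s e) \<le> prob ((\<Union>m. B m) \<union> {\<omega>\<in>space M. K \<le> \<bar>N s \<omega>\<bar>})"
      by (rule finite_measure_mono) (use B_sets s in auto)
    also have "\<dots> \<le> prob (\<Union>m. B m) + prob {\<omega>\<in>space M. K \<le> \<bar>N s \<omega>\<bar>}"
      by (rule measure_subadditive) (use B_sets s in \<open>auto simp: emeasure_eq_measure\<close>)
    also have "prob {\<omega>\<in>space M. K \<le> \<bar>N s \<omega>\<bar>} \<le> (\<integral>\<omega>. \<bar>N s \<omega>\<bar> \<partial>M) / K"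
      by (rule integral_Markov_inequality_measure[where A="space M"]) (use Ni[OF s] K in auto)
    also have "\<dots> \<le> C / K" by (rule divide_right_mono) (use bd[OF s] K in auto)
    finally show ?thesis using UB by simp
  qed
  have osc: "AE \<omega> in M. \<exists>n::nat. \<omega> \<notin> far (real n) e" if e: "0 < e" for e
  proof -
    let ?B = "\<Inter>n::nat. far (real n) e"
    have B: "?B \<in> sets M" using far_sets by auto
    \<comment> \<open>The order of limits matters: for fixed \<open>K\<close> the starting time goes
      to infinity and removes the term with \<open>L - v\<close>, although its denominator depends
      on \<open>K\<close>. Only then does \<open>K\<close> grow.\<close>
    have "prob ?B \<le> C / K" if K: "0 < K" for K
    proof -
      let ?D = "e\<^sup>2 / (2 * (1 + K)\<^sup>2 * (1 + K + e))"
      have "(\<lambda>n. C / K + (L - v (real n)) / ?D) \<longlonglongrightarrow> C / K + (L - L) / ?D"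
        using e K by (intro tendsto_intros L(1)) auto
      moreover have "prob ?B \<le> C / K + (L - v (real n)) / ?D" for n :: nat
      proof -
        have "prob ?B \<le> prob (far (real n) e)" by (rule finite_measure_mono) (use far_sets in auto)
        then show ?thesis using far_bd[of "real n" e K] e K by simp
      qed
      ultimately have "prob ?B \<le> C / K + (L - L) / ?D" by (intro LIMSEQ_le_const) auto
      then show ?thesis by simp
    qed
    then have "prob ?B \<le> C * inverse (real (Suc m))" for m by (simp add: divide_inverse)
    then have "prob ?B \<le> C * 0"
      by (intro LIMSEQ_le_const[OF tendsto_mult_left[OF LIMSEQ_inverse_real_of_nat]]) auto
    then have "?B \<in> null_sets M" using B by (auto simp: null_sets_def emeasure_eq_measure measure_le_0_iff)
    then show ?thesis by (rule AE_not_in[THEN AE_mp]) auto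
  qed
  have "AE \<omega> in M. \<forall>k. \<exists>n::nat. \<omega> \<notin> far (real n) (1 / real (Suc k))"
    by (intro AE_all_countable[THEN iffD2] allI osc) simp
  then show ?thesis
    using AE_space
  proof eventually_elim
    case (elim \<omega>)
    have close: "\<exists>n::nat. \<forall>u\<ge>real n. \<bar>N u \<omega> - N (real n) \<omega>\<bar> \<le> 1 / real (Suc k)" for k
    proof -
      obtain n where n: "\<omega> \<notin> far (real n) (1 / real (Suc k))" using elim(1) by blast
      have "\<bar>N u \<omega> - N (real n) \<omega>\<bar> \<le> 1 / real (Suc k)" if u: "real n \<le> u" for u
      proof -
        \<comment> \<open>Grid points are rational and approach \<open>u\<close> from the right, so
          right-continuity extends the bound from rational to real times.\<close>
        have "(\<lambda>i. \<bar>N (next_grid i u) \<omega> - N (real n) \<omega>\<bar>) \<longlonglongrightarrow> \<bar>N u \<omega> - N (real n) \<omega>\<bar>"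
          using u by (intro tendsto_intros right_continuous_sequentially[where f="\<lambda>t. N t \<omega>"] rc elim(2)
            next_grid_tendsto less_imp_le[OF next_grid_gt]) auto
        moreover have "\<bar>N (next_grid i u) \<omega> - N (real n) \<omega>\<bar> \<le> 1 / real (Suc k)" for i
          using n elim(2) next_grid_Rats[of i u] next_grid_gt[of u i] u by (force simp: far_def not_less)
        ultimately show ?thesis by (intro LIMSEQ_le_const2) auto
      qed
      then show ?thesis by blast
    qed
    have "Cauchy (\<lambda>n. N (real n) \<omega>)"
    proof (rule metric_CauchyI)
      fix r :: real assume "0 < r"
      then obtain k where k: "1 / real (Suc k) < r / 2" using nat_approx_posE[of "r / 2"] by auto
      obtain n :: nat where n: "\<And>u. u \<ge> real n \<Longrightarrow> \<bar>N u \<omega> - N (real n) \<omega>\<bar> \<le> 1 / real (Suc k)" using close by blast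
      have "dist (N (real i) \<omega>) (N (real j) \<omega>) < r" if "n \<le> i" "n \<le> j" for i j
        using n[of "real i"] n[of "real j"] that k by (auto simp: dist_real_def)
      then show "\<exists>n. \<forall>i\<ge>n. \<forall>j\<ge>n. dist (N (real i) \<omega>) (N (real j) \<omega>) < r" by blast
    qed
    then obtain l where l: "(\<lambda>n. N (real n) \<omega>) \<longlonglongrightarrow> l" using Cauchy_convergent convergent_def by blast
    have "((\<lambda>t. N t \<omega>) \<longlongrightarrow> l) at_top"
    proof (rule tendstoI)
      fix r :: real assume "0 < r"
      then obtain k where k: "1 / real (Suc k) < r / 2" using nat_approx_posE[of "r / 2"] by auto
      obtain n :: nat where n: "\<And>u. u \<ge> real n \<Longrightarrow> \<bar>N u \<omega> - N (real n) \<omega>\<bar> \<le> 1 / real (Suc k)" using close by blast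
      have "(\<lambda>i. \<bar>N (real i) \<omega> - N (real n) \<omega>\<bar>) \<longlonglongrightarrow> \<bar>l - N (real n) \<omega>\<bar>" by (intro tendsto_intros l)
      then have "\<bar>l - N (real n) \<omega>\<bar> \<le> 1 / real (Suc k)"
        by (rule LIMSEQ_le_const2) (intro exI[of _ n] allI impI n, simp)
      then have "dist (N u \<omega>) l < r" if "u \<ge> real n" for u
        using n[OF that] k by (simp add: dist_real_def)
      then show "eventually (\<lambda>u. dist (N u \<omega>) l < r) at_top"
        by (auto simp: eventually_at_top_linorder)
    qed
    then show ?case by blast
  qed
qed

end

section \<open>Extension of measures under property (P)\<close>

text \<open>
  A Polish space is embedded into the real sequences by the distances to the points of a dense
  sequence. The image is Borel: it consists of the sequences that satisfy the triangle inequalities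
  and have infimum \<open>0\<close>.
\<close>

lemma polish_vimage_real_sequences:
  fixes S :: "'b topology" and \<pi> :: "'a \<Rightarrow> 'b"
  assumes S: "polish_topology S" and \<pi>: "\<pi> ` \<Omega> = topspace S"
  obtains h :: "'a \<Rightarrow> nat \<Rightarrow> real"
  where "h ` \<Omega> \<in> sets borel"
    and "{\<pi> -` B \<inter> \<Omega> | B. B \<in> borel_sets_of S} = {h -` B \<inter> \<Omega> | B. B \<in> sets borel}"
proof (cases "\<Omega> = {}")
  case True
  have "topspace S = {}" using \<pi> True by simp
  show ?thesis
    by (rule that[of "\<lambda>_ _. 0"]) (use True in \<open>auto simp: borel_sets_of_def intro: exI[of _ "{}"] sigma_sets.Empty\<close>)
next
  case False
  obtain Y d where Y: "Metric_space Y d" "Metric_space.mcomplete Y d" "S = Metric_space.mtopology Y d"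
    using S unfolding polish_topology_def completely_metrizable_space_def by auto
  interpret Metric_space Y d by fact
  have top: "topspace S = Y" using Y(3) by simp
  obtain C where C: "countable C" "C \<subseteq> Y" "S closure_of C = Y"
    using S top unfolding polish_topology_def separable_space_def by auto
  have "C \<noteq> {}" using C(3) \<pi> top False by auto
  define c where "c = from_nat_into C"
  have c: "c i \<in> Y" for i using from_nat_into[OF \<open>C \<noteq> {}\<close>] C(2) by (auto simp: c_def)
  have dense: "\<exists>i. d (c i) y < e" if y: "y \<in> Y" and e: "0 < e" for y e
  proof -
    have "y \<in> mtopology closure_of C" using C(3) Y(3) y by simp
    then obtain z where z: "z \<in> C" "d y z < e" using e by (auto simp: metric_closure_of)
    then have "c (to_nat_on C z) = z" by (simp add: c_def C(1) from_nat_into_to_nat_on)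
    then show ?thesis using z commute by (intro exI[of _ "to_nat_on C z"]) auto
  qed
  have \<pi>Y: "\<pi> \<omega> \<in> Y" if "\<omega> \<in> \<Omega>" for \<omega> using \<pi> top that by auto
  define h where "h \<omega> i = d (c i) (\<pi> \<omega>)" for \<omega> i
  have img: "h ` \<Omega> = {y. (\<forall>i j. \<bar>y i - y j\<bar> \<le> d (c i) (c j) \<and> d (c i) (c j) \<le> y i + y j) \<and> (\<forall>k. \<exists>i. y i < 1 / real (Suc k))}"
    (is "_ = ?R")
  proof (intro equalityI subsetI)
    fix y assume "y \<in> h ` \<Omega>"
    then obtain \<omega> where \<omega>: "\<omega> \<in> \<Omega>" "y = h \<omega>" by auto
    have "\<bar>y i - y j\<bar> \<le> d (c i) (c j)" "d (c i) (c j) \<le> y i + y j" for i j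
      using triangle[OF c[of i] c[of j] \<pi>Y[OF \<omega>(1)]] triangle[OF c[of j] c[of i] \<pi>Y[OF \<omega>(1)]]
        triangle[OF c[of i] \<pi>Y[OF \<omega>(1)] c[of j]] commute[of "c i" "c j"] commute[of "\<pi> \<omega>" "c j"]
      by (auto simp: \<omega>(2) h_def)
    moreover have "\<exists>i. y i < 1 / real (Suc k)" for k
      using dense[OF \<pi>Y[OF \<omega>(1)], of "1 / real (Suc k)"] by (simp add: \<omega>(2) h_def)
    ultimately show "y \<in> ?R" by auto
  next
    fix y assume y: "y \<in> ?R"
    then have "\<forall>k. \<exists>i. y i < 1 / real (Suc k)" by auto
    then obtain i where i: "\<And>k. y (i k) < 1 / real (Suc k)" by metis
    have y0: "0 \<le> y j" for j
    proof -
      have "d (c j) (c j) \<le> y j + y j" using y by blast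
      then show ?thesis using mdist_zero[OF c] by simp
    qed
    have yi: "(\<lambda>k. y (i k)) \<longlonglongrightarrow> 0"
      by (rule tendsto_sandwich[of "\<lambda>_. 0" _ _ "\<lambda>k. 1 / real (Suc k)"])
         (use y0 i LIMSEQ_inverse_real_of_nat in \<open>auto simp: inverse_eq_divide intro!: always_eventually less_imp_le\<close>)
    \<comment> \<open>The inequality \<open>d (c i) (c j) \<le> y i + y j\<close> makes the centres
      with small coordinates mutually close. By completeness they converge, and the distances from
      their limit to the dense points are the prescribed \<open>y j\<close>.\<close>
    have "MCauchy (\<lambda>k. c (i k))"
      unfolding MCauchy_def
    proof (intro conjI allI impI)
      fix e :: real assume "0 < e"
      then have "eventually (\<lambda>k. y (i k) < e / 2) sequentially" using yi by (intro order_tendstoD) auto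
      then obtain K where K: "\<And>k. k \<ge> K \<Longrightarrow> y (i k) < e / 2" by (auto simp: eventually_sequentially)
      show "\<exists>K. \<forall>n n'. K \<le> n \<longrightarrow> K \<le> n' \<longrightarrow> d (c (i n)) (c (i n')) < e"
      proof (intro exI[of _ K] allI impI)
        fix n n' assume "K \<le> n" "K \<le> n'"
        moreover have "d (c (i n)) (c (i n')) \<le> y (i n) + y (i n')" using y by blast
        ultimately show "d (c (i n)) (c (i n')) < e" using K[of n] K[of n'] by linarith
      qed
    qed (use c in auto)
    then obtain x where x: "limitin mtopology (\<lambda>k. c (i k)) x sequentially"
      using Y(2) unfolding mcomplete_def by blast
    then have xY: "x \<in> Y" using limitin_mspace by blast
    then obtain \<omega> where \<omega>: "\<omega> \<in> \<Omega>" "\<pi> \<omega> = x" using \<pi> top by auto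
    have dx: "(\<lambda>k. d (c (i k)) x) \<longlonglongrightarrow> 0"
      using x unfolding limitin_metric_dist_null by auto
    have "h \<omega> j = y j" for j
    proof -
      have "(\<lambda>k. y (i k) + d (c (i k)) x) \<longlonglongrightarrow> 0 + 0" by (intro tendsto_add yi dx)
      moreover have "\<bar>h \<omega> j - y j\<bar> \<le> y (i k) + d (c (i k)) x" for k
      proof -
        have "\<bar>y j - y (i k)\<bar> \<le> d (c j) (c (i k))" "d (c j) (c (i k)) \<le> y j + y (i k)" using y by blast+
        moreover have "d (c j) x \<le> d (c j) (c (i k)) + d (c (i k)) x" by (rule triangle[OF c c xY])
        moreover have "d (c j) (c (i k)) \<le> d (c j) x + d (c (i k)) x"
          using triangle[OF c xY c, of j "i k"] commute by metis
        ultimately show ?thesis by (simp add: h_def \<omega>(2) abs_le_iff)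
      qed
      ultimately have "\<bar>h \<omega> j - y j\<bar> \<le> 0" by (intro LIMSEQ_le_const[of _ 0]) auto
      then show ?thesis by simp
    qed
    then show "y \<in> h ` \<Omega>" using \<omega>(1) by (intro image_eqI[of _ _ \<omega>]) auto
  qed
  have coord [measurable]: "(\<lambda>y :: nat \<Rightarrow> real. y i) \<in> borel_measurable borel" for i
    by (intro borel_measurable_continuous_onI continuous_on_product_coordinates)
  have "?R \<in> sets borel" by measurable
  moreover have "{\<pi> -` B \<inter> \<Omega> | B. B \<in> borel_sets_of S} = {h -` B \<inter> \<Omega> | B. B \<in> sets borel}"
  proof -
    define G where "G = vimage_algebra \<Omega> \<pi> (sigma (topspace S) {U. openin S U})"
    have op: "{U. openin S U} \<subseteq> Pow (topspace S)" using openin_subset by auto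
    have "\<pi> \<in> \<Omega> \<rightarrow> topspace S" using \<pi> by auto
    then have setsG: "sets G = {\<pi> -` B \<inter> \<Omega> | B. B \<in> borel_sets_of S}"
      using op by (simp add: G_def sets_vimage_algebra2 borel_sets_of_def space_measure_of sets_measure_of)
    have spG: "space G = \<Omega>" by (simp add: G_def)
    have setsH: "sets (vimage_algebra \<Omega> h borel) = {h -` B \<inter> \<Omega> | B. B \<in> sets borel}"
      by (simp add: sets_vimage_algebra2)
    have "h \<in> borel_measurable G"
    proof (rule measurable_coordinatewise_then_product)
      fix i
      show "(\<lambda>\<omega>. h \<omega> i) \<in> borel_measurable G"
      proof (rule borel_measurableI_less)
        fix r
        have "{\<omega> \<in> space G. h \<omega> i < r} = \<pi> -` mball (c i) r \<inter> \<Omega>"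
          using \<pi>Y c by (auto simp: spG h_def)
        moreover have "openin S (mball (c i) r)" using Y(3) by simp
        ultimately show "{\<omega> \<in> space G. h \<omega> i < r} \<in> sets G"
          unfolding setsG borel_sets_of_def by auto
      qed
    qed
    then have "sets (vimage_algebra \<Omega> h borel) \<subseteq> sets G"
      using measurable_sets[of h G borel] spG unfolding setsH by auto
    moreover have "\<pi> -` B \<inter> \<Omega> \<in> sets (vimage_algebra \<Omega> h borel)" if "B \<in> borel_sets_of S" for B
      using that unfolding borel_sets_of_def
    proof (induction rule: sigma_sets.induct)
      case (Basic U)
      then have U: "openin mtopology U" using Y(3) by simp
      \<comment> \<open>Balls of radius \<open>1 / (k + 1)\<close> around the dense points form a
        countable base, so the preimage of an open set is a countable union of conditions on single
        coordinates of \<open>h\<close>.\<close>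
      define I where "I = {(i, k). mball (c i) (1 / real (Suc k)) \<subseteq> U}"
      have "\<pi> -` U \<inter> \<Omega> = (\<Union>(i, k)\<in>I. h -` {y. y i < 1 / real (Suc k)} \<inter> \<Omega>)"
      proof (intro equalityI subsetI)
        fix \<omega> assume \<omega>: "\<omega> \<in> \<pi> -` U \<inter> \<Omega>"
        then obtain r where r: "r > 0" "mball (\<pi> \<omega>) r \<subseteq> U" using U by (auto simp: openin_mtopology)
        obtain k where k: "1 / real (Suc k) < r / 2" using nat_approx_posE[of "r/2"] r(1) by auto
        obtain i where i: "d (c i) (\<pi> \<omega>) < 1 / real (Suc k)" using dense[OF \<pi>Y, of \<omega> "1 / real (Suc k)"] \<omega> by auto
        have "mball (c i) (1 / real (Suc k)) \<subseteq> U"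
        proof
          fix z assume z: "z \<in> mball (c i) (1 / real (Suc k))"
          then have zY: "z \<in> Y" "d (c i) z < 1 / real (Suc k)" by auto
          have "d (\<pi> \<omega>) z \<le> d (\<pi> \<omega>) (c i) + d (c i) z" using triangle[OF \<pi>Y c zY(1)] \<omega> by auto
          then have "d (\<pi> \<omega>) z < r" using commute[of "\<pi> \<omega>" "c i"] i zY(2) k by linarith
          then show "z \<in> U" using r(2) zY \<pi>Y \<omega> by auto
        qed
        then show "\<omega> \<in> (\<Union>(i, k)\<in>I. h -` {y. y i < 1 / real (Suc k)} \<inter> \<Omega>)"
          using i \<omega> by (auto simp: I_def h_def intro!: bexI[of _ "(i, k)"])
      next
        fix \<omega> assume "\<omega> \<in> (\<Union>(i, k)\<in>I. h -` {y. y i < 1 / real (Suc k)} \<inter> \<Omega>)"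
        then obtain i k where ik: "mball (c i) (1 / real (Suc k)) \<subseteq> U" "h \<omega> i < 1 / real (Suc k)" "\<omega> \<in> \<Omega>"
          by (auto simp: I_def)
        then show "\<omega> \<in> \<pi> -` U \<inter> \<Omega>" using \<pi>Y[OF ik(3)] c[of i] by (auto simp: h_def)
      qed
      also have "\<dots> \<in> sets (vimage_algebra \<Omega> h borel)"
      proof (rule sets.countable_UN'')
        fix p assume "p \<in> I"
        obtain i k where p: "p = (i, k)" by (cases p)
        have "{y :: nat \<Rightarrow> real. y i < 1 / real (Suc k)} \<in> sets borel" by measurable
        then show "(case p of (i, k) \<Rightarrow> h -` {y. y i < 1 / real (Suc k)} \<inter> \<Omega>) \<in> sets (vimage_algebra \<Omega> h borel)"
          unfolding setsH p prod.case by blast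
      qed auto
      finally show ?case .
    next
      case (Compl B)
      have "\<pi> -` (topspace S - B) \<inter> \<Omega> = space (vimage_algebra \<Omega> h borel) - (\<pi> -` B \<inter> \<Omega>)"
        using \<pi> by auto
      then show ?case using Compl.IH by (metis sets.compl_sets)
    next
      case (Union B)
      have "\<pi> -` (\<Union>i. B i) \<inter> \<Omega> = (\<Union>i. \<pi> -` B i \<inter> \<Omega>)" by auto
      moreover have "(\<Union>i. \<pi> -` B i \<inter> \<Omega>) \<in> sets (vimage_algebra \<Omega> h borel)"
        using Union.IH by (intro sets.countable_UN) auto
      ultimately show ?case by (simp only:)
    qed auto
    ultimately show ?thesis using setsG setsH by auto
  qed
  ultimately show ?thesis using that[of h] img by simp
qed

text \<open>Doob-Dynkin factorisation of \<open>g\<close> through \<open>h\<close>. Since singletons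
  are Borel, \<open>g\<close> cannot separate points that \<open>h\<close> identifies, so
  \<open>p\<close> is well defined on the image; extended by a constant it stays measurable because
  the image is Borel.\<close>

lemma measurable_restricted_eq_on_image:
  fixes h g :: "'a \<Rightarrow> 'b::topological_space"
  assumes img: "h ` \<Omega> \<in> sets borel"
    and g: "\<And>B. B \<in> sets borel \<Longrightarrow> \<exists>D\<in>sets borel. g -` B \<inter> \<Omega> = h -` D \<inter> \<Omega>"
    and sing: "\<And>x::'b. {x} \<in> sets borel"
  obtains p where "p \<in> borel_measurable borel" "\<And>\<omega>. \<omega> \<in> \<Omega> \<Longrightarrow> g \<omega> = p (h \<omega>)"
proof -
  define p where "p y = (if y \<in> h ` \<Omega> then g (inv_into \<Omega> h y) else undefined)" for y
  have gh: "g \<omega> = g \<omega>'" if "\<omega> \<in> \<Omega>" "\<omega>' \<in> \<Omega>" "h \<omega> = h \<omega>'" for \<omega> \<omega>'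
    using g[OF sing[of "g \<omega>"]] that by (auto simp: set_eq_iff) metis
  have ph: "g \<omega> = p (h \<omega>)" if "\<omega> \<in> \<Omega>" for \<omega>
    using gh[OF that inv_into_into[of "h \<omega>" h \<Omega>]] that by (simp add: p_def f_inv_into_f)
  have "p \<in> borel_measurable borel"
  proof (rule measurableI)
    fix B :: "'b set" assume B: "B \<in> sets borel"
    from g[OF B] obtain D where D: "D \<in> sets borel" "g -` B \<inter> \<Omega> = h -` D \<inter> \<Omega>" by (elim bexE)
    have "p -` B \<inter> space borel = (D \<inter> h ` \<Omega>) \<union> (if undefined \<in> B then - h ` \<Omega> else {})"
    proof (rule set_eqI)
      fix y
      show "y \<in> p -` B \<inter> space borel \<longleftrightarrow> y \<in> (D \<inter> h ` \<Omega>) \<union> (if undefined \<in> B then - h ` \<Omega> else {})"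
      proof (cases "y \<in> h ` \<Omega>")
        case True
        then obtain \<omega> where \<omega>: "\<omega> \<in> \<Omega>" "y = h \<omega>" by auto
        have "\<omega> \<in> g -` B \<inter> \<Omega> \<longleftrightarrow> \<omega> \<in> h -` D \<inter> \<Omega>" using D(2) by simp
        then show ?thesis using \<omega> ph[OF \<omega>(1)] True by auto
      next
        case False
        then show ?thesis by (auto simp: p_def)
      qed
    qed
    also have "\<dots> \<in> sets borel" using D(1) img by auto
    finally show "p -` B \<inter> space borel \<in> sets borel" .
  qed simp
  then show ?thesis using ph that by blast
qed

text \<open>
  Kolmogorov's theorem gives a measure on sequences of points of the Polish spaces; condition (3) of
  property (P) says that the image of \<open>\<Omega>\<close> in the space of sequences is the set of coherent
  sequences, which is Borel and of full measure.
\<close>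

theorem property_P_extension:
  fixes M :: "'a measure" and F :: "real \<Rightarrow> 'a measure" and \<mu> :: "nat \<Rightarrow> 'a measure"
  assumes "filtered_prob_space M F" and P: "property_P M F"
    and prob: "\<And>n. prob_space (\<mu> n)" and sets_\<mu>: "\<And>n. sets (\<mu> n) = sets (F (real n))"
    and consistent: "\<And>n B. B \<in> sets (F (real n)) \<Longrightarrow> emeasure (\<mu> (Suc n)) B = emeasure (\<mu> n) B"
  shows "\<exists>Q. sets Q = sets M \<and> (\<forall>n. \<forall>B\<in>sets (F (real n)). emeasure Q B = emeasure (\<mu> n) B)"
proof -
  interpret filtered_prob_space M F by fact
  define \<Omega> where "\<Omega> = space M"
  obtain G where sets_M: "sets M = sets (sigma_infinity \<Omega> F)"
    and G: "real_filtration \<Omega> G"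
    and FG': "\<forall>t\<ge>0. sets (F t) = (\<Inter>s\<in>{t<..}. sets (G s))"
    and polish: "\<forall>t\<ge>0. \<exists>(S :: 'a topology) \<pi>.
            polish_topology S \<and> \<pi> ` \<Omega> = topspace S \<and>
            sets (G t) = {\<pi> -` B \<inter> \<Omega> | B. B \<in> borel_sets_of S} \<and>
            (\<forall>B\<in>sets (G t). \<forall>\<omega>\<in>\<Omega>. \<pi> \<omega> \<in> \<pi> ` B \<longrightarrow> \<omega> \<in> B)"
    and atoms: "\<forall>\<omega> :: nat \<Rightarrow> 'a. (\<forall>n. \<omega> n \<in> \<Omega>) \<longrightarrow>
                (\<forall>N. (\<Inter>n\<in>{..N}. atom_at (G (real n)) (\<omega> n)) \<noteq> {}) \<longrightarrow>
                (\<Inter>n. atom_at (G (real n)) (\<omega> n)) \<noteq> {}"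
    using P[unfolded property_P_def, folded \<Omega>_def] by (elim conjE exE) (rule that; assumption)
  have FG: "sets (F t) = (\<Inter>s\<in>{t<..}. sets (G s))" if "0 \<le> t" for t using FG' that by blast
  have G_mono: "sets (G s) \<subseteq> sets (G t)" if "0 \<le> s" "s \<le> t" for s t
  proof -
    have "sets (extend_filtration \<Omega> G (ennreal s)) \<subseteq> sets (extend_filtration \<Omega> G (ennreal t))"
      by (rule filtration.sets_F_mono[OF G[unfolded real_filtration_def]])
         (simp add: that ennreal_leI)
    then show ?thesis using that by (simp add: extend_filtration_def)
  qed
  \<comment> \<open>\<open>F t\<close> lies between \<open>G t\<close> and every later
    \<open>G s\<close>. The construction can therefore be carried out with \<open>G\<close>, to
    which the Polish spaces belong, and transferred to \<open>F\<close> at the price of one step of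
    time.\<close>
  have GF: "sets (G t) \<subseteq> sets (F t)" if "0 \<le> t" for t
    unfolding FG[OF that] by (intro INT_greatest G_mono) (use that in auto)
  have FG_less: "sets (F s) \<subseteq> sets (G t)" if "0 \<le> s" "s < t" for s t
    unfolding FG[OF that(1)] using that by auto
  have sp_\<mu>: "space (\<mu> n) = \<Omega>" for n
    using sets_eq_imp_space_eq[OF sets_\<mu>[of n]] space_F[of "real n"] by (simp add: \<Omega>_def)
  have "\<forall>n. \<exists>h :: 'a \<Rightarrow> nat \<Rightarrow> real. h ` \<Omega> \<in> sets borel \<and> sets (G (real n)) = {h -` B \<inter> \<Omega> | B. B \<in> sets borel}"
  proof
    fix n
    obtain S :: "'a topology" and \<pi> where S: "polish_topology S" "\<pi> ` \<Omega> = topspace S"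
      "sets (G (real n)) = {\<pi> -` B \<inter> \<Omega> | B. B \<in> borel_sets_of S}"
      using polish[rule_format, of "real n"] by auto
    obtain h :: "'a \<Rightarrow> nat \<Rightarrow> real" where h: "h ` \<Omega> \<in> sets borel"
      "{\<pi> -` B \<inter> \<Omega> | B. B \<in> borel_sets_of S} = {h -` B \<inter> \<Omega> | B. B \<in> sets borel}"
      by (rule polish_vimage_real_sequences[OF S(1,2)])
    show "\<exists>h :: 'a \<Rightarrow> nat \<Rightarrow> real. h ` \<Omega> \<in> sets borel \<and> sets (G (real n)) = {h -` B \<inter> \<Omega> | B. B \<in> sets borel}"
      by (rule exI[of _ h], rule conjI, rule h(1)) (simp only: S(3) h(2))
  qed
  from choice[OF this] obtain h :: "nat \<Rightarrow> 'a \<Rightarrow> nat \<Rightarrow> real"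
    where h: "\<forall>n. h n ` \<Omega> \<in> sets borel \<and> sets (G (real n)) = {h n -` B \<inter> \<Omega> | B. B \<in> sets borel}"
    by (elim exE)
  then have img: "h n ` \<Omega> \<in> sets borel" and sets_G: "sets (G (real n)) = {h n -` B \<inter> \<Omega> | B. B \<in> sets borel}" for n
    by simp_all
  have h_G: "h i -` B \<inter> \<Omega> \<in> sets (G (real n))" if "i \<le> n" "B \<in> sets borel" for i n B
  proof -
    have "h i -` B \<inter> \<Omega> \<in> sets (G (real i))" unfolding sets_G using that(2) by blast
    moreover have "sets (G (real i)) \<subseteq> sets (G (real n))" by (rule G_mono) (use that in auto)
    ultimately show ?thesis by blast
  qed
  have h_meas: "h i \<in> borel_measurable (\<mu> n)" if "i \<le> n" for i n
    by (rule measurableI) (use h_G[OF that] GF[of "real n"] in \<open>auto simp: sets_\<mu> sp_\<mu>\<close>)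
  have "\<exists>p. p \<in> borel_measurable borel \<and> (\<forall>\<omega>\<in>\<Omega>. h i \<omega> = p (h n \<omega>))" if le: "i \<le> n" for i n
  proof -
    obtain p where "p \<in> borel_measurable borel" "\<And>\<omega>. \<omega> \<in> \<Omega> \<Longrightarrow> h i \<omega> = p (h n \<omega>)"
    proof (rule measurable_restricted_eq_on_image[OF img[of n], of "h i"])
      fix B :: "(nat \<Rightarrow> real) set" assume B: "B \<in> sets borel"
      show "\<exists>D\<in>sets borel. h i -` B \<inter> \<Omega> = h n -` D \<inter> \<Omega>"
        using h_G[OF le B, unfolded sets_G] by (elim CollectE exE conjE) (rule bexI)
    qed auto
    then show ?thesis by auto
  qed
  then obtain p where p: "\<And>i n. i \<le> n \<Longrightarrow> p i n \<in> borel_measurable borel"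
    and hp: "\<And>i n \<omega>. i \<le> n \<Longrightarrow> \<omega> \<in> \<Omega> \<Longrightarrow> h i \<omega> = p i n (h n \<omega>)" by metis
  have cons: "emeasure (\<mu> n) B = emeasure (\<mu> m) B" if "m \<le> n" "B \<in> sets (F (real m))" for m n B
    using that(1)
  proof (induction n rule: dec_induct)
    case (step n)
    have "B \<in> sets (F (real n))" using that(2) sets_F_mono[of "real m" "real n"] step(1) by auto
    then show ?case using consistent step by simp
  qed simp
  let ?b = "\<lambda>_::nat. borel :: (nat \<Rightarrow> real) measure"
  \<comment> \<open>The joint law of the coordinates in \<open>J\<close> is taken under the measure
    of the latest index; by consistency any later measure gives the same law. Inserting 0 covers the
    empty \<open>J\<close>.\<close>
  define top where "top J = Max (insert 0 J)" for J :: "nat set"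
  have top: "i \<le> top J" if "finite J" "i \<in> J" for i J using that by (auto simp: top_def)
  define HJ where "HJ J \<omega> = (\<lambda>i\<in>J. h i \<omega>)" for J \<omega>
  define PJ where "PJ J = distr (\<mu> (top J)) (PiM J ?b) (HJ J)" for J
  have HJ: "HJ J \<in> measurable (\<mu> n) (PiM J ?b)" if "\<And>i. i \<in> J \<Longrightarrow> i \<le> n" for J n
    unfolding HJ_def by (intro measurable_restrict h_meas that)
  interpret polish_projective UNIV PJ
  proof (intro polish_projective.intro projective_family.intro)
    fix J K :: "nat set" assume JK: "J \<subseteq> K" "finite K" "K \<subseteq> UNIV"
    have fJ: "finite J" using JK finite_subset by auto
    have tt: "top J \<le> top K" unfolding top_def using JK by (intro Max_mono) auto
    have "distr (PJ K) (PiM J ?b) (\<lambda>f. restrict f J) = distr (\<mu> (top K)) (PiM J ?b) ((\<lambda>f. restrict f J) \<circ> HJ K)"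
      unfolding PJ_def using JK top by (intro distr_distr measurable_restrict_subset HJ) auto
    also have "(\<lambda>f. restrict f J) \<circ> HJ K = HJ J" using JK by (auto simp: HJ_def fun_eq_iff)
    also have "distr (\<mu> (top K)) (PiM J ?b) (HJ J) = PJ J"
    proof (rule measure_eqI)
      fix B assume B: "B \<in> sets (distr (\<mu> (top K)) (PiM J ?b) (HJ J))"
      then have "HJ J -` B \<inter> \<Omega> \<in> sets (F (real (top J)))"
        using measurable_sets[OF HJ[of J "top J"], of B] top[OF fJ] by (simp add: sets_\<mu> sp_\<mu>)
      then show "emeasure (distr (\<mu> (top K)) (PiM J ?b) (HJ J)) B = emeasure (PJ J) B"
        using B cons[OF tt] top[OF fJ] top[OF JK(2)] JK
        by (simp add: PJ_def emeasure_distr HJ sp_\<mu> subset_eq)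
    qed (simp add: PJ_def)
    finally show "PJ J = distr (PJ K) (PiM J ?b) (\<lambda>f. restrict f J)" ..
  next
    fix J :: "nat set" assume "finite J"
    then show "prob_space (PJ J)"
      unfolding PJ_def using top by (intro prob_space.prob_space_distr prob HJ) auto
  qed
  \<comment> \<open>Coherence up to \<open>n\<close>: coordinate \<open>n\<close> comes from a point
    of \<open>\<Omega>\<close> and determines all earlier coordinates. In the next identity
    \<open>Y n\<close> becomes a cylinder, and equality of real sequences is tested entry by entry
    to make it visibly Borel.\<close>
  define Y where "Y n = {x. x n \<in> h n ` \<Omega> \<and> (\<forall>i\<le>n. x i = p i n (x n))}" for n
  have cylinder: "emeasure lim {x. restrict x J \<in> B} = emeasure (\<mu> (top J)) (HJ J -` B \<inter> \<Omega>)"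
    if "finite J" "B \<in> sets (PiM J ?b)" for J B
  proof -
    have "{x. restrict x J \<in> B} = emb UNIV J B" by (auto simp: prod_emb_def space_PiM)
    then show ?thesis using emeasure_lim_emb[of J B] that top[OF that(1)]
      by (simp add: PJ_def emeasure_distr HJ sp_\<mu>)
  qed
  have [measurable]: "(\<lambda>y :: nat \<Rightarrow> real. y i) \<in> borel_measurable borel" for i
    by (intro borel_measurable_continuous_onI continuous_on_product_coordinates)
  have Y_eq: "Y n = {x. restrict x {..n} \<in> {x\<in>space (PiM {..n} ?b). x n \<in> h n ` \<Omega> \<and> (\<forall>i\<in>{..n}. \<forall>j. x i j = p i n (x n) j)}}"
    (is "_ = {x. _ \<in> ?B n}") for n
    by (auto simp: Y_def space_PiM fun_eq_iff)
  have B_sets: "?B n \<in> sets (PiM {..n} ?b)" for n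
  proof -
    have [measurable]: "h n ` \<Omega> \<in> sets borel" by (rule img)
    have [measurable]: "(\<lambda>x. x n) \<in> measurable (PiM {..n} ?b) borel"
      by (rule measurable_component_singleton) simp
    have [measurable]: "Measurable.pred (PiM {..n} ?b) (\<lambda>x. x i j = p i n (x n) j)" if i: "i \<in> {..n}" for i j
    proof -
      have 1: "(\<lambda>x. x i j) \<in> borel_measurable (PiM {..n} ?b)"
        by (rule measurable_compose[OF measurable_component_singleton[OF i]]) measurable
      have "(\<lambda>x. p i n (x n)) \<in> borel_measurable (PiM {..n} ?b)"
        by (rule measurable_compose[OF _ p]) (use i in auto)
      then have 2: "(\<lambda>x. p i n (x n) j) \<in> borel_measurable (PiM {..n} ?b)"
        by (rule measurable_compose) measurable
      show ?thesis unfolding pred_def using borel_measurable_eq[OF 1 2] .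
    qed
    show ?thesis by measurable
  qed
  have Y_sets: "Y n \<in> sets lim" for n
    unfolding Y_eq using measurable_sets[OF measurable_restrict_subset[of "{..n}" UNIV ?b] B_sets]
    by (simp add: vimage_def space_PiM)
  have "emeasure lim (Y n) = 1" for n
  proof -
    have "HJ {..n} -` ?B n \<inter> \<Omega> = \<Omega>"
      using hp by (auto simp: HJ_def space_PiM PiE_def)
    then show ?thesis
      unfolding Y_eq cylinder[OF finite_atMost B_sets]
      using prob_space.emeasure_space_1[OF prob] by (simp add: sp_\<mu>)
  qed
  then have "AE x in lim. x \<in> Y n" for n
    by (intro P.AE_prob_1) (simp add: measure_def)
  then have AE_Y: "AE x in lim. x \<in> (\<Inter>n. Y n)" by (simp add: AE_all_countable)
  have ex: "\<exists>\<omega>\<in>\<Omega>. \<forall>n. h n \<omega> = x n" if x: "x \<in> (\<Inter>n. Y n)" for x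
  proof -
    define w where "w n = inv_into \<Omega> (h n) (x n)" for n
    have w: "w n \<in> \<Omega>" "h n (w n) = x n" for n
      using x by (auto simp: w_def Y_def inv_into_into f_inv_into_f)
    have hw: "h i (w n) = x i" if "i \<le> n" for i n
      using hp[OF that w(1)] x that w(2) by (auto simp: Y_def)
    have "w N \<in> atom_at (G (real n)) (w n)" if "n \<le> N" for n N
      using w hw[OF that] by (auto simp: atom_at_def sets_G)
    then have "w N \<in> (\<Inter>n\<in>{..N}. atom_at (G (real n)) (w n))" for N by (intro INT_I) simp
    then have "(\<Inter>n\<in>{..N}. atom_at (G (real n)) (w n)) \<noteq> {}" for N by blast
    then have "(\<Inter>n. atom_at (G (real n)) (w n)) \<noteq> {}"
      using atoms[THEN spec, of w] w(1) by blast
    then obtain \<omega> where \<omega>: "\<And>n. \<omega> \<in> atom_at (G (real n)) (w n)" by blast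
    have "\<omega> \<in> h n -` {x n} \<inter> \<Omega>" for n
    proof -
      have "h n -` {x n} \<inter> \<Omega> \<in> sets (G (real n))" by (intro h_G) auto
      moreover have "w n \<in> h n -` {x n} \<inter> \<Omega>" using w by auto
      ultimately show ?thesis using \<omega>[of n] unfolding atom_at_def by blast
    qed
    then show ?thesis by auto
  qed
  obtain \<omega>0 where \<omega>0: "\<omega>0 \<in> \<Omega>" using prob_space.not_empty[OF prob[of 0]] by (auto simp: sp_\<mu>)
  \<comment> \<open>An arbitrary choice of preimages is nevertheless measurable: sets in
    \<open>G n\<close> depend on \<open>h n\<close> only, and \<open>h n (k x)\<close> is the
    coordinate \<open>x n\<close>. The default \<open>\<omega>0\<close> is used on a null
    set.\<close>
  define k where "k x = (if x \<in> (\<Inter>n. Y n) then SOME \<omega>. \<omega> \<in> \<Omega> \<and> (\<forall>n. h n \<omega> = x n) else \<omega>0)" for x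
  have k: "k x \<in> \<Omega>" "x \<in> (\<Inter>n. Y n) \<Longrightarrow> h n (k x) = x n" for x n
  proof -
    have *: "k x \<in> \<Omega> \<and> (\<forall>n. h n (k x) = x n)" if "x \<in> (\<Inter>n. Y n)"
      using ex[OF that] someI_ex[of "\<lambda>\<omega>. \<omega> \<in> \<Omega> \<and> (\<forall>n. h n \<omega> = x n)"] that by (auto simp: k_def)
    then show "x \<in> (\<Inter>n. Y n) \<Longrightarrow> h n (k x) = x n" by auto
    show "k x \<in> \<Omega>" using * \<omega>0 by (cases "x \<in> (\<Inter>n. Y n)") (auto simp: k_def)
  qed
  have YI: "(\<Inter>n. Y n) \<in> sets lim" using Y_sets by auto
  have coord: "{x. x n \<in> C} \<in> sets lim" if "C \<in> sets borel" for n C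
    using measurable_sets[OF measurable_component_singleton[of n UNIV ?b] that]
    by (simp add: vimage_def space_PiM)
  have vim: "k -` (h n -` C \<inter> \<Omega>) \<inter> space lim = ((\<Inter>n. Y n) \<inter> {x. x n \<in> C}) \<union> (if h n \<omega>0 \<in> C then - (\<Inter>n. Y n) else {})" for n C
    using k(1) k(2)[of _ n] by (auto simp: space_PiM k_def[of _] split: if_splits)
  have compl: "- (\<Inter>n. Y n) \<in> sets lim"
    using sets.compl_sets[OF YI] by (simp add: space_PiM Compl_eq_Diff_UNIV)
  have k_sets: "k -` B \<inter> space lim \<in> sets lim" if B: "B \<in> sets (G (real n))" for n B
  proof -
    obtain C where C: "C \<in> sets borel" "B = h n -` C \<inter> \<Omega>"
      using B unfolding sets_G by (elim CollectE exE conjE)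
    show ?thesis unfolding C(2) vim using YI coord[OF C(1), of n] compl by auto
  qed
  have sets_M': "sets M = sigma_sets \<Omega> (\<Union>t\<in>{0..}. sets (F t))"
  proof -
    have "(\<Union>t\<in>{0..}. sets (F t)) \<subseteq> Pow \<Omega>" using sets.sets_into_space space_F by (fastforce simp: \<Omega>_def)
    then show ?thesis unfolding sets_M sigma_infinity_def by simp
  qed
  have k_meas: "k \<in> measurable lim M"
  proof (rule measurable_sigma_sets[OF sets_M'])
    show "(\<Union>t\<in>{0..}. sets (F t)) \<subseteq> Pow \<Omega>" using sets.sets_into_space space_F by (fastforce simp: \<Omega>_def)
    show "k \<in> space lim \<rightarrow> \<Omega>" using k by auto
    fix B assume "B \<in> (\<Union>t\<in>{0..}. sets (F t))"
    then obtain t where t: "0 \<le> t" "B \<in> sets (F t)" by auto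
    obtain n :: nat where n: "t < real n" using reals_Archimedean2 by blast
    then show "k -` B \<inter> space lim \<in> sets lim" using t FG_less[OF t(1) n] by (intro k_sets[of B n]) auto
  qed
  have Q_G: "emeasure (distr lim M k) B = emeasure (\<mu> n) B" if B: "B \<in> sets (G (real n))" for n B
  proof -
    obtain C where C: "C \<in> sets borel" "B = h n -` C \<inter> \<Omega>"
      using B unfolding sets_G by (elim CollectE exE conjE)
    have "B \<in> sets M" using B GF[of "real n"] sets_F_subset[of "real n"] by auto
    then have "emeasure (distr lim M k) B = emeasure lim (k -` B \<inter> space lim)"
      by (intro emeasure_distr k_meas)
    also have "\<dots> = emeasure lim {x. x n \<in> C}"
    proof (rule emeasure_eq_AE)
      show "AE x in lim. x \<in> k -` B \<inter> space lim \<longleftrightarrow> x \<in> {x. x n \<in> C}"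
        using AE_Y by eventually_elim (use k(1) k(2)[of _ n] in \<open>auto simp: C(2) space_PiM\<close>)
    qed (use k_sets[OF B] coord[OF C(1)] in auto)
    also have "{x. x n \<in> C} = {x. restrict x {n} \<in> {y\<in>space (PiM {n} ?b). y n \<in> C}}"
      by (auto simp: space_PiM)
    also have "emeasure lim \<dots> = emeasure (\<mu> (top {n})) (HJ {n} -` {y\<in>space (PiM {n} ?b). y n \<in> C} \<inter> \<Omega>)"
    proof (rule cylinder)
      show "{y\<in>space (PiM {n} ?b). y n \<in> C} \<in> sets (PiM {n} ?b)"
        using measurable_sets[OF measurable_component_singleton[of n "{n}" ?b] C(1)]
        by (simp add: vimage_def Collect_conj_eq Int_commute)
    qed simp
    also have "HJ {n} -` {y\<in>space (PiM {n} ?b). y n \<in> C} \<inter> \<Omega> = B"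
      by (auto simp: C(2) HJ_def space_PiM)
    finally show ?thesis by (simp add: top_def)
  qed
  \<comment> \<open>\<open>F n\<close> may be larger than \<open>G n\<close>, but it is contained in
    \<open>G (n + 1)\<close>; consistency then leads back from index \<open>n + 1\<close> to
    \<open>n\<close>.\<close>
  have "emeasure (distr lim M k) B = emeasure (\<mu> n) B" if B: "B \<in> sets (F (real n))" for n B
    using Q_G[of B "Suc n"] FG_less[of "real n" "real (Suc n)"] B consistent[OF B] by auto
  then show ?thesis by (intro exI[of _ "distr lim M k"]) auto
qed

section \<open>Densities and completions\<close>

lemma emeasure_density_integral:
  fixes d :: "'a \<Rightarrow> real"
  assumes d: "integrable M d" "\<And>x. x \<in> space M \<Longrightarrow> 0 \<le> d x" and L: "\<Lambda> \<in> sets M"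
  shows "emeasure (density M (\<lambda>x. ennreal (d x))) \<Lambda> = ennreal (\<integral>x. indicator \<Lambda> x * d x \<partial>M)"
proof -
  have "emeasure (density M (\<lambda>x. ennreal (d x))) \<Lambda> = (\<integral>\<^sup>+x. ennreal (d x) * indicator \<Lambda> x \<partial>M)"
    by (rule emeasure_density) (use d L in auto)
  also have "\<dots> = (\<integral>\<^sup>+x. ennreal (indicator \<Lambda> x * d x) \<partial>M)"
    by (intro nn_integral_cong) (auto split: split_indicator)
  also have "\<dots> = ennreal (\<integral>x. indicator \<Lambda> x * d x \<partial>M)"
  proof (rule nn_integral_eq_integral)
    show "integrable M (\<lambda>x. indicator \<Lambda> x * d x)"
      using integrable_real_mult_indicator[OF L d(1)] by (simp add: mult.commute)
  qed (use d in \<open>auto intro!: AE_I2\<close>)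
  finally show ?thesis .
qed

text \<open>The hypothesis \<open>eq\<close> says that \<open>R\<close> restricted to
  \<open>B\<close> and \<open>M\<close> with density \<open>d\<close> have the same trace on
  \<open>G\<close>. Integrals of \<open>G\<close>-measurable functions depend on this trace only,
  and it is finite, so bounded functions are integrable.\<close>

lemma restr_measure_integral_eq:
  fixes f :: "'a \<Rightarrow> real" and d :: "'a \<Rightarrow> real"
  assumes sub: "subalgebra M G" and sets: "sets R = sets M"
    and B: "B \<in> sets M" and d: "d \<in> borel_measurable M" "\<And>x. x \<in> space M \<Longrightarrow> 0 \<le> d x" "integrable M d"
    and eq: "\<And>\<Lambda>. \<Lambda> \<in> sets G \<Longrightarrow> emeasure R (\<Lambda> \<inter> B) = ennreal (\<integral>x. indicator \<Lambda> x * d x \<partial>M)"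
    and f: "f \<in> borel_measurable G" "\<And>x. x \<in> space M \<Longrightarrow> \<bar>f x\<bar> \<le> K"
  shows "has_bochner_integral R (\<lambda>x. f x * indicator B x) (\<integral>x. f x * d x \<partial>M)"
proof -
  have sp: "space R = space M" using sets by (rule sets_eq_imp_space_eq)
  have fM: "f \<in> borel_measurable M" using measurable_from_subalg[OF sub f(1)] .
  have fR: "f \<in> borel_measurable R" using fM by (simp add: measurable_cong_sets[OF sets refl])
  let ?R = "density R (\<lambda>x. ennreal (indicator B x))" and ?M = "density M (\<lambda>x. ennreal (d x))"
  have BR: "B \<in> sets R" using B sets by simp
  have subR: "subalgebra ?R G" and subM: "subalgebra ?M G"
    using sub sp sets by (auto simp: subalgebra_def)
  have GM: "\<Lambda> \<in> sets M" if "\<Lambda> \<in> sets G" for \<Lambda> using sub that by (auto simp: subalgebra_def)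
  have R_G: "emeasure (restr_to_subalg ?R G) \<Lambda> = ennreal (\<integral>x. indicator \<Lambda> x * d x \<partial>M)" if L: "\<Lambda> \<in> sets G" for \<Lambda>
  proof -
    have "emeasure (restr_to_subalg ?R G) \<Lambda> = (\<integral>\<^sup>+x. ennreal (indicator B x) * indicator \<Lambda> x \<partial>R)"
      unfolding emeasure_restr_to_subalg[OF subR L]
      by (rule emeasure_density) (use BR GM[OF L] sets in auto)
    also have "\<dots> = (\<integral>\<^sup>+x. indicator (\<Lambda> \<inter> B) x \<partial>R)"
      by (intro nn_integral_cong) (auto split: split_indicator)
    also have "\<dots> = emeasure R (\<Lambda> \<inter> B)" using BR GM[OF L] sets by (intro nn_integral_indicator) auto
    finally show ?thesis using eq[OF L] by simp
  qed
  have M_G: "emeasure (restr_to_subalg ?M G) \<Lambda> = ennreal (\<integral>x. indicator \<Lambda> x * d x \<partial>M)" if L: "\<Lambda> \<in> sets G" for \<Lambda>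
    unfolding emeasure_restr_to_subalg[OF subM L] by (rule emeasure_density_integral[OF d(3,2) GM[OF L]])
  have eqm: "restr_to_subalg ?R G = restr_to_subalg ?M G"
  proof (rule measure_eqI)
    show "sets (restr_to_subalg ?R G) = sets (restr_to_subalg ?M G)"
      by (simp add: sets_restr_to_subalg[OF subR] sets_restr_to_subalg[OF subM])
    fix \<Lambda> assume "\<Lambda> \<in> sets (restr_to_subalg ?R G)"
    then have "\<Lambda> \<in> sets G" by (simp add: sets_restr_to_subalg[OF subR])
    then show "emeasure (restr_to_subalg ?R G) \<Lambda> = emeasure (restr_to_subalg ?M G) \<Lambda>"
      by (simp add: R_G M_G)
  qed
  have fr: "f \<in> borel_measurable (restr_to_subalg ?R G)"
    using f(1) by (simp add: measurable_cong_sets[OF sets_restr_to_subalg[OF subR] refl])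
  have spG: "space G = space M" using sub by (simp add: subalgebra_def)
  have fin: "finite_measure (restr_to_subalg ?R G)"
  proof (rule finite_measureI)
    have "emeasure (restr_to_subalg ?R G) (space M) = ennreal (\<integral>x. indicator (space M) x * d x \<partial>M)"
      by (rule R_G) (use spG sets.top[of G] in simp)
    then show "emeasure (restr_to_subalg ?R G) (space (restr_to_subalg ?R G)) \<noteq> \<infinity>"
      by (simp add: space_restr_to_subalg sp)
  qed
  have int: "integrable (restr_to_subalg ?R G) f"
    by (rule finite_measure.integrable_const_bound[OF fin, where B=K])
       (use f fr in \<open>auto simp: space_restr_to_subalg sp intro!: AE_I2\<close>)
  have intR: "integrable ?R f" by (rule integrable_from_subalg[OF subR int])
  have dR: "AE x in R. 0 \<le> (indicator B x :: real)" by simp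
  have dM: "AE x in M. 0 \<le> d x" using d(2) by (auto intro!: AE_I2)
  have iB: "(indicator B :: 'a \<Rightarrow> real) \<in> borel_measurable R" using BR by simp
  have "integrable R (\<lambda>x. indicator B x * f x)"
    using intR integrable_density[OF fR iB dR] by simp
  moreover have "(\<integral>x. indicator B x * f x \<partial>R) = (\<integral>x. f x \<partial>?R)"
    using integral_density[OF fR iB dR] by simp
  moreover have "(\<integral>x. f x \<partial>?R) = (\<integral>x. f x \<partial>(restr_to_subalg ?R G))"
    by (rule integral_subalgebra2[OF subR f(1), symmetric])
  moreover have "(\<integral>x. f x \<partial>(restr_to_subalg ?M G)) = (\<integral>x. f x \<partial>?M)"
    by (rule integral_subalgebra2[OF subM f(1)])
  moreover have "(\<integral>x. f x \<partial>?M) = (\<integral>x. d x * f x \<partial>M)"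
    using integral_density[OF fM d(1) dM] by simp
  ultimately show ?thesis
    unfolding has_bochner_integral_iff by (simp add: eqm mult.commute)
qed

text \<open>Here \<open>C\<close> will be an event about the last zero and \<open>B\<close> a
  measurable substitute. Agreement almost everywhere makes \<open>C\<close> measurable for the
  completion.\<close>

lemma has_bochner_integral_completion_cong:
  fixes f :: "'a \<Rightarrow> real"
  assumes g: "has_bochner_integral R (\<lambda>x. f x * indicator B x) v"
    and f: "f \<in> borel_measurable R" and B: "B \<in> sets R"
    and eq: "AE x in R. x \<in> B \<longleftrightarrow> x \<in> C"
  shows "has_bochner_integral (completion R) (\<lambda>x. f x * indicator C x) v"
proof -
  have BR: "B \<subseteq> space R" using B sets.sets_into_space by auto
  have "C \<inter> space R \<in> sets (completion R)"
  proof (rule completion.in_sets_AE)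
    show "AE x in completion R. x \<in> B \<longleftrightarrow> x \<in> C \<inter> space R"
      using AE_completion[OF eq] AE_space by eventually_elim auto
  qed (use B in auto)
  then have "(indicator (C \<inter> space R) :: 'a \<Rightarrow> real) \<in> borel_measurable (completion R)" by simp
  then have C: "(indicator C :: 'a \<Rightarrow> real) \<in> borel_measurable (completion R)"
    by (rule measurable_cong[THEN iffD1, rotated]) (auto split: split_indicator)
  have fc: "f \<in> borel_measurable (completion R)" by (rule measurable_completion[OF f])
  have fB: "(\<lambda>x. f x * indicator B x) \<in> borel_measurable R" using f B by auto
  have "has_bochner_integral (completion R) (\<lambda>x. f x * indicator B x) v"
    using g unfolding has_bochner_integral_iff integrable_completion[OF fB] integral_completion[OF fB] .
  then show ?thesis
  proof (rule has_bochner_integral_cong_AE[THEN iffD1, rotated 3])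
    show "AE x in completion R. f x * indicator B x = f x * indicator C x"
      using AE_completion[OF eq] by eventually_elim (auto split: split_indicator)
  qed (use fc C measurable_completion[OF fB] in auto)
qed

section \<open>The first zero after a given time\<close>

text \<open>One decomposition of \<open>X\<close> is fixed. Right-continuity of the filtration is
  stated for single events, a form that both the usual assumptions and property (P) provide.\<close>

locale Sigma_process = filtered_prob_space M F for M :: "'a measure" and F +
  fixes X N A :: "real \<Rightarrow> 'a \<Rightarrow> real"
  assumes X_eq: "\<And>t \<omega>. 0 \<le> t \<Longrightarrow> \<omega> \<in> space M \<Longrightarrow> X t \<omega> = N t \<omega> + A t \<omega>"
    and X_nonneg: "\<And>t \<omega>. 0 \<le> t \<Longrightarrow> \<omega> \<in> space M \<Longrightarrow> 0 \<le> X t \<omega>"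
    and X_adapted: "adapted F X"
    and X_integrable: "\<And>t. 0 \<le> t \<Longrightarrow> integrable M (X t)"
    and N_martingale: "martingale M F N"
    and N_cadlag: "\<And>\<omega>. \<omega> \<in> space M \<Longrightarrow> cadlag (\<lambda>t. N t \<omega>)"
    and A_adapted: "adapted F A"
    and A_0: "\<And>\<omega>. \<omega> \<in> space M \<Longrightarrow> A 0 \<omega> = 0"
    and A_continuous: "\<And>\<omega>. \<omega> \<in> space M \<Longrightarrow> continuous_on {0..} (\<lambda>t. A t \<omega>)"
    and A_mono_on: "\<And>\<omega>. \<omega> \<in> space M \<Longrightarrow> mono_on {0..} (\<lambda>t. A t \<omega>)"
    and A_carried: "AE \<omega> in M. AE t in stieltjes (\<lambda>t. A t \<omega>). 0 \<le> t \<and> X t \<omega> = 0"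
    and F_right_continuous: "\<And>t B. 0 \<le> t \<Longrightarrow> (\<And>s. t < s \<Longrightarrow> B \<in> sets (F s)) \<Longrightarrow> B \<in> sets (F t)"
begin

lemma A_mono: "\<omega> \<in> space M \<Longrightarrow> 0 \<le> s \<Longrightarrow> s \<le> t \<Longrightarrow> A s \<omega> \<le> A t \<omega>"
  using A_mono_on[of \<omega>] by (auto simp: mono_on_def)

lemma A_nonneg: "\<omega> \<in> space M \<Longrightarrow> 0 \<le> t \<Longrightarrow> 0 \<le> A t \<omega>"
  using A_mono[of \<omega> 0 t] A_0 by auto

lemma N_right: "\<omega> \<in> space M \<Longrightarrow> 0 \<le> t \<Longrightarrow> ((\<lambda>t. N t \<omega>) \<longlongrightarrow> N t \<omega>) (at_right t)"
  using N_cadlag by (auto simp: cadlag_def)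

lemma A_right:
  assumes "\<omega> \<in> space M" "0 \<le> t"
  shows "((\<lambda>t. A t \<omega>) \<longlongrightarrow> A t \<omega>) (at_right t)"
proof -
  have "((\<lambda>t. A t \<omega>) \<longlongrightarrow> A t \<omega>) (at t within {0..})"
    using A_continuous[OF assms(1)] assms(2) by (auto simp: continuous_on_def)
  then show ?thesis by (rule tendsto_within_subset) (use assms in auto)
qed

lemma X_right:
  assumes "\<omega> \<in> space M" "0 \<le> t"
  shows "((\<lambda>t. X t \<omega>) \<longlongrightarrow> X t \<omega>) (at_right t)"
proof -
  have "((\<lambda>t. N t \<omega> + A t \<omega>) \<longlongrightarrow> N t \<omega> + A t \<omega>) (at_right t)"
    by (intro tendsto_add N_right A_right assms)
  moreover have "eventually (\<lambda>u. N u \<omega> + A u \<omega> = X u \<omega>) (at_right t)"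
    using assms by (auto simp: eventually_at_right_less X_eq intro!: eventually_at_rightI[of t "t+1"])
  ultimately show ?thesis using assms by (simp add: X_eq tendsto_cong)
qed

lemma A_integrable:
  assumes "0 \<le> t" shows "integrable M (A t)"
proof -
  have "integrable M (\<lambda>\<omega>. X t \<omega> - N t \<omega>)"
    using X_integrable[OF assms] N_martingale assms by (auto simp: martingale_def)
  then show ?thesis
    by (rule Bochner_Integration.integrable_cong[THEN iffD1, rotated 2]) (auto simp: X_eq assms)
qed

text \<open>
  \<open>near_zero n q\<close> uses rational times only, to be measurable. At a finite \<open>zero_time q\<close> the process itself
  or its left limit vanishes.
\<close>

definition near_zero :: "nat \<Rightarrow> real \<Rightarrow> 'a \<Rightarrow> ennreal" where
  "near_zero n q \<omega> = Inf (ennreal ` {u\<in>\<rat>. q \<le> u \<and> X u \<omega> < 1 / real (Suc n)})"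

definition zero_time :: "real \<Rightarrow> 'a \<Rightarrow> ennreal" where
  "zero_time q \<omega> = (SUP n. near_zero n q \<omega>)"

lemma near_zero_less_iff:
  "near_zero n q \<omega> < t \<longleftrightarrow> (\<exists>u\<in>\<rat>. q \<le> u \<and> X u \<omega> < 1 / real (Suc n) \<and> ennreal u < t)"
  unfolding near_zero_def Inf_less_iff by auto

lemma near_zero_ge: "ennreal q \<le> near_zero n q \<omega>"
  unfolding near_zero_def by (intro Inf_greatest) (auto intro: ennreal_leI)

lemma near_zero_mono: "m \<le> n \<Longrightarrow> near_zero m q \<omega> \<le> near_zero n q \<omega>"
  unfolding near_zero_def
proof (intro Inf_superset_mono image_mono subsetI)
  fix u assume "m \<le> n" and u: "u \<in> {u\<in>\<rat>. q \<le> u \<and> X u \<omega> < 1 / real (Suc n)}"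
  then have "1 / real (Suc n) \<le> 1 / real (Suc m)" by (simp add: frac_le)
  then show "u \<in> {u\<in>\<rat>. q \<le> u \<and> X u \<omega> < 1 / real (Suc m)}" using u by auto
qed

lemma near_zero_mono_start: "q \<le> r \<Longrightarrow> near_zero n q \<omega> \<le> near_zero n r \<omega>"
  unfolding near_zero_def by (intro Inf_superset_mono image_mono) auto

lemma near_zero_le_zero_time: "near_zero n q \<omega> \<le> zero_time q \<omega>"
  unfolding zero_time_def by (rule SUP_upper) simp

lemma zero_time_ge: "ennreal q \<le> zero_time q \<omega>"
  using near_zero_ge near_zero_le_zero_time order_trans by blast

lemma zero_time_mono: "q \<le> r \<Longrightarrow> zero_time q \<omega> \<le> zero_time r \<omega>"
  unfolding zero_time_def by (intro SUP_mono) (auto intro: near_zero_mono_start)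

text \<open>A value below the level at \<open>u\<close> would persist on a right neighbourhood of
  \<open>u\<close>, which contains rational times before the near-zero time.\<close>

lemma X_ge_before_near_zero:
  assumes \<omega>: "\<omega> \<in> space M" and u: "0 \<le> q" "q \<le> u" "ennreal u < near_zero n q \<omega>"
  shows "1 / real (Suc n) \<le> X u \<omega>"
proof (rule ccontr)
  assume "\<not> ?thesis"
  then have "eventually (\<lambda>v. X v \<omega> < 1 / real (Suc n)) (at_right u)"
    using X_right[OF \<omega>, of u] u by (intro order_tendstoD(2)) auto
  then obtain b where b: "b > u" "\<And>v. u < v \<Longrightarrow> v < b \<Longrightarrow> X v \<omega> < 1 / real (Suc n)"
    by (auto simp: eventually_at_right[OF less_add_one])
  obtain b' where b': "ennreal u < b'" "b' < near_zero n q \<omega>" using dense[OF u(3)] by blast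
  then have "b' \<noteq> top" using less_top by fastforce
  then obtain b'' where b'': "b' = ennreal b''" "0 \<le> b''" by (cases b') auto
  have ub: "u < b''" using b'(1) b'' u ennreal_less_iff[of u b''] by auto
  then obtain v where v: "v \<in> \<rat>" "u < v" "v < min b b''"
    using Rats_dense_in_real[of u "min b b''"] b(1) by auto
  have "near_zero n q \<omega> < b'"
    unfolding near_zero_less_iff using v b(2)[of v] u b'' by (intro bexI[of _ v]) (auto simp: ennreal_less_iff)
  then show False using b'(2) by auto
qed

text \<open>If \<open>X\<close> exceeded the level at the infimum, right-continuity would keep it
  above the level for a while afterwards, contradicting the rational times close to the infimum. A
  strict inequality need not survive the limit.\<close>

lemma X_le_at_near_zero:
  assumes \<omega>: "\<omega> \<in> space M" and q: "0 \<le> q" and fin: "near_zero n q \<omega> \<noteq> \<infinity>"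
  shows "X (enn2real (near_zero n q \<omega>)) \<omega> \<le> 1 / real (Suc n)"
proof (rule ccontr)
  let ?r = "enn2real (near_zero n q \<omega>)"
  assume "\<not> ?thesis"
  then have ev: "eventually (\<lambda>v. 1 / real (Suc n) < X v \<omega>) (at_right ?r)" and r: "1 / real (Suc n) < X ?r \<omega>"
    using X_right[OF \<omega>, of ?r] by (auto intro!: order_tendstoD(1))
  from ev obtain b where b: "b > ?r" "\<And>v. ?r < v \<Longrightarrow> v < b \<Longrightarrow> 1 / real (Suc n) < X v \<omega>"
    by (auto simp: eventually_at_right[OF less_add_one])
  have er: "ennreal ?r = near_zero n q \<omega>" using fin by (simp add: less_top)
  have "near_zero n q \<omega> < ennreal b" using b(1) er by (metis ennreal_less_iff enn2real_nonneg)
  then obtain u where u: "q \<le> u" "X u \<omega> < 1 / real (Suc n)" "ennreal u < ennreal b" "u \<in> \<rat>"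
    unfolding near_zero_less_iff by blast
  have "near_zero n q \<omega> \<le> ennreal u"
    unfolding near_zero_def by (rule Inf_lower) (use u in auto)
  then have "?r \<le> u" using er u q by (metis ennreal_le_iff order_trans)
  moreover have "u < b" using u q by (auto simp: ennreal_less_iff)
  ultimately show False using b(2)[of u] r u by (cases "u = ?r") auto
qed

lemma X_pos_before_zero_time:
  assumes "\<omega> \<in> space M" "0 \<le> q" "q \<le> u" "ennreal u < zero_time q \<omega>"
  shows "0 < X u \<omega>"
proof -
  obtain n where "ennreal u < near_zero n q \<omega>" using assms(4) unfolding zero_time_def less_SUP_iff by auto
  from X_ge_before_near_zero[OF assms(1-3) this] show ?thesis
    by (smt (verit) of_nat_0_less_iff zero_less_Suc zero_less_divide_1_iff)
qed

text \<open>The terminal-time property: having no zero during \<open>[q, u]\<close> splits at any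
  intermediate \<open>s\<close>. It is what makes the killed process below satisfy the martingale
  identity from every starting time.\<close>

lemma zero_time_split:
  assumes "q \<le> s" "0 \<le> q" "s \<le> u"
  shows "ennreal u < zero_time q \<omega> \<longleftrightarrow> ennreal s < zero_time q \<omega> \<and> ennreal u < zero_time s \<omega>"
proof (intro iffI conjI)
  assume *: "ennreal u < zero_time q \<omega>"
  show "ennreal s < zero_time q \<omega>" using * ennreal_leI[OF assms(3)] by auto
  show "ennreal u < zero_time s \<omega>" using * zero_time_mono[OF assms(1)] less_le_trans by blast
next
  assume *: "ennreal s < zero_time q \<omega> \<and> ennreal u < zero_time s \<omega>"
  then obtain m n where mn: "ennreal s < near_zero m q \<omega>" "ennreal u < near_zero n s \<omega>"
    unfolding zero_time_def less_SUP_iff by auto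
  \<comment> \<open>Near-zero times increase with the level index, so a single level witnesses both
    strict inequalities.\<close>
  define k where "k = max m n"
  have k: "ennreal s < near_zero k q \<omega>" "ennreal u < near_zero k s \<omega>"
    using mn near_zero_mono[of m k q \<omega>] near_zero_mono[of n k s \<omega>] by (auto simp: k_def)
  have "near_zero k s \<omega> \<le> near_zero k q \<omega>"
    unfolding near_zero_def[of k q]
  proof (rule Inf_greatest, clarify)
    fix v :: real assume v: "v \<in> \<rat>" "q \<le> v" "X v \<omega> < 1 / real (Suc k)"
    have "s \<le> v"
    proof (rule ccontr)
      assume "\<not> s \<le> v"
      then have "near_zero k q \<omega> \<le> ennreal s"
        unfolding near_zero_def by (intro Inf_lower2[of "ennreal v"]) (use v in \<open>auto intro!: ennreal_leI\<close>)
      then show False using k(1) by auto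
    qed
    then show "near_zero k s \<omega> \<le> ennreal v"
      unfolding near_zero_def by (intro Inf_lower) (use v in auto)
  qed
  then have "ennreal u < near_zero k q \<omega>" using k(2) by auto
  then show "ennreal u < zero_time q \<omega>" using near_zero_le_zero_time less_le_trans by blast
qed

section \<open>Measurability of the first zero times\<close>

lemma near_zero_less_sets:
  assumes q: "0 \<le> q" and t: "0 \<le> t"
  shows "{\<omega>\<in>space M. near_zero n q \<omega> < ennreal t} \<in> sets (F t)"
proof -
  have "{\<omega>\<in>space M. near_zero n q \<omega> < ennreal t} = (\<Union>u\<in>{u\<in>\<rat>. q \<le> u \<and> u < t}. {\<omega>\<in>space M. X u \<omega> < 1 / real (Suc n)})"
    unfolding near_zero_less_iff using q by (auto simp: ennreal_less_iff)
  also have "\<dots> \<in> sets (F t)"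
  proof (rule sets.countable_UN'')
    show "countable {u\<in>\<rat>. q \<le> u \<and> u < t}" by (rule countable_subset[OF _ countable_rat]) auto
    fix u assume u: "u \<in> {u\<in>\<rat>. q \<le> u \<and> u < t}"
    then have "X u \<in> borel_measurable (F u)" using X_adapted q by (auto simp: adapted_def)
    then have "{\<omega>\<in>space (F u). X u \<omega> < 1 / real (Suc n)} \<in> sets (F u)" by measurable
    then show "{\<omega>\<in>space M. X u \<omega> < 1 / real (Suc n)} \<in> sets (F t)"
      using sets_F_mono[of u t] u q by (auto simp: space_F)
  qed
  finally show ?thesis .
qed

text \<open>A supremum of values below \<open>r\<close> is only known to be at most
  \<open>r\<close>; the gap between the rational \<open>r\<close> and \<open>t\<close> restores the
  strict inequality.\<close>

lemma zero_time_less_iff: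
  "zero_time q \<omega> < ennreal t \<longleftrightarrow> (\<exists>r\<in>{r\<in>\<rat>. 0 \<le> r \<and> r < t}. \<forall>n. near_zero n q \<omega> < ennreal r)"
proof
  assume *: "zero_time q \<omega> < ennreal t"
  then obtain z where z: "zero_time q \<omega> = ennreal z" "0 \<le> z"
    by (cases "zero_time q \<omega>") auto
  then have "z < t" using * by (simp add: ennreal_less_iff)
  then obtain r where r: "r \<in> \<rat>" "z < r" "r < t" using Rats_dense_in_real by blast
  have "near_zero n q \<omega> < ennreal r" for n
    using near_zero_le_zero_time[of n q \<omega>] z r by (auto simp: ennreal_less_iff intro: le_less_trans)
  then show "\<exists>r\<in>{r\<in>\<rat>. 0 \<le> r \<and> r < t}. \<forall>n. near_zero n q \<omega> < ennreal r" using r z by auto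
next
  assume "\<exists>r\<in>{r\<in>\<rat>. 0 \<le> r \<and> r < t}. \<forall>n. near_zero n q \<omega> < ennreal r"
  then obtain r where r: "0 \<le> r" "r < t" "\<And>n. near_zero n q \<omega> < ennreal r" by auto
  then have "zero_time q \<omega> \<le> ennreal r" unfolding zero_time_def by (intro SUP_least less_imp_le) auto
  then show "zero_time q \<omega> < ennreal t" using r by (auto simp: ennreal_less_iff intro: le_less_trans)
qed

lemma zero_time_less_sets:
  assumes q: "0 \<le> q" and t: "0 \<le> t"
  shows "{\<omega>\<in>space M. zero_time q \<omega> < ennreal t} \<in> sets (F t)"
proof -
  have "{\<omega>\<in>space M. zero_time q \<omega> < ennreal t} =
      (\<Union>r\<in>{r\<in>\<rat>. 0 \<le> r \<and> r < t}. \<Inter>n. {\<omega>\<in>space M. near_zero n q \<omega> < ennreal r})"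
    unfolding zero_time_less_iff by auto
  also have "\<dots> \<in> sets (F t)"
  proof (rule sets.countable_UN'')
    show "countable {r\<in>\<rat>. 0 \<le> r \<and> r < t}" by (rule countable_subset[OF _ countable_rat]) auto
    fix r assume r: "r \<in> {r\<in>\<rat>. 0 \<le> r \<and> r < t}"
    have "(\<Inter>n. {\<omega>\<in>space M. near_zero n q \<omega> < ennreal r}) \<in> sets (F r)"
      using near_zero_less_sets[OF q] r by (intro sets.countable_INT) auto
    then show "(\<Inter>n. {\<omega>\<in>space M. near_zero n q \<omega> < ennreal r}) \<in> sets (F t)"
      using sets_F_mono[of r t] r by auto
  qed
  finally show ?thesis .
qed

text \<open>The complement \<open>{zero_time q \<le> t}\<close> is the intersection of
  \<open>{zero_time q < r}\<close> over rational \<open>r\<close> just after \<open>t\<close>. It is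
  known at every \<open>s > t\<close>, and right-continuity of the filtration brings it back to
  \<open>t\<close>.\<close>

lemma zero_time_greater_sets:
  assumes q: "0 \<le> q" and t: "0 \<le> t"
  shows "{\<omega>\<in>space M. ennreal t < zero_time q \<omega>} \<in> sets (F t)"
proof (rule F_right_continuous[OF t])
  fix s assume s: "t < s"
  have "{\<omega>\<in>space M. ennreal t < zero_time q \<omega>} =
      space M - (\<Inter>r\<in>{r\<in>\<rat>. t < r \<and> r < s}. {\<omega>\<in>space M. zero_time q \<omega> < ennreal r})" (is "_ = space M - ?B")
  proof -
    have "zero_time q \<omega> \<le> ennreal t" if *: "\<And>r. r \<in> \<rat> \<Longrightarrow> t < r \<Longrightarrow> r < s \<Longrightarrow> zero_time q \<omega> < ennreal r" for \<omega>
    proof (rule ccontr)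
      assume "\<not> zero_time q \<omega> \<le> ennreal t"
      then have "ennreal t < min (zero_time q \<omega>) (ennreal s)" using s t by (auto simp: ennreal_less_iff)
      then obtain b where b: "ennreal t < b" "b < min (zero_time q \<omega>) (ennreal s)" using dense by blast
      then obtain b' where b': "b = ennreal b'" "0 \<le> b'" by (cases b) auto
      have "t < b'" "b' < s" using b b' t by (auto simp: ennreal_less_iff)
      then obtain r where r: "r \<in> \<rat>" "t < r" "r < b'" using Rats_dense_in_real by blast
      then have "zero_time q \<omega> < ennreal b'" using *[of r] \<open>b' < s\<close> t by (auto simp: ennreal_less_iff intro: less_trans)
      then show False using b b' by auto
    qed
    moreover have "zero_time q \<omega> < ennreal r" if "zero_time q \<omega> \<le> ennreal t" "t < r" for \<omega> r
      using that t by (auto simp: ennreal_less_iff intro: le_less_trans)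
    moreover obtain r0 where "r0 \<in> {r\<in>\<rat>. t < r \<and> r < s}" using Rats_dense_in_real[OF s] by auto
    ultimately show ?thesis by (auto simp: not_less[symmetric])
  qed
  also have "?B \<in> sets (F s)"
  proof (rule sets.countable_INT', rule_tac[3] image_subsetI)
    show "countable {r\<in>\<rat>. t < r \<and> r < s}" by (rule countable_subset[OF _ countable_rat]) auto
    fix r assume r: "r \<in> {r\<in>\<rat>. t < r \<and> r < s}"
    then show "{\<omega>\<in>space M. zero_time q \<omega> < ennreal r} \<in> sets (F s)"
      using zero_time_less_sets[OF q, of r] sets_F_mono[of r s] t by auto
  qed (use Rats_dense_in_real[OF s] in auto)
  then have "space M - ?B \<in> sets (F s)"
    using sets.compl_sets[of ?B "F s"] space_F[of s] s t by auto
  finally show "{\<omega>\<in>space M. ennreal t < zero_time q \<omega>} \<in> sets (F s)" .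
qed

text \<open>\<open>X\<close> is strictly positive on \<open>[q, zero_time q)\<close>, so the carrier
  condition leaves no mass of \<open>dA\<close> on \<open>(q, u]\<close> for \<open>u\<close> before
  \<open>zero_time q\<close>. Continuity of \<open>A\<close> adds the endpoint. One null set serves
  all \<open>q\<close> and \<open>r\<close>.\<close>

lemma A_constant_before_zero_time:
  "AE \<omega> in M. \<forall>q r. 0 \<le> q \<longrightarrow> q \<le> r \<longrightarrow> ennreal r \<le> zero_time q \<omega> \<longrightarrow> A r \<omega> = A q \<omega>"
  using A_carried
proof (rule AE_mp, intro AE_I2 impI allI)
  fix \<omega> q r assume \<omega>: "\<omega> \<in> space M" and car: "AE t in stieltjes (\<lambda>t. A t \<omega>). 0 \<le> t \<and> X t \<omega> = 0"
    and q: "0 \<le> q" "q \<le> r" "ennreal r \<le> zero_time q \<omega>"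
  have "continuous_on UNIV (\<lambda>t. A (max 0 t) \<omega>)"
    by (rule continuous_on_compose2[OF A_continuous[OF \<omega>]]) (auto intro!: continuous_intros)
  then have cont: "continuous (at_right a) (\<lambda>t. A (max 0 t) \<omega>)" for a
    by (auto simp: continuous_on_eq_continuous_within intro: continuous_at_imp_continuous_at_within)
  have const: "A u \<omega> = A q \<omega>" if u: "q \<le> u" "ennreal u < zero_time q \<omega>" for u
  proof -
    let ?S = "stieltjes (\<lambda>t. A t \<omega>)"
    have "AE t in ?S. \<not> (t \<in> {q<..u})"
      using car
    proof eventually_elim
      case (elim t)
      show ?case
      proof
        assume t: "t \<in> {q<..u}"
        then have "ennreal t < zero_time q \<omega>" using u(2) by (auto intro: le_less_trans ennreal_leI)
        then show False using X_pos_before_zero_time[OF \<omega> q(1), of t] t elim by auto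
      qed
    qed
    then have "emeasure ?S {t\<in>space ?S. t \<in> {q<..u}} = 0" by (rule emeasure_eq_0_AE)
    moreover have "{t\<in>space ?S. t \<in> {q<..u}} = {q<..u}" by (auto simp: stieltjes_def)
    ultimately have "emeasure ?S {q<..u} = 0" by (simp only:)
    moreover have "emeasure ?S {q<..u} = ennreal (A (max 0 u) \<omega> - A (max 0 q) \<omega>)"
      unfolding stieltjes_def
      by (rule emeasure_interval_measure_Ioc) (use u q A_mono[OF \<omega>] cont in auto)
    ultimately have "A u \<omega> \<le> A q \<omega>" using u q by (simp add: max_def ennreal_eq_0_iff)
    then show ?thesis using A_mono[OF \<omega> q(1) u(1)] by simp
  qed
  show "A r \<omega> = A q \<omega>"
  proof (cases "q = r")
    case False
    \<comment> \<open>Points increasing from \<open>u 0 = q\<close> to \<open>r\<close> but staying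
      strictly below \<open>r\<close>, because \<open>r\<close> may equal
      \<open>zero_time q\<close>, where \<open>X\<close> need not be positive.\<close>
    define u where "u k = r - (r - q) / real (Suc k)" for k
    have u: "q \<le> u k" "u k < r" for k
    proof -
      have "(r - q) / real (Suc k) \<le> (r - q) / 1" by (rule divide_left_mono) (use q in auto)
      then show "q \<le> u k" by (simp add: u_def)
      show "u k < r" using False q by (simp add: u_def)
    qed
    have "u \<longlonglongrightarrow> r - (r - q) * 0"
      unfolding u_def divide_inverse by (intro tendsto_intros LIMSEQ_inverse_real_of_nat)
    then have "(\<lambda>k. A (u k) \<omega>) \<longlonglongrightarrow> A r \<omega>"
      using A_continuous[OF \<omega>, unfolded continuous_on_sequentially] u q
      by (auto simp: o_def intro: order_trans)
    moreover have "A (u k) \<omega> = A q \<omega>" for k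
      using u[of k] q by (intro const) (auto intro!: less_le_trans[OF _ q(3)] simp: ennreal_less_iff)
    ultimately show ?thesis by (simp add: LIMSEQ_const_iff)
  qed simp
qed

text \<open>Only the increasing part depends on \<open>T\<close>: the martingale contributes
  \<open>N (c + 1)\<close> for every time bounded by \<open>c\<close>. So two such times at which
  \<open>A\<close> agrees give \<open>X\<close> the same integral over a common
  \<open>\<Lambda>\<close>.\<close>

lemma stopped_value:
  assumes T: "weak_stopping T c" and c: "0 \<le> c"
    and L: "\<Lambda> \<in> sets M" "\<And>t. 0 \<le> t \<Longrightarrow> {\<omega>\<in>\<Lambda>. T \<omega> < t} \<in> sets (F t)"
  shows "integrable M (\<lambda>\<omega>. indicator \<Lambda> \<omega> * A (T \<omega>) \<omega>)"
    and "integrable M (\<lambda>\<omega>. indicator \<Lambda> \<omega> * X (T \<omega>) \<omega>)"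
    and "(\<integral>\<omega>. indicator \<Lambda> \<omega> * X (T \<omega>) \<omega> \<partial>M) =
      (\<integral>\<omega>. indicator \<Lambda> \<omega> * N (c + 1) \<omega> \<partial>M) + (\<integral>\<omega>. indicator \<Lambda> \<omega> * A (T \<omega>) \<omega> \<partial>M)"
proof -
  note OS = optional_stopping[OF N_martingale N_right T c L]
  have T0: "0 \<le> T \<omega>" "T \<omega> \<le> c" if "\<omega> \<in> space M" for \<omega> using T that by (auto simp: weak_stopping_def)
  have AT: "(\<lambda>\<omega>. A (T \<omega>) \<omega>) \<in> borel_measurable M"
    by (rule measurable_F_M[OF weak_stopping_value_measurable[OF T c A_adapted A_right]]) (use c in auto)
  show A: "integrable M (\<lambda>\<omega>. indicator \<Lambda> \<omega> * A (T \<omega>) \<omega>)"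
  proof (rule Bochner_Integration.integrable_bound[OF A_integrable[OF c]])
    show "(\<lambda>\<omega>. indicator \<Lambda> \<omega> * A (T \<omega>) \<omega>) \<in> borel_measurable M" using AT L(1) by auto
    show "AE \<omega> in M. norm (indicator \<Lambda> \<omega> * A (T \<omega>) \<omega>) \<le> norm (A c \<omega>)"
    proof (rule AE_I2)
      fix \<omega> assume "\<omega> \<in> space M"
      then show "norm (indicator \<Lambda> \<omega> * A (T \<omega>) \<omega>) \<le> norm (A c \<omega>)"
        using T0[of \<omega>] A_nonneg[of \<omega> "T \<omega>"] A_nonneg[of \<omega> c] A_mono[of \<omega> "T \<omega>" c] c
        by (auto split: split_indicator)
    qed
  qed
  have eq: "indicator \<Lambda> \<omega> * X (T \<omega>) \<omega> = indicator \<Lambda> \<omega> * N (T \<omega>) \<omega> + indicator \<Lambda> \<omega> * A (T \<omega>) \<omega>"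
    if "\<omega> \<in> space M" for \<omega>
    using X_eq[OF T0(1)[OF that] that] by (simp add: distrib_left)
  have "integrable M (\<lambda>\<omega>. indicator \<Lambda> \<omega> * N (T \<omega>) \<omega> + indicator \<Lambda> \<omega> * A (T \<omega>) \<omega>)"
    using OS(1) A by simp
  then show "integrable M (\<lambda>\<omega>. indicator \<Lambda> \<omega> * X (T \<omega>) \<omega>)"
    by (rule Bochner_Integration.integrable_cong[THEN iffD2, rotated 2]) (auto simp: eq)
  have "(\<integral>\<omega>. indicator \<Lambda> \<omega> * X (T \<omega>) \<omega> \<partial>M) = (\<integral>\<omega>. indicator \<Lambda> \<omega> * N (T \<omega>) \<omega> + indicator \<Lambda> \<omega> * A (T \<omega>) \<omega> \<partial>M)"
    by (rule Bochner_Integration.integral_cong) (auto simp: eq)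
  also have "\<dots> = (\<integral>\<omega>. indicator \<Lambda> \<omega> * N (c + 1) \<omega> \<partial>M) + (\<integral>\<omega>. indicator \<Lambda> \<omega> * A (T \<omega>) \<omega> \<partial>M)"
    using OS A by simp
  finally show "(\<integral>\<omega>. indicator \<Lambda> \<omega> * X (T \<omega>) \<omega> \<partial>M) = (\<integral>\<omega>. indicator \<Lambda> \<omega> * N (c + 1) \<omega> \<partial>M) + (\<integral>\<omega>. indicator \<Lambda> \<omega> * A (T \<omega>) \<omega> \<partial>M)" .
qed

lemma sets_M: "B \<in> sets (F t) \<Longrightarrow> 0 \<le> t \<Longrightarrow> B \<in> sets M"
  using sets_F_subset by auto

text \<open>On \<open>{near_zero n q < c}\<close> the integrals of \<open>X\<close> at the truncated
  \<open>near_zero n q\<close> and \<open>zero_time q\<close> coincide, since \<open>A\<close>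
  agrees at both times; the former is at most \<open>1 / (n + 1)\<close>. The event
  \<open>{zero_time q < c}\<close> lies in all these events, so there the nonnegative
  \<open>X\<close> has integral 0.\<close>

lemma X_zero_time_bounded:
  assumes q: "0 \<le> q" "q \<le> c"
  shows "AE \<omega> in M. zero_time q \<omega> < ennreal c \<longrightarrow> X (cut_time c (zero_time q \<omega>)) \<omega> = 0"
proof -
  have c: "0 \<le> c" using q by simp
  let ?T = "\<lambda>\<omega>. cut_time c (zero_time q \<omega>)"
  let ?Tn = "\<lambda>n \<omega>. cut_time c (near_zero n q \<omega>)"
  let ?L = "\<lambda>n. {\<omega>\<in>space M. near_zero n q \<omega> < ennreal c}"
  have T: "weak_stopping ?T c" by (intro weak_stopping_cut_time c zero_time_less_sets q)
  have Tn: "weak_stopping (?Tn n) c" for n by (intro weak_stopping_cut_time c near_zero_less_sets q)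
  have L: "?L n \<in> sets (F c)" for n by (intro near_zero_less_sets q c)
  have LM: "?L n \<in> sets M" for n by (rule sets_M[OF L c])
  have LT: "{\<omega>\<in>?L n. ?T \<omega> < t} \<in> sets (F t)" if "0 \<le> t" for t n
  proof (rule cut_time_sets[OF c L _ that])
    fix t :: real assume t: "0 \<le> t" "t \<le> c"
    have "{\<omega>\<in>?L n. zero_time q \<omega> < ennreal t} = {\<omega>\<in>space M. zero_time q \<omega> < ennreal t}"
      using near_zero_le_zero_time[of n q] ennreal_leI[OF t(2)] by (auto intro: le_less_trans less_le_trans)
    then show "{\<omega>\<in>?L n. zero_time q \<omega> < ennreal t} \<in> sets (F t)" using zero_time_less_sets q t by auto
  qed
  have LTn: "{\<omega>\<in>?L n. ?Tn n \<omega> < t} \<in> sets (F t)" if "0 \<le> t" for t n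
  proof (rule cut_time_sets[OF c L _ that])
    fix t :: real assume t: "0 \<le> t" "t \<le> c"
    have "{\<omega>\<in>?L n. near_zero n q \<omega> < ennreal t} = {\<omega>\<in>space M. near_zero n q \<omega> < ennreal t}"
      using ennreal_leI[OF t(2)] by (auto intro: less_le_trans)
    then show "{\<omega>\<in>?L n. near_zero n q \<omega> < ennreal t} \<in> sets (F t)" using near_zero_less_sets q t by auto
  qed
  note sT = stopped_value[OF T c LM LT]
  note sTn = stopped_value[OF Tn c LM LTn]
  have le: "(\<integral>\<omega>. indicator (?L n) \<omega> * X (?T \<omega>) \<omega> \<partial>M) \<le> 1 / real (Suc n)" for n
  proof -
    have "(\<integral>\<omega>. indicator (?L n) \<omega> * A (?T \<omega>) \<omega> \<partial>M) = (\<integral>\<omega>. indicator (?L n) \<omega> * A (?Tn n \<omega>) \<omega> \<partial>M)"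
    proof (rule integral_cong_AE)
      show "AE \<omega> in M. indicator (?L n) \<omega> * A (?T \<omega>) \<omega> = indicator (?L n) \<omega> * A (?Tn n \<omega>) \<omega>"
        using A_constant_before_zero_time
      proof (eventually_elim)
        case (elim \<omega>)
        have 1: "q \<le> ?Tn n \<omega>" "?Tn n \<omega> \<le> ?T \<omega>"
          using near_zero_ge[of q n \<omega>] near_zero_le_zero_time[of n q \<omega>] cut_time_mono[of "ennreal q" _ c]
            cut_time_ennreal[OF q] by (auto intro!: cut_time_mono)
        have 2: "q \<le> ?T \<omega>" using 1 by simp
        have 3: "ennreal (?T \<omega>) \<le> zero_time q \<omega>" by (simp add: ennreal_cut_time)
        have 4: "ennreal (?Tn n \<omega>) \<le> zero_time q \<omega>" using order_trans[OF ennreal_leI[OF 1(2)] 3] .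
        show ?case using elim[rule_format, OF q(1) 2 3] elim[rule_format, OF q(1) 1(1) 4] by simp
      qed
    qed (use sT(1)[of n] sTn(1)[of n] in auto)
    then have "(\<integral>\<omega>. indicator (?L n) \<omega> * X (?T \<omega>) \<omega> \<partial>M) = (\<integral>\<omega>. indicator (?L n) \<omega> * X (?Tn n \<omega>) \<omega> \<partial>M)"
      using sT(3)[of n] sTn(3)[of n] by simp
    also have "\<dots> \<le> (\<integral>\<omega>. 1 / real (Suc n) \<partial>M)"
    proof (rule integral_mono[OF sTn(2)])
      fix \<omega> assume \<omega>: "\<omega> \<in> space M"
      show "indicator (?L n) \<omega> * X (?Tn n \<omega>) \<omega> \<le> 1 / real (Suc n)"
      proof (cases "near_zero n q \<omega> < ennreal c")
        case True
        then have "?Tn n \<omega> = enn2real (near_zero n q \<omega>)" by (intro cut_time_le_imp_eq) auto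
        moreover have "near_zero n q \<omega> \<noteq> \<infinity>" using True by auto
        ultimately show ?thesis using X_le_at_near_zero[OF \<omega> q(1), of n] \<omega> True by simp
      qed simp
    qed (assumption | rule integrable_const)+
    also have "\<dots> = 1 / real (Suc n)" by (simp add: prob_space)
    finally show ?thesis .
  qed
  let ?D = "{\<omega>\<in>space M. zero_time q \<omega> < ennreal c}"
  have D: "?D \<in> sets M" by (rule sets_M[OF zero_time_less_sets[OF q(1) c] c])
  have XT: "(\<lambda>\<omega>. X (?T \<omega>) \<omega>) \<in> borel_measurable M"
    by (rule measurable_F_M[OF weak_stopping_value_measurable[OF T c X_adapted X_right]]) (use c in auto)
  have XT0: "0 \<le> X (?T \<omega>) \<omega>" if "\<omega> \<in> space M" for \<omega>
    using that by (intro X_nonneg cut_time_nonneg)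
  have DL: "indicator ?D \<omega> * X (?T \<omega>) \<omega> \<le> indicator (?L n) \<omega> * X (?T \<omega>) \<omega>" if "\<omega> \<in> space M" for \<omega> n
    using that XT0[OF that] near_zero_le_zero_time[of n q \<omega>]
    by (auto intro: le_less_trans split: split_indicator)
  have int: "integrable M (\<lambda>\<omega>. indicator ?D \<omega> * X (?T \<omega>) \<omega>)"
    by (rule Bochner_Integration.integrable_bound[OF sT(2)[of 0]])
       (use XT D DL[of _ 0] XT0 in \<open>auto intro!: AE_I2\<close>)
  have "(\<integral>\<omega>. indicator ?D \<omega> * X (?T \<omega>) \<omega> \<partial>M) \<le> 1 / real (Suc n)" for n
    using integral_mono[OF int sT(2)[of n] DL] le[of n] by auto
  then have "(\<integral>\<omega>. indicator ?D \<omega> * X (?T \<omega>) \<omega> \<partial>M) \<le> 0"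
    by (intro LIMSEQ_le_const[OF LIMSEQ_inverse_real_of_nat]) (auto simp: inverse_eq_divide)
  moreover have nn: "AE \<omega> in M. 0 \<le> indicator ?D \<omega> * X (?T \<omega>) \<omega>" using XT0 by (auto intro!: AE_I2)
  ultimately have "(\<integral>\<omega>. indicator ?D \<omega> * X (?T \<omega>) \<omega> \<partial>M) = 0"
    using integral_nonneg_AE[OF nn] by simp
  then have "AE \<omega> in M. indicator ?D \<omega> * X (?T \<omega>) \<omega> = 0"
    using integral_nonneg_eq_0_iff_AE[OF int nn] by simp
  then show ?thesis
    using AE_space by eventually_elim auto
qed

text \<open>The constant time \<open>q\<close> is compared with the minimum of \<open>s\<close> and
  \<open>zero_time q\<close>: \<open>A\<close> agrees at both, and at the latter \<open>X\<close>
  vanishes almost surely unless \<open>s\<close> comes first.\<close>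

lemma X_before_last_zero:
  assumes q: "0 \<le> q" "q \<le> s" and L: "\<Lambda> \<in> sets (F q)"
  shows "(\<integral>\<omega>. indicator \<Lambda> \<omega> * X q \<omega> \<partial>M) =
    (\<integral>\<omega>. indicator \<Lambda> \<omega> * X s \<omega> * indicator {\<omega>. ennreal s < zero_time q \<omega>} \<omega> \<partial>M)"
proof -
  have s: "0 \<le> s" using q by simp
  let ?T = "\<lambda>\<omega>. cut_time s (zero_time q \<omega>)"
  have LM: "\<Lambda> \<in> sets M" by (rule sets_M[OF L q(1)])
  have Lr: "\<Lambda> \<in> sets (F r)" if "q \<le> r" for r using L sets_F_mono[OF q(1) that] by auto
  have T: "weak_stopping ?T s" by (intro weak_stopping_cut_time s zero_time_less_sets q)
  have Tq: "weak_stopping (\<lambda>_. q) s"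
    unfolding weak_stopping_def
  proof (intro conjI allI impI ballI)
    fix t :: real assume "0 \<le> t"
    then show "{\<omega>\<in>space M. q < t} \<in> sets (F t)"
      using sets.top[of "F t"] by (auto simp: space_F)
  qed (use q in auto)
  have LT: "{\<omega>\<in>\<Lambda>. ?T \<omega> < t} \<in> sets (F t)" if "0 \<le> t" for t
  proof (rule cut_time_sets[OF s Lr[OF q(2)] _ that])
    fix t :: real assume t: "0 \<le> t" "t \<le> s"
    show "{\<omega>\<in>\<Lambda>. zero_time q \<omega> < ennreal t} \<in> sets (F t)"
    proof (cases "q \<le> t")
      case True
      have "{\<omega>\<in>\<Lambda>. zero_time q \<omega> < ennreal t} = \<Lambda> \<inter> {\<omega>\<in>space M. zero_time q \<omega> < ennreal t}"
        using LM sets.sets_into_space by auto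
      then show ?thesis using Lr[OF True] zero_time_less_sets[OF q(1) t(1)] by auto
    next
      case False
      then have "\<not> zero_time q \<omega> < ennreal t" for \<omega>
        using zero_time_ge[of q \<omega>] t ennreal_leI[of t q] by (meson leD le_cases order_trans)
      then show ?thesis by simp
    qed
  qed
  have Lq: "{\<omega>\<in>\<Lambda>. q < t} \<in> sets (F t)" if "0 \<le> t" for t using Lr[of t] by (cases "q < t") auto
  note sT = stopped_value[OF T s LM LT]
  note sq = stopped_value[OF Tq s LM Lq]
  have "(\<integral>\<omega>. indicator \<Lambda> \<omega> * A (?T \<omega>) \<omega> \<partial>M) = (\<integral>\<omega>. indicator \<Lambda> \<omega> * A q \<omega> \<partial>M)"
  proof (rule integral_cong_AE)
    show "AE \<omega> in M. indicator \<Lambda> \<omega> * A (?T \<omega>) \<omega> = indicator \<Lambda> \<omega> * A q \<omega>"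
      using A_constant_before_zero_time
    proof (eventually_elim)
      case (elim \<omega>)
      have 1: "q \<le> ?T \<omega>"
        using zero_time_ge[of q \<omega>] cut_time_mono[of "ennreal q" "zero_time q \<omega>" s] cut_time_ennreal[OF q] by auto
      have 2: "ennreal (?T \<omega>) \<le> zero_time q \<omega>" by (simp add: ennreal_cut_time)
      show ?case using elim[rule_format, OF q(1) 1 2] by simp
    qed
  qed (use sT(1) sq(1) in auto)
  then have "(\<integral>\<omega>. indicator \<Lambda> \<omega> * X q \<omega> \<partial>M) = (\<integral>\<omega>. indicator \<Lambda> \<omega> * X (?T \<omega>) \<omega> \<partial>M)"
    using sT(3) sq(3) by simp
  also have "\<dots> = (\<integral>\<omega>. indicator \<Lambda> \<omega> * X s \<omega> * indicator {\<omega>. ennreal s < zero_time q \<omega>} \<omega> \<partial>M)"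
  proof (rule integral_cong_AE)
    have "{\<omega>\<in>space M. ennreal s < zero_time q \<omega>} \<in> sets M"
      by (rule sets_M[OF zero_time_greater_sets[OF q(1) s] s])
    then have [measurable]: "Measurable.pred M (\<lambda>\<omega>. ennreal s < zero_time q \<omega>)" by (simp add: pred_def)
    have [measurable]: "X s \<in> borel_measurable M" using X_integrable[OF s] by auto
    show "(\<lambda>\<omega>. indicator \<Lambda> \<omega> * X s \<omega> * indicator {\<omega>. ennreal s < zero_time q \<omega>} \<omega>) \<in> borel_measurable M"
      using LM by measurable
    \<comment> \<open>The horizon \<open>s + 1\<close> includes the case
      \<open>zero_time q = s\<close>, which the strict inequality at horizon \<open>s\<close> would
      miss.\<close>
    have "AE \<omega> in M. zero_time q \<omega> < ennreal (s + 1) \<longrightarrow> X (cut_time (s + 1) (zero_time q \<omega>)) \<omega> = 0"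
      by (rule X_zero_time_bounded) (use q in auto)
    then show "AE \<omega> in M. indicator \<Lambda> \<omega> * X (?T \<omega>) \<omega> = indicator \<Lambda> \<omega> * X s \<omega> * indicator {\<omega>. ennreal s < zero_time q \<omega>} \<omega>"
    proof eventually_elim
      case (elim \<omega>)
      show ?case
      proof (cases "ennreal s < zero_time q \<omega>")
        case True
        then have "?T \<omega> = s" by (intro cut_time_eq s) auto
        then show ?thesis using True by simp
      next
        case False
        then have z: "zero_time q \<omega> \<le> ennreal s" by simp
        moreover have "ennreal s < ennreal (s + 1)" using s by (simp add: ennreal_less_iff)
        ultimately have "zero_time q \<omega> < ennreal (s + 1)" by order
        moreover then have "?T \<omega> = cut_time (s + 1) (zero_time q \<omega>)"
          using z by (simp add: cut_time_le_imp_eq)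
        ultimately show ?thesis using elim False by simp
      qed
    qed
  qed (use sT(2) in auto)
  finally show ?thesis .
qed

section \<open>From constant times to stopping times\<close>

text \<open>The measurable substitute for \<open>g \<le> t\<close>. Only \<open>q > t\<close> are
  considered because a zero at \<open>t\<close> itself is allowed.\<close>

definition zero_free_after :: "real \<Rightarrow> 'a \<Rightarrow> bool" where
  "zero_free_after t \<omega> \<longleftrightarrow> (\<forall>q\<in>\<rat>. t < q \<longrightarrow> zero_time q \<omega> = \<infinity>)"

definition zeros_attained :: "'a \<Rightarrow> bool" where
  "zeros_attained \<omega> \<longleftrightarrow> (\<forall>q\<in>\<rat>. 0 \<le> q \<longrightarrow> zero_time q \<omega> \<noteq> \<infinity> \<longrightarrow> X (enn2real (zero_time q \<omega>)) \<omega> = 0)"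

text \<open>Attainment turns a finite \<open>zero_time q\<close> with \<open>q > t\<close> into a
  genuine zero after \<open>t\<close>; a mere left limit 0 would not count for
  \<open>last_zero\<close>. Conversely, a rational strictly between \<open>t\<close> and a later
  zero has a finite zero time.\<close>

lemma last_zero_le_iff:
  assumes \<omega>: "\<omega> \<in> space M" "zeros_attained \<omega>" and t: "0 \<le> t"
  shows "last_zero X \<omega> \<le> ennreal t \<longleftrightarrow> zero_free_after t \<omega>"
proof
  assume le: "last_zero X \<omega> \<le> ennreal t"
  show "zero_free_after t \<omega>"
    unfolding zero_free_after_def
  proof (intro ballI impI, rule ccontr)
    fix q assume q: "q \<in> \<rat>" "t < q" "zero_time q \<omega> \<noteq> \<infinity>"
    then have "X (enn2real (zero_time q \<omega>)) \<omega> = 0" using \<omega>(2) t by (auto simp: zeros_attained_def)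
    then have "ennreal (enn2real (zero_time q \<omega>)) \<le> last_zero X \<omega>"
      unfolding last_zero_def by (intro SUP_upper) auto
    moreover have "ennreal (enn2real (zero_time q \<omega>)) = zero_time q \<omega>" using q(3) by (simp add: less_top)
    ultimately have "ennreal q \<le> ennreal t" using zero_time_ge[of q \<omega>] le by order
    then show False using q(2) t by (simp add: ennreal_le_iff)
  qed
next
  assume zf: "zero_free_after t \<omega>"
  show "last_zero X \<omega> \<le> ennreal t"
    unfolding last_zero_def
  proof (rule SUP_least, rule ccontr)
    fix v assume v: "v \<in> {v. 0 \<le> v \<and> X v \<omega> = 0}" "\<not> ennreal v \<le> ennreal t"
    then have "t < v" using ennreal_leI[of v t] by force
    then obtain q where q: "q \<in> \<rat>" "t < q" "q < v" using Rats_dense_in_real by blast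
    then have "zero_time q \<omega> = \<infinity>" using zf by (auto simp: zero_free_after_def)
    then have "0 < X v \<omega>" using q t by (intro X_pos_before_zero_time[OF \<omega>(1), of q]) auto
    then show False using v by simp
  qed
qed

lemma zero_time_infinite_sets: "0 \<le> q \<Longrightarrow> {\<omega>\<in>space M. zero_time q \<omega> = \<infinity>} \<in> sets M"
proof -
  assume q: "0 \<le> q"
  have "{\<omega>\<in>space M. zero_time q \<omega> = \<infinity>} = (\<Inter>n. {\<omega>\<in>space M. ennreal (real n) < zero_time q \<omega>})"
    by (simp only: ennreal_eq_top_iff_less_nat) blast
  also have "\<dots> \<in> sets M"
    using sets_M[OF zero_time_greater_sets[OF q]] by (intro sets.countable_INT) auto
  finally show ?thesis .
qed

lemma zero_time_infinite_Int_sets: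
  assumes "0 \<le> q" "\<Lambda> \<in> sets M"
  shows "{\<omega>\<in>\<Lambda>. zero_time q \<omega> = \<infinity>} \<in> sets M"
proof -
  have "{\<omega>\<in>\<Lambda>. zero_time q \<omega> = \<infinity>} = \<Lambda> \<inter> {\<omega>\<in>space M. zero_time q \<omega> = \<infinity>}"
    using assms(2) sets.sets_into_space by auto
  then show ?thesis using assms zero_time_infinite_sets by auto
qed

lemma zero_free_after_sets:
  assumes T: "T \<in> borel_measurable M" "\<And>\<omega>. \<omega> \<in> space M \<Longrightarrow> 0 \<le> T \<omega>"
  shows "{\<omega>\<in>space M. zero_free_after (T \<omega>) \<omega>} \<in> sets M"
proof -
  have "{\<omega>\<in>space M. zero_free_after (T \<omega>) \<omega>} =
    (\<Inter>q\<in>{q\<in>\<rat>. 0 \<le> q}. {\<omega>\<in>space M. q \<le> T \<omega>} \<union> {\<omega>\<in>space M. zero_time q \<omega> = \<infinity>})"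
    using T(2) by (auto simp: zero_free_after_def not_le[symmetric]) (meson le_cases order_trans Rats_0)+
  also have "\<dots> \<in> sets M"
  proof (rule sets.countable_INT', rule_tac[3] image_subsetI)
    show "countable {q\<in>\<rat>. 0 \<le> (q::real)}" by (rule countable_subset[OF _ countable_rat]) auto
    show "{q\<in>\<rat>. 0 \<le> (q::real)} \<noteq> {}" using Rats_0 by auto
    fix q :: real assume "q \<in> {q\<in>\<rat>. 0 \<le> q}"
    then show "{\<omega>\<in>space M. q \<le> T \<omega>} \<union> {\<omega>\<in>space M. zero_time q \<omega> = \<infinity>} \<in> sets M"
      using zero_time_infinite_sets[of q] T(1) by (intro sets.Un) auto
  qed
  finally show ?thesis .
qed

text \<open>\<open>R\<close> is compared with \<open>M\<close> on each \<open>F s\<close> only. For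
  fixed \<open>q\<close> and horizon \<open>c\<close> the failure event belongs to
  \<open>F (c + 1)\<close>, so it is null for \<open>R\<close>; rational \<open>q\<close> and
  horizons \<open>q + n\<close> make countably many such events.\<close>

lemma AE_zeros_attained:
  assumes sets: "sets R = sets M"
    and ac: "\<And>s B. 0 \<le> s \<Longrightarrow> B \<in> sets (F s) \<Longrightarrow> emeasure M B = 0 \<Longrightarrow> emeasure R B = 0"
  shows "AE \<omega> in R. zeros_attained \<omega>"
proof -
  have bad: "AE \<omega> in R. zero_time q \<omega> < ennreal c \<longrightarrow> X (cut_time c (zero_time q \<omega>)) \<omega> = 0"
    if q: "0 \<le> q" "q \<le> c" for q c
  proof -
    have c: "0 \<le> c" "0 \<le> c + 1" using q by auto
    let ?B = "{\<omega>\<in>space M. zero_time q \<omega> < ennreal c \<and> X (cut_time c (zero_time q \<omega>)) \<omega> \<noteq> 0}"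
    have T: "weak_stopping (\<lambda>\<omega>. cut_time c (zero_time q \<omega>)) c"
      by (intro weak_stopping_cut_time c zero_time_less_sets q)
    have [measurable]: "(\<lambda>\<omega>. X (cut_time c (zero_time q \<omega>)) \<omega>) \<in> borel_measurable (F (c + 1))"
      by (rule weak_stopping_value_measurable[OF T c(1) X_adapted X_right])
    have "{\<omega>\<in>space M. zero_time q \<omega> < ennreal c} \<in> sets (F (c + 1))"
      using zero_time_less_sets[OF q(1) c(1)] sets_F_mono[of c "c + 1"] c by auto
    then have [measurable]: "Measurable.pred (F (c + 1)) (\<lambda>\<omega>. zero_time q \<omega> < ennreal c)"
      unfolding pred_def using space_F[OF c(2)] by simp
    have "{\<omega>\<in>space (F (c + 1)). zero_time q \<omega> < ennreal c \<and> X (cut_time c (zero_time q \<omega>)) \<omega> \<noteq> 0} \<in> sets (F (c + 1))"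
      by measurable
    then have B: "?B \<in> sets (F (c + 1))" using space_F[OF c(2)] by simp
    have "AE \<omega> in M. \<omega> \<notin> ?B"
      using X_zero_time_bounded[OF q] by eventually_elim auto
    then have "?B \<in> null_sets M" using AE_iff_null_sets[OF sets_M[OF B c(2)]] by simp
    then have "emeasure M ?B = 0" by auto
    then have "emeasure R ?B = 0" using ac[OF c(2) B] by simp
    then have "AE \<omega> in R. \<omega> \<notin> ?B" using sets_M[OF B c(2)] by (intro AE_not_in) (auto simp: null_sets_def sets)
    then show ?thesis
      using AE_space by eventually_elim (auto simp: sets_eq_imp_space_eq[OF sets])
  qed
  have "AE \<omega> in R. \<forall>q\<in>{q\<in>\<rat>. 0 \<le> q}. \<forall>n. zero_time q \<omega> < ennreal (q + real n) \<longrightarrow> X (cut_time (q + real n) (zero_time q \<omega>)) \<omega> = 0"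
  proof (intro AE_ball_countable[THEN iffD2] ballI AE_all_countable[THEN iffD2] allI bad)
    show "countable {q\<in>\<rat>. 0 \<le> (q::real)}" by (rule countable_subset[OF _ countable_rat]) auto
  qed auto
  then show ?thesis
  proof eventually_elim
    case (elim \<omega>)
    show ?case
      unfolding zeros_attained_def
    proof (intro ballI impI)
      fix q :: real assume q: "q \<in> \<rat>" "0 \<le> q" "zero_time q \<omega> \<noteq> \<infinity>"
      then obtain z where z: "zero_time q \<omega> = ennreal z" "0 \<le> z" by (cases "zero_time q \<omega>") auto
      obtain n :: nat where "z < real n" using reals_Archimedean2 by blast
      then have lt: "zero_time q \<omega> < ennreal (q + real n)" using z q by (simp add: ennreal_less_iff del: ennreal_plus)
      have "X (cut_time (q + real n) (zero_time q \<omega>)) \<omega> = 0" using elim q lt by blast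
      moreover have "cut_time (q + real n) (zero_time q \<omega>) = enn2real (zero_time q \<omega>)"
        using lt by (intro cut_time_le_imp_eq) auto
      ultimately show "X (enn2real (zero_time q \<omega>)) \<omega> = 0" by simp
    qed
  qed
qed

text \<open>For grid times the identity is a finite sum of instances of \<open>law\<close>. As they
  approach \<open>T\<close> strictly from the right, the event
  \<open>zero_time = \<infinity>\<close> at the grid time turns into \<open>zero_free_after\<close>
  at \<open>T\<close>, and both sides have a limit.\<close>

lemma emeasure_zero_free_after:
  assumes sets: "sets R = sets M"
    and law: "\<And>q \<Lambda>. 0 \<le> q \<Longrightarrow> \<Lambda> \<in> sets (F q) \<Longrightarrow>
      emeasure R {\<omega>\<in>\<Lambda>. zero_time q \<omega> = \<infinity>} = ennreal (\<integral>\<omega>. indicator \<Lambda> \<omega> * X q \<omega> \<partial>M)"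
    and T: "weak_stopping T c" and c: "0 \<le> c"
    and L: "\<Lambda> \<in> sets M" "\<And>t. 0 \<le> t \<Longrightarrow> {\<omega>\<in>\<Lambda>. T \<omega> < t} \<in> sets (F t)"
  shows "emeasure R {\<omega>\<in>\<Lambda>. zero_free_after (T \<omega>) \<omega>} = ennreal (\<integral>\<omega>. indicator \<Lambda> \<omega> * X (T \<omega>) \<omega> \<partial>M)"
proof -
  let ?S = "\<lambda>k \<omega>. next_grid k (T \<omega>)"
  have T0: "0 \<le> T \<omega>" "T \<omega> \<le> c" if "\<omega> \<in> space M" for \<omega> using T that by (auto simp: weak_stopping_def)
  have Lsp: "\<Lambda> \<subseteq> space M" using L(1) sets.sets_into_space by auto
  have J: "0 \<le> u \<and> u \<le> c + 1" if "u \<in> grid_set k c" for u k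
    using grid_set_bounds[OF that] by auto
  have SJ: "?S k \<omega> \<in> grid_set k c" if "\<omega> \<in> space M" for k \<omega>
    using T0[OF that] by (intro next_grid_in_grid_set)
  have Su: "{\<omega>\<in>space M. ?S k \<omega> = u} \<in> sets (F u)" if "u \<in> grid_set k c" for u k
    by (rule weak_stopping_grid[OF T weak_stopping_space[OF T] that])
  have Lu: "{\<omega>\<in>\<Lambda>. ?S k \<omega> = u} \<in> sets (F u)" if "u \<in> grid_set k c" for u k
    by (rule weak_stopping_grid[OF T L(2) that])
  define B where "B k = {\<omega>\<in>\<Lambda>. zero_time (?S k \<omega>) \<omega> = \<infinity>}" for k
  define C where "C k u = {\<omega>\<in>{\<omega>\<in>\<Lambda>. ?S k \<omega> = u}. zero_time u \<omega> = \<infinity>}" for k u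
  have C_sets: "C k u \<in> sets R" if "u \<in> grid_set k c" for k u
    unfolding C_def sets using J[OF that] by (intro zero_time_infinite_Int_sets sets_M[OF Lu[OF that]]) auto
  have B_eq: "B k = (\<Union>u\<in>grid_set k c. C k u)" for k
    using SJ Lsp by (auto simp: B_def C_def)
  have B_sets: "B k \<in> sets R" for k unfolding B_eq using C_sets by auto
  have X_grid: "integrable M (\<lambda>\<omega>. indicator {\<omega>\<in>\<Lambda>. ?S k \<omega> = u} \<omega> * X u \<omega>)" if "u \<in> grid_set k c" for k u
    by (rule integrable_bounded_mult[OF X_integrable, of _ _ 1])
       (use J[OF that] sets_M[OF Lu[OF that]] in \<open>auto split: split_indicator\<close>)
  have X_S: "(\<Sum>u\<in>grid_set k c. indicator {\<omega>\<in>\<Lambda>. ?S k \<omega> = u} \<omega> * X u \<omega>) = indicator \<Lambda> \<omega> * X (?S k \<omega>) \<omega>"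
    if "\<omega> \<in> space M" for k \<omega>
    using SJ[OF that, of k] by (subst sum.remove[of _ "?S k \<omega>"]) (auto intro!: sum.neutral split: split_indicator)
  have emB: "emeasure R (B k) = ennreal (\<integral>\<omega>. indicator \<Lambda> \<omega> * X (?S k \<omega>) \<omega> \<partial>M)" for k
  proof -
    have "emeasure R (B k) = (\<Sum>u\<in>grid_set k c. emeasure R (C k u))"
      unfolding B_eq using C_sets by (intro sum_emeasure[symmetric]) (auto simp: disjoint_family_on_def C_def)
    also have "\<dots> = (\<Sum>u\<in>grid_set k c. ennreal (\<integral>\<omega>. indicator {\<omega>\<in>\<Lambda>. ?S k \<omega> = u} \<omega> * X u \<omega> \<partial>M))"
      unfolding C_def using J Lu by (intro sum.cong refl law) auto
    also have "\<dots> = ennreal (\<Sum>u\<in>grid_set k c. \<integral>\<omega>. indicator {\<omega>\<in>\<Lambda>. ?S k \<omega> = u} \<omega> * X u \<omega> \<partial>M)"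
      using J X_nonneg by (intro sum_ennreal integral_nonneg_AE AE_I2) auto
    also have "(\<Sum>u\<in>grid_set k c. \<integral>\<omega>. indicator {\<omega>\<in>\<Lambda>. ?S k \<omega> = u} \<omega> * X u \<omega> \<partial>M)
        = (\<integral>\<omega>. (\<Sum>u\<in>grid_set k c. indicator {\<omega>\<in>\<Lambda>. ?S k \<omega> = u} \<omega> * X u \<omega>) \<partial>M)"
      using X_grid by (intro Bochner_Integration.integral_sum[symmetric])
    also have "\<dots> = (\<integral>\<omega>. indicator \<Lambda> \<omega> * X (?S k \<omega>) \<omega> \<partial>M)"
      by (intro Bochner_Integration.integral_cong refl X_S)
    finally show ?thesis .
  qed
  note NS = martingale_simple_stopping[OF N_martingale finite_grid_set J SJ _ grid_indicator_measurable[OF T L(2)], where C=1]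
  have A_S: "(\<lambda>\<omega>. A (?S k \<omega>) \<omega>) \<in> borel_measurable M" for k
  proof (rule simple_stopped_measurable[where N=A and S="?S k", OF _ finite_grid_set SJ])
    fix u assume u: "u \<in> grid_set k c"
    show "A u \<in> borel_measurable M"
      using A_integrable J[OF u] by auto
    show "{\<omega>\<in>space M. ?S k \<omega> = u} \<in> sets M" by (rule sets_M[OF Su[OF u]]) (use J[OF u] in auto)
  qed
  have A_bd: "\<bar>indicator \<Lambda> \<omega> * A t \<omega>\<bar> \<le> A (c + 1) \<omega>" if "\<omega> \<in> space M" "0 \<le> t" "t \<le> c + 1" for \<omega> t
    using A_nonneg[OF that(1,2)] A_mono[OF that] by (auto split: split_indicator)
  have S_bd: "0 \<le> ?S k \<omega>" "?S k \<omega> \<le> c + 1" if "\<omega> \<in> space M" for k \<omega>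
    using J[OF SJ[OF that, of k]] by auto
  have A_int: "integrable M (A (c + 1))" using A_integrable c by auto
  have AS_int: "integrable M (\<lambda>\<omega>. indicator \<Lambda> \<omega> * A (?S k \<omega>) \<omega>)" for k
  proof (rule Bochner_Integration.integrable_bound[OF A_int])
    show "(\<lambda>\<omega>. indicator \<Lambda> \<omega> * A (?S k \<omega>) \<omega>) \<in> borel_measurable M" using A_S L(1) by auto
    show "AE \<omega> in M. norm (indicator \<Lambda> \<omega> * A (?S k \<omega>) \<omega>) \<le> norm (A (c + 1) \<omega>)"
      using A_bd[OF _ S_bd] by (intro AE_I2) (simp add: order_trans[OF _ abs_ge_self])
  qed
  have limA: "(\<lambda>k. \<integral>\<omega>. indicator \<Lambda> \<omega> * A (?S k \<omega>) \<omega> \<partial>M) \<longlonglongrightarrow> (\<integral>\<omega>. indicator \<Lambda> \<omega> * A (T \<omega>) \<omega> \<partial>M)"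
  proof (rule integral_dominated_convergence[OF _ _ A_int])
    show "(\<lambda>\<omega>. indicator \<Lambda> \<omega> * A (T \<omega>) \<omega>) \<in> borel_measurable M"
      using stopped_value(1)[OF T c L] by auto
    show "AE \<omega> in M. (\<lambda>k. indicator \<Lambda> \<omega> * A (?S k \<omega>) \<omega>) \<longlonglongrightarrow> indicator \<Lambda> \<omega> * A (T \<omega>) \<omega>"
      by (intro AE_I2 tendsto_intros right_continuous_sequentially[where f="\<lambda>t. A t _"] A_right T0
            next_grid_tendsto less_imp_le[OF next_grid_gt])
  qed (use AS_int A_bd S_bd in \<open>auto intro!: AE_I2\<close>)
  \<comment> \<open>The martingale part does not depend on \<open>k\<close>, so only
    \<open>A\<close> needs a limit, and there \<open>A (c + 1)\<close> dominates.\<close>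
  have eqX: "(\<integral>\<omega>. indicator \<Lambda> \<omega> * X (?S k \<omega>) \<omega> \<partial>M) =
      (\<integral>\<omega>. indicator \<Lambda> \<omega> * N (c + 1) \<omega> \<partial>M) + (\<integral>\<omega>. indicator \<Lambda> \<omega> * A (?S k \<omega>) \<omega> \<partial>M)" for k
  proof -
    have "(\<integral>\<omega>. indicator \<Lambda> \<omega> * X (?S k \<omega>) \<omega> \<partial>M) =
      (\<integral>\<omega>. indicator \<Lambda> \<omega> * N (?S k \<omega>) \<omega> + indicator \<Lambda> \<omega> * A (?S k \<omega>) \<omega> \<partial>M)"
      using S_bd by (intro Bochner_Integration.integral_cong refl) (simp add: X_eq distrib_left)
    then show ?thesis using NS[of k] AS_int[of k] by (simp split: split_indicator)
  qed
  have "(\<lambda>k. \<integral>\<omega>. indicator \<Lambda> \<omega> * X (?S k \<omega>) \<omega> \<partial>M) \<longlonglongrightarrow> (\<integral>\<omega>. indicator \<Lambda> \<omega> * X (T \<omega>) \<omega> \<partial>M)"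
    using tendsto_add[OF tendsto_const limA, of "\<integral>\<omega>. indicator \<Lambda> \<omega> * N (c + 1) \<omega> \<partial>M"]
    by (simp add: eqX stopped_value(3)[OF T c L])
  then have lim1: "(\<lambda>k. emeasure R (B k)) \<longlonglongrightarrow> ennreal (\<integral>\<omega>. indicator \<Lambda> \<omega> * X (T \<omega>) \<omega> \<partial>M)"
    unfolding emB by (rule tendsto_ennrealI)
  let ?B = "{\<omega>\<in>\<Lambda>. zero_free_after (T \<omega>) \<omega>}"
  have "?B = \<Lambda> \<inter> {\<omega>\<in>space M. zero_free_after (T \<omega>) \<omega>}" using Lsp by auto
  then have BR: "?B \<in> sets R"
    using zero_free_after_sets[OF weak_stopping_measurable[OF T] T0(1)] L(1) by (auto simp: sets)
  \<comment> \<open>\<open>R\<close> may be infinite. All \<open>B k\<close> lie in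
    \<open>?E\<close>, because the grid times are at most \<open>c + 1\<close>, and
    \<open>law\<close> gives \<open>?E\<close> finite mass.\<close>
  let ?E = "{\<omega>\<in>space M. zero_time (c + 1) \<omega> = \<infinity>}"
  have ER: "?E \<in> sets R" using zero_time_infinite_sets[of "c + 1"] c by (simp add: sets)
  have Efin: "emeasure R ?E < \<infinity>"
    using law[of "c + 1" "space M"] c space_F[of "c + 1"] sets.top[of "F (c + 1)"] by simp
  have "(\<lambda>k. \<integral>\<^sup>+\<omega>. indicator (B k) \<omega> \<partial>R) \<longlonglongrightarrow> (\<integral>\<^sup>+\<omega>. indicator ?B \<omega> \<partial>R)"
  proof (rule nn_integral_dominated_convergence[where w="indicator ?E"])
    show "AE \<omega> in R. indicator (B k) \<omega> \<le> (indicator ?E \<omega> :: ennreal)" for k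
    proof (intro AE_I2)
      fix \<omega>
      have "\<omega> \<in> B k \<Longrightarrow> \<omega> \<in> ?E"
        using S_bd[of \<omega> k] Lsp zero_time_mono[of "?S k \<omega>" "c + 1" \<omega>] by (auto simp: B_def top_unique)
      then show "indicator (B k) \<omega> \<le> (indicator ?E \<omega> :: ennreal)" by (auto split: split_indicator)
    qed
    show "AE \<omega> in R. (\<lambda>k. indicator (B k) \<omega> :: ennreal) \<longlonglongrightarrow> indicator ?B \<omega>"
    proof (intro AE_I2)
      fix \<omega>
      show "(\<lambda>k. indicator (B k) \<omega> :: ennreal) \<longlonglongrightarrow> indicator ?B \<omega>"
      proof (cases "\<omega> \<in> \<Lambda>")
        case True
        have "eventually (\<lambda>k. \<omega> \<in> B k \<longleftrightarrow> \<omega> \<in> ?B) sequentially"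
        proof (cases "zero_free_after (T \<omega>) \<omega>")
          case zf: True
          have "\<omega> \<in> B k" for k
            using zf next_grid_gt[of "T \<omega>" k] next_grid_Rats True by (auto simp: B_def zero_free_after_def)
          then show ?thesis using zf True by auto
        next
          case False
          then obtain q where q: "T \<omega> < q" "zero_time q \<omega> \<noteq> \<infinity>" by (auto simp: zero_free_after_def)
          have "eventually (\<lambda>k. ?S k \<omega> < q) sequentially"
            using next_grid_tendsto q(1) by (rule order_tendstoD(2))
          then show ?thesis
          proof eventually_elim
            case (elim k)
            then show ?case
              using zero_time_mono[of "?S k \<omega>" q \<omega>] q(2) False by (auto simp: B_def top_unique)
          qed
        qed
        then show ?thesis by (intro tendsto_eventually) (auto elim!: eventually_mono split: split_indicator)
      next
        case False
        then show ?thesis by (auto simp: B_def)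
      qed
    qed
  qed (use B_sets BR ER Efin in auto)
  then have "(\<lambda>k. emeasure R (B k)) \<longlonglongrightarrow> emeasure R ?B"
    using B_sets BR by (simp add: nn_integral_indicator)
  from LIMSEQ_unique[OF this lim1] show ?thesis .
qed

lemma bounded_stopping_representation:
  assumes sets: "sets R = sets M"
    and law: "\<And>q \<Lambda>. 0 \<le> q \<Longrightarrow> \<Lambda> \<in> sets (F q) \<Longrightarrow>
      emeasure R {\<omega>\<in>\<Lambda>. zero_time q \<omega> = \<infinity>} = ennreal (\<integral>\<omega>. indicator \<Lambda> \<omega> * X q \<omega> \<partial>M)"
    and att: "AE \<omega> in R. zeros_attained \<omega>"
    and T: "is_stopping_time M F T" and c: "0 \<le> c" "\<And>\<omega>. \<omega> \<in> space M \<Longrightarrow> T \<omega> \<le> ennreal c"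
    and f: "f \<in> borel_measurable (sigma_at M F T)" "\<And>\<omega>. \<omega> \<in> space M \<Longrightarrow> \<bar>f \<omega>\<bar> \<le> K"
  shows "integrable M (\<lambda>\<omega>. f \<omega> * X (enn2real (T \<omega>)) \<omega>)"
    and "has_bochner_integral (completion R) (\<lambda>\<omega>. f \<omega> * indicator {\<omega>. last_zero X \<omega> \<le> T \<omega>} \<omega>)
          (\<integral>\<omega>. f \<omega> * X (enn2real (T \<omega>)) \<omega> \<partial>M)"
proof -
  have sp: "space R = space M" using sets by (rule sets_eq_imp_space_eq)
  let ?T = "\<lambda>\<omega>. cut_time c (T \<omega>)"
  let ?G = "sigma_at M F T"
  let ?B = "{\<omega>\<in>space M. zero_free_after (?T \<omega>) \<omega>}"
  have Teq: "enn2real (T \<omega>) = ?T \<omega>" "ennreal (?T \<omega>) = T \<omega>" if "\<omega> \<in> space M" for \<omega>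
    using c(2)[OF that] by (auto simp: cut_time_le_imp_eq[of _ c, symmetric] ennreal_cut_time min_absorb1)
  have W: "weak_stopping ?T c" by (intro weak_stopping_cut_time c stopping_time_less_sets T)
  have sub: "subalgebra M ?G" by (rule subalgebra_sigma_at[OF T])
  have GM: "\<Lambda> \<in> sets M" if "\<Lambda> \<in> sets ?G" for \<Lambda> using sub that by (auto simp: subalgebra_def)
  have L: "{\<omega>\<in>\<Lambda>. ?T \<omega> < t} \<in> sets (F t)" if L: "\<Lambda> \<in> sets ?G" and t: "0 \<le> t" for \<Lambda> t
  proof -
    have "\<Lambda> \<subseteq> space M" using GM[OF L] sets.sets_into_space by auto
    moreover have "?T \<omega> < t \<longleftrightarrow> T \<omega> < ennreal t" if "\<omega> \<in> space M" for \<omega>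
      using ennreal_less_iff[OF cut_time_nonneg, of c "T \<omega>" t] Teq(2)[OF that] by simp
    ultimately have "{\<omega>\<in>\<Lambda>. ?T \<omega> < t} = {\<omega>\<in>\<Lambda>. T \<omega> < ennreal t}" by blast
    then show ?thesis using sigma_at_less_sets[OF T L t] by simp
  qed
  have B: "?B \<in> sets M" by (intro zero_free_after_sets weak_stopping_measurable[OF W] cut_time_nonneg)
  have spG: "space M \<in> sets ?G" using sets.top[of ?G] by (simp add: space_sigma_at)
  have int: "integrable M (\<lambda>\<omega>. indicator (space M) \<omega> * X (?T \<omega>) \<omega>)"
    by (rule stopped_value(2)[OF W c(1) GM[OF spG] L[OF spG]])
  have intX: "integrable M (\<lambda>\<omega>. X (?T \<omega>) \<omega>)"
    by (rule Bochner_Integration.integrable_cong[THEN iffD1, OF refl _ int]) simp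
  have fM: "f \<in> borel_measurable M" using measurable_from_subalg[OF sub f(1)] .
  have "integrable M (\<lambda>\<omega>. f \<omega> * X (?T \<omega>) \<omega>)" by (rule integrable_bounded_mult[OF intX fM f(2)])
  then show "integrable M (\<lambda>\<omega>. f \<omega> * X (enn2real (T \<omega>)) \<omega>)"
    by (rule Bochner_Integration.integrable_cong[THEN iffD2, rotated 2]) (auto simp: Teq)
  have "has_bochner_integral R (\<lambda>\<omega>. f \<omega> * indicator ?B \<omega>) (\<integral>\<omega>. f \<omega> * X (?T \<omega>) \<omega> \<partial>M)"
  proof (rule restr_measure_integral_eq[OF sub sets B _ _ intX _ f])
    fix \<Lambda> assume \<Lambda>: "\<Lambda> \<in> sets ?G"
    have 1: "\<Lambda> \<inter> ?B = {\<omega>\<in>\<Lambda>. zero_free_after (?T \<omega>) \<omega>}" using GM[OF \<Lambda>] sets.sets_into_space by auto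
    show "emeasure R (\<Lambda> \<inter> ?B) = ennreal (\<integral>\<omega>. indicator \<Lambda> \<omega> * X (?T \<omega>) \<omega> \<partial>M)"
      unfolding 1 by (rule emeasure_zero_free_after[OF sets law W c(1) GM[OF \<Lambda>] L[OF \<Lambda>]])
  qed (use intX X_nonneg cut_time_nonneg in auto)
  moreover have "(\<integral>\<omega>. f \<omega> * X (?T \<omega>) \<omega> \<partial>M) = (\<integral>\<omega>. f \<omega> * X (enn2real (T \<omega>)) \<omega> \<partial>M)"
    by (rule Bochner_Integration.integral_cong) (auto simp: Teq)
  ultimately have "has_bochner_integral R (\<lambda>\<omega>. f \<omega> * indicator ?B \<omega>) (\<integral>\<omega>. f \<omega> * X (enn2real (T \<omega>)) \<omega> \<partial>M)"
    by simp
  then show "has_bochner_integral (completion R) (\<lambda>\<omega>. f \<omega> * indicator {\<omega>. last_zero X \<omega> \<le> T \<omega>} \<omega>)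
          (\<integral>\<omega>. f \<omega> * X (enn2real (T \<omega>)) \<omega> \<partial>M)"
  proof (rule has_bochner_integral_completion_cong)
    show "f \<in> borel_measurable R" using fM by (simp add: measurable_cong_sets[OF sets refl])
    show "?B \<in> sets R" using B sets by simp
    show "AE \<omega> in R. \<omega> \<in> ?B \<longleftrightarrow> \<omega> \<in> {\<omega>. last_zero X \<omega> \<le> T \<omega>}"
      using att AE_space
    proof eventually_elim
      case (elim \<omega>)
      then have \<omega>: "\<omega> \<in> space M" using sp by simp
      show ?case using last_zero_le_iff[OF \<omega> elim(1) cut_time_nonneg, of c "T \<omega>"] \<omega> Teq(2)[OF \<omega>] by simp
    qed
  qed
qed

lemma zero_time_infinite_split:
  assumes "0 \<le> q" "q \<le> s"
  shows "zero_time q \<omega> = \<infinity> \<longleftrightarrow> ennreal s < zero_time q \<omega> \<and> zero_time s \<omega> = \<infinity>"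
proof
  assume *: "zero_time q \<omega> = \<infinity>"
  then show "ennreal s < zero_time q \<omega> \<and> zero_time s \<omega> = \<infinity>"
    using zero_time_mono[OF assms(2), of \<omega>] by (auto simp: top_unique)
next
  assume *: "ennreal s < zero_time q \<omega> \<and> zero_time s \<omega> = \<infinity>"
  show "zero_time q \<omega> = \<infinity>"
  proof (rule ccontr)
    assume "zero_time q \<omega> \<noteq> \<infinity>"
    then obtain z where z: "zero_time q \<omega> = ennreal z" "0 \<le> z" by (cases "zero_time q \<omega>") auto
    then have "s \<le> z" using * ennreal_leI[of z s] by fastforce
    then have "ennreal z < zero_time q \<omega>"
      using zero_time_split[OF assms(2,1), of z \<omega>] * by auto
    then show False using z by simp
  qed
qed

lemma zero_time_infinite_imp_last_zero_le:
  assumes "\<omega> \<in> space M" "0 \<le> q" "zero_time q \<omega> = \<infinity>"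
  shows "last_zero X \<omega> \<le> ennreal q"
  unfolding last_zero_def
proof (rule SUP_least, rule ccontr)
  fix v assume v: "v \<in> {v. 0 \<le> v \<and> X v \<omega> = 0}" "\<not> ennreal v \<le> ennreal q"
  then have "q \<le> v" using ennreal_leI[of v q] by force
  then have "0 < X v \<omega>" using assms(3) by (intro X_pos_before_zero_time[OF assms(1,2)]) auto
  then show False using v by simp
qed

section \<open>The representing measure\<close>

text \<open>\<open>X\<close> killed at its first zero from \<open>q\<close> on. For
  \<open>s \<ge> q\<close> this is the density process whose measure describes paths without such a
  zero.\<close>

definition killed :: "real \<Rightarrow> real \<Rightarrow> 'a \<Rightarrow> real" where
  "killed q s \<omega> = X s \<omega> * indicator {\<omega>. ennreal s < zero_time q \<omega>} \<omega>"

lemma killed_nonneg: "0 \<le> s \<Longrightarrow> \<omega> \<in> space M \<Longrightarrow> 0 \<le> killed q s \<omega>"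
  by (simp add: killed_def X_nonneg)

lemma killed_integrable:
  assumes "0 \<le> q" "0 \<le> s"
  shows "integrable M (killed q s)"
proof -
  let ?B = "{\<omega>\<in>space M. ennreal s < zero_time q \<omega>}"
  have B: "?B \<in> sets M" by (rule sets_M[OF zero_time_greater_sets[OF assms] assms(2)])
  have "integrable M (\<lambda>\<omega>. X s \<omega> * indicator ?B \<omega>)"
    by (rule integrable_real_mult_indicator[OF B X_integrable[OF assms(2)]])
  then show ?thesis
    by (rule Bochner_Integration.integrable_cong[THEN iffD1, rotated 2])
       (auto simp: killed_def split: split_indicator)
qed

text \<open>\<open>X_before_last_zero\<close> from \<open>s\<close> to \<open>u\<close>, applied on
  the part of \<open>\<Lambda>\<close> with no zero yet; \<open>zero_time_split\<close> recombines
  the two conditions.\<close>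

lemma killed_integral_eq:
  assumes "0 \<le> q" "q \<le> s" "s \<le> u" "\<Lambda> \<in> sets (F s)"
  shows "(\<integral>\<omega>. indicator \<Lambda> \<omega> * killed q s \<omega> \<partial>M) = (\<integral>\<omega>. indicator \<Lambda> \<omega> * killed q u \<omega> \<partial>M)"
proof -
  let ?L = "\<Lambda> \<inter> {\<omega>\<in>space M. ennreal s < zero_time q \<omega>}"
  have L: "?L \<in> sets (F s)" using zero_time_greater_sets[of q s] assms by auto
  have "(\<integral>\<omega>. indicator \<Lambda> \<omega> * killed q s \<omega> \<partial>M) = (\<integral>\<omega>. indicator ?L \<omega> * X s \<omega> \<partial>M)"
    by (intro Bochner_Integration.integral_cong) (auto simp: killed_def split: split_indicator)
  also have "\<dots> = (\<integral>\<omega>. indicator ?L \<omega> * X u \<omega> * indicator {\<omega>. ennreal u < zero_time s \<omega>} \<omega> \<partial>M)"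
    by (rule X_before_last_zero[OF _ assms(3) L]) (use assms in auto)
  also have "\<dots> = (\<integral>\<omega>. indicator \<Lambda> \<omega> * killed q u \<omega> \<partial>M)"
    using zero_time_split[OF assms(2,1,3)]
    by (intro Bochner_Integration.integral_cong) (auto simp: killed_def split: split_indicator)
  finally show ?thesis .
qed

text \<open>The indicator in \<open>killed q q\<close> removes the paths with
  \<open>zero_time q = q\<close>, on which \<open>X q\<close> vanishes almost surely.\<close>

lemma killed_integral_start:
  assumes "0 \<le> q" "\<Lambda> \<in> sets (F q)"
  shows "(\<integral>\<omega>. indicator \<Lambda> \<omega> * killed q q \<omega> \<partial>M) = (\<integral>\<omega>. indicator \<Lambda> \<omega> * X q \<omega> \<partial>M)"
  using X_before_last_zero[OF assms(1) order_refl assms(2)] by (simp add: killed_def mult.assoc)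

lemma exists_killed_measure:
  assumes P: "property_P M F"
  shows "\<exists>Q. sets Q = sets M \<and> (\<forall>i \<Lambda>. \<Lambda> \<in> sets (F (real i)) \<longrightarrow>
    emeasure Q \<Lambda> = ennreal (\<integral>\<omega>. indicator \<Lambda> \<omega> * killed (real n) (real (max n i)) \<omega> \<partial>M))"
proof -
  \<comment> \<open>The killed process has the martingale identity from time \<open>n\<close> on.
    For \<open>i < n\<close> the density at time \<open>n\<close> is used, which is consistent with
    all later ones.\<close>
  let ?D = "\<lambda>i. killed (real n) (real (max n i))"
  define e where "e = (\<integral>\<omega>. X (real n) \<omega> \<partial>M)"
  have D_int: "integrable M (?D i)" for i by (rule killed_integrable) auto
  have D0: "0 \<le> ?D i \<omega>" if "\<omega> \<in> space M" for i \<omega> by (rule killed_nonneg) (use that in auto)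
  have space_mult: "(\<integral>\<omega>. indicator (space M) \<omega> * f \<omega> \<partial>M) = (\<integral>\<omega>. f \<omega> \<partial>M)" for f :: "'a \<Rightarrow> real"
    by (rule Bochner_Integration.integral_cong) auto
  have D_e: "(\<integral>\<omega>. ?D i \<omega> \<partial>M) = e" for i
    using killed_integral_eq[of "real n" "real n" "real (max n i)" "space M"]
      killed_integral_start[of "real n" "space M"] space_in_sets_F by (simp add: space_mult e_def)
  have D_step: "(\<integral>\<omega>. indicator \<Lambda> \<omega> * ?D (Suc i) \<omega> \<partial>M) = (\<integral>\<omega>. indicator \<Lambda> \<omega> * ?D i \<omega> \<partial>M)"
    if "\<Lambda> \<in> sets (F (real i))" for i \<Lambda>
    by (rule killed_integral_eq[symmetric])
       (use that sets_F_mono[of "real i" "real (max n i)"] in auto)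
  have LM: "\<Lambda> \<in> sets M" if "\<Lambda> \<in> sets (F (real i))" for i \<Lambda> by (rule sets_M[OF that]) simp
  have LD_int: "integrable M (\<lambda>\<omega>. indicator \<Lambda> \<omega> * ?D i \<omega>)" if "\<Lambda> \<in> sets M" for i \<Lambda>
    using integrable_real_mult_indicator[OF that D_int[of i]] by (simp add: mult.commute)
  have e0: "0 \<le> e" unfolding e_def using X_nonneg by (intro integral_nonneg_AE AE_I2) auto
  show ?thesis
  \<comment> \<open>The extension theorem concerns probabilities, so the densities are divided by
    their common mass \<open>e\<close>; for mass 0 the null measure serves.\<close>
  proof (cases "e = 0")
    case True
    have "(\<integral>\<omega>. indicator \<Lambda> \<omega> * ?D i \<omega> \<partial>M) = 0" if "\<Lambda> \<in> sets (F (real i))" for i \<Lambda>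
    proof (rule antisym)
      have "(\<integral>\<omega>. indicator \<Lambda> \<omega> * ?D i \<omega> \<partial>M) \<le> (\<integral>\<omega>. ?D i \<omega> \<partial>M)"
        by (rule integral_mono[OF LD_int[OF LM[OF that]] D_int]) (auto simp: D0 split: split_indicator)
      then show "(\<integral>\<omega>. indicator \<Lambda> \<omega> * ?D i \<omega> \<partial>M) \<le> 0" using D_e True by simp
      show "0 \<le> (\<integral>\<omega>. indicator \<Lambda> \<omega> * ?D i \<omega> \<partial>M)" using D0 by (intro integral_nonneg_AE AE_I2) auto
    qed
    then show ?thesis by (intro exI[of _ "null_measure M"]) auto
  next
    case False
    then have e: "0 < e" using e0 by simp
    let ?M = "\<lambda>i. density M (\<lambda>\<omega>. ennreal (?D i \<omega> / e))"
    define \<mu> where "\<mu> i = restr_to_subalg (?M i) (F (real i))" for i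
    have sub: "subalgebra (?M i) (F (real i))" for i
      using subalgebra_F[of "real i"] by (simp add: subalgebra_def)
    have em: "emeasure (\<mu> i) \<Lambda> = ennreal ((\<integral>\<omega>. indicator \<Lambda> \<omega> * ?D i \<omega> \<partial>M) / e)" if L: "\<Lambda> \<in> sets (F (real i))" for i \<Lambda>
    proof -
      have "emeasure (\<mu> i) \<Lambda> = ennreal (\<integral>\<omega>. indicator \<Lambda> \<omega> * (?D i \<omega> / e) \<partial>M)"
        unfolding \<mu>_def emeasure_restr_to_subalg[OF sub L]
        by (rule emeasure_density_integral) (use D_int D0 e LM[OF L] in auto)
      also have "(\<integral>\<omega>. indicator \<Lambda> \<omega> * (?D i \<omega> / e) \<partial>M) = (\<integral>\<omega>. indicator \<Lambda> \<omega> * ?D i \<omega> \<partial>M) / e" by simp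
      finally show ?thesis .
    qed
    have sets_\<mu>: "sets (\<mu> i) = sets (F (real i))" for i unfolding \<mu>_def by (rule sets_restr_to_subalg[OF sub])
    have "\<exists>Q. sets Q = sets M \<and> (\<forall>i. \<forall>\<Lambda>\<in>sets (F (real i)). emeasure Q \<Lambda> = emeasure (\<mu> i) \<Lambda>)"
    proof (rule property_P_extension[OF filtered_prob_space_axioms P _ sets_\<mu>])
      show "prob_space (\<mu> i)" for i
      proof (rule prob_spaceI)
        have "space (\<mu> i) = space M" by (simp add: \<mu>_def space_restr_to_subalg)
        then show "emeasure (\<mu> i) (space (\<mu> i)) = 1"
          using em[OF space_in_sets_F[of "real i"]] e by (simp add: space_mult D_e)
      qed
      fix i \<Lambda> assume L: "\<Lambda> \<in> sets (F (real i))"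
      then have "\<Lambda> \<in> sets (F (real (Suc i)))" using sets_F_mono[of "real i" "real (Suc i)"] by auto
      then show "emeasure (\<mu> (Suc i)) \<Lambda> = emeasure (\<mu> i) \<Lambda>" by (simp only: em L D_step)
    qed
    then obtain Q where Q: "sets Q = sets M" "\<And>i \<Lambda>. \<Lambda> \<in> sets (F (real i)) \<Longrightarrow> emeasure Q \<Lambda> = emeasure (\<mu> i) \<Lambda>"
      by blast
    have "emeasure (scale_measure (ennreal e) Q) \<Lambda> = ennreal (\<integral>\<omega>. indicator \<Lambda> \<omega> * ?D i \<omega> \<partial>M)"
      if "\<Lambda> \<in> sets (F (real i))" for i \<Lambda>
    proof -
      have "0 \<le> (\<integral>\<omega>. indicator \<Lambda> \<omega> * ?D i \<omega> \<partial>M)" using D0 by (intro integral_nonneg_AE AE_I2) auto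
      then show ?thesis using e by (simp add: Q(2)[OF that] em[OF that] ennreal_mult[symmetric])
    qed
    then show ?thesis using Q(1) by (intro exI[of _ "scale_measure (ennreal e) Q"]) auto
  qed
qed

text \<open>Since \<open>zero_time q \<le> zero_time n\<close>, the processes killed from
  \<open>n\<close> and from \<open>q\<close> agree on \<open>{zero_time q > i}\<close>. By the
  martingale identity these decreasing events have constant mass, which passes to their
  intersection. With \<open>q = n\<close> and the whole space this shows that the measure is carried
  by \<open>{zero_time n = \<infinity>}\<close>.\<close>

lemma killed_measure_zero_free:
  assumes sets: "sets R = sets M"
    and law: "\<And>i \<Lambda>. \<Lambda> \<in> sets (F (real i)) \<Longrightarrow>
      emeasure R \<Lambda> = ennreal (\<integral>\<omega>. indicator \<Lambda> \<omega> * killed (real n) (real (max n i)) \<omega> \<partial>M)"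
    and q: "0 \<le> q" "q \<le> real n" "q \<le> s" and L: "\<Lambda> \<in> sets (F s)"
  shows "emeasure R {\<omega>\<in>\<Lambda>. zero_time q \<omega> = \<infinity>} = ennreal (\<integral>\<omega>. indicator \<Lambda> \<omega> * killed q s \<omega> \<partial>M)"
proof -
  have s: "0 \<le> s" using q by simp
  obtain i0 :: nat where i0: "max (real n) s \<le> real i0" using real_arch_simple by blast
  define B where "B j = {\<omega>\<in>\<Lambda>. ennreal (real (i0 + j)) < zero_time q \<omega>}" for j
  have Lsp: "\<Lambda> \<subseteq> space M" using sets_M[OF L s] sets.sets_into_space by auto
  have B_F: "B j \<in> sets (F (real (i0 + j)))" for j
  proof -
    have "B j = \<Lambda> \<inter> {\<omega>\<in>space M. ennreal (real (i0 + j)) < zero_time q \<omega>}" using Lsp by (auto simp: B_def)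
    then show ?thesis
      using zero_time_greater_sets[OF q(1), of "real (i0 + j)"] L sets_F_mono[OF s, of "real (i0 + j)"] i0 by auto
  qed
  have em: "emeasure R (B j) = ennreal (\<integral>\<omega>. indicator \<Lambda> \<omega> * killed q s \<omega> \<partial>M)" for j
  proof -
    have mx: "max n (i0 + j) = i0 + j" using i0 by auto
    have "(\<integral>\<omega>. indicator (B j) \<omega> * killed (real n) (real (i0 + j)) \<omega> \<partial>M) = (\<integral>\<omega>. indicator \<Lambda> \<omega> * killed q (real (i0 + j)) \<omega> \<partial>M)"
      using zero_time_mono[OF q(2)] by (intro Bochner_Integration.integral_cong)
        (auto simp: B_def killed_def intro: less_le_trans split: split_indicator)
    also have "\<dots> = (\<integral>\<omega>. indicator \<Lambda> \<omega> * killed q s \<omega> \<partial>M)"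
      using i0 by (intro killed_integral_eq[symmetric] q L) auto
    finally show ?thesis using law[OF B_F[of j]] by (simp add: mx)
  qed
  have BR: "B j \<in> sets R" for j using sets_M[OF B_F] sets by simp
  have "(INF j. emeasure R (B j)) = emeasure R (\<Inter>j. B j)"
  proof (rule INF_emeasure_decseq)
    show "decseq B"
      unfolding decseq_def
    proof (intro allI impI subsetI)
      fix m n \<omega> assume "m \<le> n" and \<omega>: "\<omega> \<in> B n"
      then have "ennreal (real (i0 + m)) \<le> ennreal (real (i0 + n))" by (intro ennreal_leI) simp
      then show "\<omega> \<in> B m" using \<omega> unfolding B_def by (simp only: mem_Collect_eq) (blast intro: le_less_trans)
    qed
  qed (use BR em in auto)
  moreover have "(\<Inter>j. B j) = {\<omega>\<in>\<Lambda>. zero_time q \<omega> = \<infinity>}"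
  proof -
    have "(\<forall>j. ennreal (real (i0 + j)) < x) \<longleftrightarrow> x = \<infinity>" for x
      unfolding ennreal_eq_top_iff_less_nat
      by (metis add.commute ennreal_leI le_add1 le_less_trans of_nat_mono)
    then show ?thesis by (auto simp: B_def)
  qed
  ultimately show ?thesis by (simp add: em)
qed

lemma exists_representing_measure:
  assumes P: "property_P M F"
  shows "\<exists>Q. sets Q = sets M \<and> sigma_finite_measure Q \<and> represents M F X Q"
proof -
  have gen: "sets M = sets (sigma_infinity (space M) F)" using P by (simp add: property_P_def)
  obtain Qn where Qn: "\<And>n. sets (Qn n) = sets M"
    and law: "\<And>n i \<Lambda>. \<Lambda> \<in> sets (F (real i)) \<Longrightarrow>
      emeasure (Qn n) \<Lambda> = ennreal (\<integral>\<omega>. indicator \<Lambda> \<omega> * killed (real n) (real (max n i)) \<omega> \<partial>M)"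
  proof -
    have "\<forall>n. \<exists>Q. sets Q = sets M \<and> (\<forall>i \<Lambda>. \<Lambda> \<in> sets (F (real i)) \<longrightarrow>
      emeasure Q \<Lambda> = ennreal (\<integral>\<omega>. indicator \<Lambda> \<omega> * killed (real n) (real (max n i)) \<omega> \<partial>M))"
      using exists_killed_measure[OF P] by blast
    from choice[OF this] show ?thesis using that by blast
  qed
  define E where "E n = {\<omega>\<in>space M. zero_time (real n) \<omega> = \<infinity>}" for n :: nat
  have E: "E n \<in> sets M" for n unfolding E_def by (rule zero_time_infinite_sets) simp
  have spQ: "space (Qn n) = space M" for n by (rule sets_eq_imp_space_eq[OF Qn])
  have fin: "emeasure (Qn n) (space M) \<noteq> \<infinity>" for n using law[of "space M" 0 n] space_in_sets_F by simp
  have mono: "Qn n \<le> Qn m" if "n \<le> m" for n m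
  proof -
    \<comment> \<open>\<open>Qn n\<close> is the trace of \<open>Qn m\<close> on \<open>E n\<close>:
      on \<open>F i\<close> with \<open>i \<ge> m\<close> both are given by the process killed from
      \<open>n\<close>. Monotonicity in \<open>n\<close> is a consequence, so the supremum can be
      taken setwise.\<close>
    have "Qn n = density (Qn m) (indicator (E n))"
    proof (rule measure_eq_on_filtration[OF gen Qn _ fin])
      fix t \<Lambda> assume t: "0 \<le> t" "\<Lambda> \<in> sets (F t)"
      obtain i :: nat where i: "max t (real m) \<le> real i" using real_arch_simple by blast
      have L: "\<Lambda> \<in> sets (F (real i))" using t sets_F_mono[OF t(1), of "real i"] i by auto
      have "max n i = i" using i that by auto
      have "{\<omega>\<in>\<Lambda>. zero_time (real n) \<omega> = \<infinity>} = \<Lambda> \<inter> E n"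
        using sets_M[OF t(2,1)] sets.sets_into_space by (auto simp: E_def)
      then have "emeasure (Qn m) (\<Lambda> \<inter> E n) = ennreal (\<integral>\<omega>. indicator \<Lambda> \<omega> * killed (real n) (real i) \<omega> \<partial>M)"
        using killed_measure_zero_free[OF Qn law, of "real n" m "real i" \<Lambda>] L i that by simp
      then have "emeasure (Qn n) \<Lambda> = emeasure (Qn m) (\<Lambda> \<inter> E n)"
        using law[OF L, of n] \<open>max n i = i\<close> by simp
      also have "\<dots> = emeasure (density (Qn m) (indicator (E n))) \<Lambda>"
        using E sets_M[OF t(2,1)] by (simp add: emeasure_restricted Qn Int_commute)
      finally show "emeasure (Qn n) \<Lambda> = emeasure (density (Qn m) (indicator (E n))) \<Lambda>" .
    qed (simp add: Qn)
    moreover have "emeasure (density (Qn m) (indicator (E n))) B \<le> emeasure (Qn m) B" if B: "B \<in> sets M" for B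
      using E B by (simp add: emeasure_restricted Qn emeasure_mono)
    ultimately have "emeasure (Qn n) B \<le> emeasure (Qn m) B" if "B \<in> sets M" for B using that by simp
    then show ?thesis by (subst le_measure) (auto simp: Qn)
  qed
  define Q where "Q = (SUP n. Qn n)"
  have sets_Q: "sets Q = sets M" unfolding Q_def by (rule sets_SUP) (auto simp: Qn)
  have space_Q: "space Q = space M" by (rule sets_eq_imp_space_eq[OF sets_Q])
  have emQ: "emeasure Q B = (SUP n. emeasure (Qn n) B)" if "B \<in> sets M" for B
    unfolding Q_def
    by (rule emeasure_SUP_chain[where N=M])
       (use that mono in \<open>auto simp: Qn Complete_Partial_Order.chain_def, metis nat_le_linear\<close>)
  have QnM: "emeasure (Qn n) B \<le> emeasure (Qn m) B" if "n \<le> m" for n m B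
    using le_measureD3[OF mono[OF that]] Qn by simp
  have lawQ: "emeasure Q {\<omega>\<in>\<Lambda>. zero_time q \<omega> = \<infinity>} = ennreal (\<integral>\<omega>. indicator \<Lambda> \<omega> * X q \<omega> \<partial>M)"
    if q: "0 \<le> q" "\<Lambda> \<in> sets (F q)" for q \<Lambda>
  proof -
    let ?B = "{\<omega>\<in>\<Lambda>. zero_time q \<omega> = \<infinity>}" and ?v = "ennreal (\<integral>\<omega>. indicator \<Lambda> \<omega> * X q \<omega> \<partial>M)"
    have B: "?B \<in> sets M" by (rule zero_time_infinite_Int_sets[OF q(1) sets_M[OF q(2,1)]])
    have v: "emeasure (Qn n) ?B = ?v" if "q \<le> real n" for n
      using killed_measure_zero_free[OF Qn law q(1) that order_refl q(2)] killed_integral_start[OF q] by simp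
    obtain n0 :: nat where n0: "q \<le> real n0" using real_arch_simple by blast
    have "(SUP n. emeasure (Qn n) ?B) = ?v"
    proof (rule antisym)
      show "(SUP n. emeasure (Qn n) ?B) \<le> ?v"
      proof (rule SUP_least)
        fix n
        have "emeasure (Qn n) ?B \<le> emeasure (Qn (max n n0)) ?B" by (rule QnM) simp
        also have "\<dots> = ?v" by (rule v) (use n0 in auto)
        finally show "emeasure (Qn n) ?B \<le> ?v" .
      qed
      show "?v \<le> (SUP n. emeasure (Qn n) ?B)" using v[OF n0] by (intro SUP_upper2[of n0]) auto
    qed
    then show ?thesis using emQ[OF B] by simp
  qed
  \<comment> \<open>At every finite time each \<open>Qn n\<close> has a density with respect to
    \<open>M\<close>; this survives the supremum, though only time by time.\<close>
  have ac: "emeasure Q B = 0" if "0 \<le> s" "B \<in> sets (F s)" "emeasure M B = 0" for s B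
  proof -
    have BM: "B \<in> sets M" by (rule sets_M[OF that(2,1)])
    obtain i :: nat where "s \<le> real i" using real_arch_simple by blast
    then have Bi: "B \<in> sets (F (real i))" using that sets_F_mono[of s "real i"] by auto
    have "AE \<omega> in M. \<omega> \<notin> B" using that BM by (intro AE_not_in) auto
    then have "(\<integral>\<omega>. indicator B \<omega> * killed (real n) (real (max n i)) \<omega> \<partial>M) = 0" for n
      by (intro integral_eq_zero_AE) (auto elim!: eventually_mono)
    then show ?thesis using emQ[OF BM] law[OF Bi] by simp
  qed
  have att: "AE \<omega> in Q. zeros_attained \<omega>" by (rule AE_zeros_attained[OF sets_Q ac])
  \<comment> \<open>Each \<open>Qn n\<close> is carried by \<open>E n\<close>, so \<open>?N\<close>
    is null. It completes the sets \<open>E n\<close> of finite mass to a cover of the space, and it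
    contains the event that the last zero is infinite.\<close>
  let ?N = "space M - (\<Union>n. E n)"
  have N_sets: "?N \<in> sets M" using E by auto
  have "emeasure (Qn n) ?N = 0" for n
  proof -
    have "emeasure (Qn n) (E n) = emeasure (Qn n) (space M)"
      using killed_measure_zero_free[OF Qn law, of "real n" n "real n" "space M"] law[of "space M" n n] space_in_sets_F
      by (simp add: E_def)
    then have "emeasure (Qn n) (space M - E n) = 0"
      using emeasure_Diff[of "Qn n" "E n" "space M"] fin[of n] E[of n] sets.sets_into_space[OF E[of n]]
      by (simp add: Qn spQ)
    moreover have "emeasure (Qn n) ?N \<le> emeasure (Qn n) (space M - E n)"
      using E by (intro emeasure_mono) (auto simp: Qn)
    ultimately show ?thesis by simp
  qed
  then have N_null: "emeasure Q ?N = 0" using emQ[OF N_sets] by simp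
  have "sigma_finite_measure Q"
  proof
    show "\<exists>S. countable S \<and> S \<subseteq> sets Q \<and> \<Union>S = space Q \<and> (\<forall>a\<in>S. emeasure Q a \<noteq> \<infinity>)"
    proof (intro exI[of _ "insert ?N (range E)"] conjI)
      have "emeasure Q (E n) \<noteq> \<infinity>" for n
        using lawQ[of "real n" "space M"] space_in_sets_F by (simp add: E_def)
      then show "\<forall>a\<in>insert ?N (range E). emeasure Q a \<noteq> \<infinity>" using N_null by auto
      show "insert ?N (range E) \<subseteq> sets Q" using E N_sets sets_Q by auto
      show "\<Union>(insert ?N (range E)) = space Q" using space_Q sets.sets_into_space[OF E] by auto
    qed simp
  qed
  moreover have "represents M F X Q"
    unfolding represents_def
  proof (intro conjI allI impI)
    have "{\<omega>\<in>space M. last_zero X \<omega> = \<infinity>} \<subseteq> ?N"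
      using zero_time_infinite_imp_last_zero_le by (fastforce simp: E_def top_unique)
    moreover have "?N \<in> null_sets (completion Q)"
      using N_null N_sets sets_Q by (intro null_sets_completionI) auto
    ultimately show "{\<omega>\<in>space M. last_zero X \<omega> = \<infinity>} \<in> null_sets (completion Q)"
      by (rule null_sets_completion_subset)
  next
    fix T and f :: "'a \<Rightarrow> real" assume T: "is_stopping_time M F T" and b: "bounded_time M T"
      and f: "f \<in> borel_measurable (sigma_at M F T)" and K: "\<exists>K. \<forall>\<omega>\<in>space M. \<bar>f \<omega>\<bar> \<le> K"
    obtain c where "\<And>\<omega>. \<omega> \<in> space M \<Longrightarrow> T \<omega> \<le> ennreal c" using b by (auto simp: bounded_time_def)
    then have c: "\<And>\<omega>. \<omega> \<in> space M \<Longrightarrow> T \<omega> \<le> ennreal (max 0 c)" by (auto simp: max_def ennreal_neg)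
    obtain K where K: "\<And>\<omega>. \<omega> \<in> space M \<Longrightarrow> \<bar>f \<omega>\<bar> \<le> K" using K by auto
    have val: "value_at X (\<lambda>_. 0) T \<omega> = X (enn2real (T \<omega>)) \<omega>" if "\<omega> \<in> space M" for \<omega>
      using c[OF that] by (auto simp: value_at_def top_unique)
    have "0 \<le> max 0 c" by simp
    note rep = bounded_stopping_representation[OF sets_Q lawQ att T this c f K]
    show "integrable M (\<lambda>\<omega>. f \<omega> * value_at X (\<lambda>_. 0) T \<omega>)"
      using rep(1) by (rule Bochner_Integration.integrable_cong[THEN iffD2, rotated 2]) (auto simp: val)
    have "(\<integral>\<omega>. f \<omega> * value_at X (\<lambda>_. 0) T \<omega> \<partial>M) = (\<integral>\<omega>. f \<omega> * X (enn2real (T \<omega>)) \<omega> \<partial>M)"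
      by (rule Bochner_Integration.integral_cong) (auto simp: val)
    then show "has_bochner_integral (completion Q) (\<lambda>\<omega>. f \<omega> * indicator {\<omega>. last_zero X \<omega> \<le> T \<omega>} \<omega>)
        (\<integral>\<omega>. f \<omega> * value_at X (\<lambda>_. 0) T \<omega> \<partial>M)" using rep(2) by (simp only:)
  qed
  ultimately show ?thesis using sets_Q by blast
qed

section \<open>Properties and uniqueness of representing measures\<close>

lemma representing_measure_const_time:
  assumes rep: "represents M F X R" and q: "0 \<le> q" and L: "\<Lambda> \<in> sets (F q)"
  shows "has_bochner_integral (completion R)
    (\<lambda>\<omega>. indicator \<Lambda> \<omega> * indicator {\<omega>. last_zero X \<omega> \<le> ennreal q} \<omega>) (\<integral>\<omega>. indicator \<Lambda> \<omega> * X q \<omega> \<partial>M)"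
proof -
  have "(indicator \<Lambda> :: 'a \<Rightarrow> real) \<in> borel_measurable (sigma_at M F (\<lambda>_. ennreal q))"
    using sets_sigma_at_const[OF q L] by simp
  moreover have "bounded_time M (\<lambda>_. ennreal q)" by (auto simp: bounded_time_def)
  moreover have "\<exists>K. \<forall>\<omega>\<in>space M. \<bar>indicator \<Lambda> \<omega> :: real\<bar> \<le> K" by (intro exI[of _ 1]) (auto split: split_indicator)
  ultimately have "has_bochner_integral (completion R)
      (\<lambda>\<omega>. indicator \<Lambda> \<omega> * indicator {\<omega>. last_zero X \<omega> \<le> ennreal q} \<omega>)
      (\<integral>\<omega>. indicator \<Lambda> \<omega> * value_at X (\<lambda>_. 0) (\<lambda>_. ennreal q) \<omega> \<partial>M)"
    using rep is_stopping_time_const[of "ennreal q"] unfolding represents_def by blast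
  then show ?thesis using q by (simp add: value_at_def)
qed

lemma representing_measure_last_zero_finite:
  assumes rep: "represents M F X R" and sets: "sets R = sets M"
  shows "AE \<omega> in R. last_zero X \<omega> \<noteq> \<infinity>"
proof -
  have "{\<omega>\<in>space M. last_zero X \<omega> = \<infinity>} \<in> null_sets (completion R)"
    using rep by (simp add: represents_def)
  from AE_not_in[OF this] have "AE \<omega> in completion R. last_zero X \<omega> \<noteq> \<infinity>"
    using AE_space by eventually_elim (auto simp: sets_eq_imp_space_eq[OF sets])
  then show ?thesis by (simp only: AE_completion_iff)
qed

text \<open>Testing with the indicator of \<open>B\<close> at the times \<open>s + n\<close> gives
  mass 0 to the part of \<open>B\<close> with last zero at most \<open>s + n\<close>, and the last
  zero is finite almost everywhere.\<close>

lemma representing_measure_absolutely_continuous: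
  assumes rep: "represents M F X R" and sets: "sets R = sets M"
    and B: "0 \<le> s" "B \<in> sets (F s)" "emeasure M B = 0"
  shows "emeasure R B = 0"
proof -
  have BM: "B \<in> sets M" by (rule sets_M[OF B(2,1)])
  have nB: "AE \<omega> in M. \<omega> \<notin> B" using B BM by (intro AE_not_in) auto
  have fin: "AE \<omega> in completion R. last_zero X \<omega> \<noteq> \<infinity>"
    by (rule AE_completion[OF representing_measure_last_zero_finite[OF rep sets]])
  have "AE \<omega> in completion R. \<not> (\<omega> \<in> B \<and> last_zero X \<omega> \<le> ennreal (s + real n))" for n
  proof -
    have "B \<in> sets (F (s + real n))" using B sets_F_mono[of s "s + real n"] by auto
    then have hb: "has_bochner_integral (completion R)
        (\<lambda>\<omega>. indicator B \<omega> * indicator {\<omega>. last_zero X \<omega> \<le> ennreal (s + real n)} \<omega>)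
        (\<integral>\<omega>. indicator B \<omega> * X (s + real n) \<omega> \<partial>M)"
      using B(1) by (intro representing_measure_const_time rep) auto
    have "(\<integral>\<omega>. indicator B \<omega> * X (s + real n) \<omega> \<partial>M) = 0"
      using nB by (intro integral_eq_zero_AE) (auto elim!: eventually_mono)
    then have "AE \<omega> in completion R. (indicator B \<omega> * indicator {\<omega>. last_zero X \<omega> \<le> ennreal (s + real n)} \<omega> :: real) = 0"
      using hb unfolding has_bochner_integral_iff
      by (subst integral_nonneg_eq_0_iff_AE[symmetric]) auto
    then show ?thesis by eventually_elim (auto split: split_indicator_asm)
  qed
  then have "AE \<omega> in completion R. \<forall>n. \<not> (\<omega> \<in> B \<and> last_zero X \<omega> \<le> ennreal (s + real n))"
    by (intro AE_all_countable[THEN iffD2] allI)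
  then have "AE \<omega> in completion R. \<omega> \<notin> B"
    using fin
  proof eventually_elim
    case (elim \<omega>)
    then obtain z where z: "last_zero X \<omega> = ennreal z" "0 \<le> z" by (cases "last_zero X \<omega>") auto
    obtain n :: nat where "z \<le> real n" using real_arch_simple by blast
    then have "last_zero X \<omega> \<le> ennreal (s + real n)" unfolding z using B(1) by (intro ennreal_leI) auto
    then show ?case using elim(1) by blast
  qed
  then have "AE \<omega> in R. \<omega> \<notin> B" by (simp only: AE_completion_iff)
  then show ?thesis using BM AE_iff_null_sets[of B R] by (auto simp: sets)
qed

text \<open>\<open>last_zero \<le> q\<close> and \<open>zero_time q = \<infinity>\<close> can differ
  when there is a zero exactly at \<open>q\<close>. Testing the representation with the indicator of
  \<open>{X q = 0}\<close> shows that such paths have mass 0. Rational \<open>q\<close> fits the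
  quantification in \<open>zeros_attained\<close>.\<close>

lemma representing_measure_law:
  assumes rep: "represents M F X R" and sets: "sets R = sets M" and q: "0 \<le> q" "q \<in> \<rat>" and L: "\<Lambda> \<in> sets (F q)"
  shows "emeasure R {\<omega>\<in>\<Lambda>. zero_time q \<omega> = \<infinity>} = ennreal (\<integral>\<omega>. indicator \<Lambda> \<omega> * X q \<omega> \<partial>M)"
proof -
  have att: "AE \<omega> in R. zeros_attained \<omega>"
    by (rule AE_zeros_attained[OF sets representing_measure_absolutely_continuous[OF rep sets]])
  have sp: "space R = space M" by (rule sets_eq_imp_space_eq[OF sets])
  have LM: "\<Lambda> \<in> sets M" by (rule sets_M[OF L q(1)])
  let ?Z = "{\<omega>\<in>space M. X q \<omega> = 0}"
  have "X q \<in> borel_measurable (F q)" using X_adapted q by (auto simp: adapted_def)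
  then have "{\<omega>\<in>space (F q). X q \<omega> = 0} \<in> sets (F q)" by measurable
  then have Z: "?Z \<in> sets (F q)" using space_F[OF q(1)] by simp
  have "(\<integral>\<omega>. indicator ?Z \<omega> * X q \<omega> \<partial>M) = 0"
    by (intro integral_eq_zero_AE AE_I2) auto
  then have "AE \<omega> in completion R. (indicator ?Z \<omega> * indicator {\<omega>. last_zero X \<omega> \<le> ennreal q} \<omega> :: real) = 0"
    using representing_measure_const_time[OF rep q(1) Z] unfolding has_bochner_integral_iff
    by (subst integral_nonneg_eq_0_iff_AE[symmetric]) auto
  then have Z_AE: "AE \<omega> in completion R. \<not> (\<omega> \<in> ?Z \<and> last_zero X \<omega> \<le> ennreal q)"
    by eventually_elim (auto split: split_indicator_asm)
  let ?B = "{\<omega>\<in>\<Lambda>. zero_time q \<omega> = \<infinity>}"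
  have B: "?B \<in> sets R" unfolding sets by (rule zero_time_infinite_Int_sets[OF q(1) LM])
  have iff: "AE \<omega> in completion R. zero_time q \<omega> = \<infinity> \<longleftrightarrow> last_zero X \<omega> \<le> ennreal q"
    using Z_AE AE_completion[OF att] AE_space
  proof eventually_elim
    case (elim \<omega>)
    then have \<omega>: "\<omega> \<in> space M" using sp by simp
    show ?case
    proof
      assume "zero_time q \<omega> = \<infinity>"
      then show "last_zero X \<omega> \<le> ennreal q" by (rule zero_time_infinite_imp_last_zero_le[OF \<omega> q(1)])
    next
      assume le: "last_zero X \<omega> \<le> ennreal q"
      show "zero_time q \<omega> = \<infinity>"
      proof (rule ccontr)
        assume fin: "zero_time q \<omega> \<noteq> \<infinity>"
        then obtain z where z: "zero_time q \<omega> = ennreal z" "0 \<le> z" by (cases "zero_time q \<omega>") auto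
        have X0: "X z \<omega> = 0" using elim(2) q fin z by (auto simp: zeros_attained_def)
        then have "ennreal z \<le> last_zero X \<omega>"
          unfolding last_zero_def using z by (intro SUP_upper) auto
        from order_trans[OF this le] have "z \<le> q" using q by (simp add: ennreal_le_iff)
        moreover have "q \<le> z" using zero_time_ge[of q \<omega>] z by (simp add: ennreal_le_iff)
        ultimately have "z = q" by simp
        then show False using X0 elim(1) le \<omega> by simp
      qed
    qed
  qed
  have "has_bochner_integral (completion R) (indicator ?B) (\<integral>\<omega>. indicator \<Lambda> \<omega> * X q \<omega> \<partial>M)"
  proof (rule has_bochner_integral_cong_AE[THEN iffD1, OF _ _ _ representing_measure_const_time[OF rep q(1) L]])
    show "AE \<omega> in completion R. indicator \<Lambda> \<omega> * indicator {\<omega>. last_zero X \<omega> \<le> ennreal q} \<omega> = (indicator ?B \<omega> :: real)"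
      using iff by eventually_elim (auto split: split_indicator)
    show "(\<lambda>\<omega>. indicator \<Lambda> \<omega> * indicator {\<omega>. last_zero X \<omega> \<le> ennreal q} \<omega> :: real) \<in> borel_measurable (completion R)"
      using representing_measure_const_time[OF rep q(1) L] by (auto simp: has_bochner_integral_iff)
    show "(indicator ?B :: 'a \<Rightarrow> real) \<in> borel_measurable (completion R)" using B by (intro borel_measurable_indicator) auto
  qed
  then have *: "has_bochner_integral R (indicator ?B :: 'a \<Rightarrow> real) (\<integral>\<omega>. indicator \<Lambda> \<omega> * X q \<omega> \<partial>M)"
    using B by (simp add: has_bochner_integral_iff integrable_completion integral_completion)
  have "emeasure R ?B = (\<integral>\<^sup>+\<omega>. ennreal (indicator ?B \<omega>) \<partial>R)"
    using B by (simp add: ennreal_indicator)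
  also have "\<dots> = ennreal (\<integral>\<omega>. indicator \<Lambda> \<omega> * X q \<omega> \<partial>M)"
    using * by (subst nn_integral_eq_integral) (auto simp: has_bochner_integral_iff)
  finally show ?thesis .
qed

text \<open>The mass of a single event is not directly prescribed, but its part in
  \<open>E n\<close> is, for events of every \<open>F i\<close>. These traces are finite, hence
  equal as measures, and the sets \<open>E n\<close> exhaust the space up to a null set because the
  last zero is finite.\<close>

lemma representing_measure_unique:
  assumes P: "property_P M F"
    and rep1: "represents M F X R1" and sets1: "sets R1 = sets M"
    and rep2: "represents M F X R2" and sets2: "sets R2 = sets M"
  shows "R1 = R2"
proof -
  have gen: "sets M = sets (sigma_infinity (space M) F)" using P by (simp add: property_P_def)
  define E where "E n = {\<omega>\<in>space M. zero_time (real n) \<omega> = \<infinity>}" for n :: nat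
  have E: "E n \<in> sets M" for n unfolding E_def by (rule zero_time_infinite_sets) simp
  have law: "emeasure R (\<Lambda> \<inter> E n) = ennreal (\<integral>\<omega>. indicator \<Lambda> \<omega> * killed (real n) (real i) \<omega> \<partial>M)"
    if rep: "represents M F X R" and sets: "sets R = sets M" and "n \<le> i" and L: "\<Lambda> \<in> sets (F (real i))" for R n i \<Lambda>
  proof -
    let ?L = "\<Lambda> \<inter> {\<omega>\<in>space M. ennreal (real i) < zero_time (real n) \<omega>}"
    have L': "?L \<in> sets (F (real i))" using L zero_time_greater_sets[of "real n" "real i"] by auto
    \<comment> \<open>Having no zero from \<open>n\<close> on splits into an event of
      \<open>F i\<close> and the absence of zeros from \<open>i\<close> on, to which the law at time
      \<open>i\<close> applies.\<close>
    have "\<Lambda> \<inter> E n = {\<omega>\<in>?L. zero_time (real i) \<omega> = \<infinity>}"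
      using zero_time_infinite_split[of "real n" "real i"] \<open>n \<le> i\<close> by (auto simp: E_def)
    then have "emeasure R (\<Lambda> \<inter> E n) = ennreal (\<integral>\<omega>. indicator ?L \<omega> * X (real i) \<omega> \<partial>M)"
      using representing_measure_law[OF rep sets _ _ L'] by simp
    also have "(\<integral>\<omega>. indicator ?L \<omega> * X (real i) \<omega> \<partial>M) = (\<integral>\<omega>. indicator \<Lambda> \<omega> * killed (real n) (real i) \<omega> \<partial>M)"
      by (intro Bochner_Integration.integral_cong) (auto simp: killed_def split: split_indicator)
    finally show ?thesis .
  qed
  have eq: "density R1 (indicator (E n)) = density R2 (indicator (E n))" for n
  proof (rule measure_eq_on_filtration[OF gen])
    have "emeasure (density R1 (indicator (E n))) (space M) = emeasure R1 (space M \<inter> E n)"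
      using E by (simp add: emeasure_restricted sets1 Int_commute)
    also have "\<dots> = ennreal (\<integral>\<omega>. indicator (space M) \<omega> * killed (real n) (real n) \<omega> \<partial>M)"
      by (rule law[OF rep1 sets1 order_refl space_in_sets_F]) simp
    finally show "emeasure (density R1 (indicator (E n))) (space M) \<noteq> \<infinity>" by simp
    fix t \<Lambda> assume t: "0 \<le> t" "\<Lambda> \<in> sets (F t)"
    obtain i :: nat where i: "max t (real n) \<le> real i" using real_arch_simple by blast
    have L: "\<Lambda> \<in> sets (F (real i))" using t sets_F_mono[OF t(1), of "real i"] i by auto
    have "n \<le> i" using i by simp
    note l = law[OF rep1 sets1 this L] law[OF rep2 sets2 this L]
    show "emeasure (density R1 (indicator (E n))) \<Lambda> = emeasure (density R2 (indicator (E n))) \<Lambda>"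
      using l E sets_M[OF t(2,1)] by (simp add: emeasure_restricted sets1 sets2 Int_commute)
  qed (simp_all add: sets1 sets2)
  have sup: "emeasure R B = (SUP n. emeasure R (E n \<inter> B))"
    if rep: "represents M F X R" and sets: "sets R = sets M" and B: "B \<in> sets M" for R B
  proof -
    have spR: "space R = space M" by (rule sets_eq_imp_space_eq[OF sets])
    have att: "AE \<omega> in R. zeros_attained \<omega>"
      by (rule AE_zeros_attained[OF sets representing_measure_absolutely_continuous[OF rep sets]])
    have AE_E: "AE \<omega> in R. \<omega> \<in> (\<Union>n. E n)"
      using representing_measure_last_zero_finite[OF rep sets] att AE_space
    proof eventually_elim
      case (elim \<omega>)
      then obtain z where z: "last_zero X \<omega> = ennreal z" "0 \<le> z" by (cases "last_zero X \<omega>") auto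
      have \<omega>: "\<omega> \<in> space M" using elim spR by simp
      obtain n :: nat where n: "z < real n" using reals_Archimedean2 by blast
      have "zero_free_after z \<omega>" using last_zero_le_iff[OF \<omega> elim(2) z(2)] z by simp
      then have "zero_time (real n) \<omega> = \<infinity>" using n by (auto simp: zero_free_after_def)
      then show ?case using \<omega> by (auto simp: E_def)
    qed
    have inc: "incseq (\<lambda>n. E n \<inter> B)"
      unfolding incseq_def
    proof (intro allI impI subsetI)
      fix m n \<omega> assume "m \<le> n" "\<omega> \<in> E m \<inter> B"
      then show "\<omega> \<in> E n \<inter> B"
        using zero_time_mono[of "real m" "real n" \<omega>] by (auto simp: E_def top_unique)
    qed
    have "(SUP n. emeasure R (E n \<inter> B)) = emeasure R (\<Union>n. E n \<inter> B)"
      by (rule SUP_emeasure_incseq) (use E B sets inc in auto)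
    also have "\<dots> = emeasure R B"
      by (rule emeasure_eq_AE) (use AE_E E B sets in \<open>auto elim!: eventually_mono\<close>)
    finally show ?thesis by simp
  qed
  show ?thesis
  proof (rule measure_eqI)
    fix B assume "B \<in> sets R1"
    then have B: "B \<in> sets M" by (simp add: sets1)
    have "emeasure R1 (E n \<inter> B) = emeasure R2 (E n \<inter> B)" for n
      using arg_cong[OF eq[of n], of "\<lambda>R. emeasure R B"] E B
      by (simp add: emeasure_restricted sets1 sets2)
    then show "emeasure R1 B = emeasure R2 B"
      using sup[OF rep1 sets1 B] sup[OF rep2 sets2 B] by simp
  qed (simp add: sets1 sets2)
qed

section \<open>Class (D)\<close>

lemma class_D_tail:
  assumes D: "class_D M F X" and e: "0 < e"
  shows "\<exists>K\<ge>0. \<forall>t\<ge>0. (\<integral>\<omega>. max (\<bar>X t \<omega>\<bar> - K) 0 \<partial>M) \<le> e"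
proof -
  let ?Y = "{value_at X (\<lambda>_. 0) T | T. is_stopping_time M F T \<and> (AE \<omega> in M. T \<omega> \<noteq> \<infinity>)}"
  let ?f = "\<lambda>K::real. SUP Y\<in>?Y. \<integral>\<^sup>+\<omega>. ennreal \<bar>Y \<omega>\<bar> * indicator {\<omega>. K < \<bar>Y \<omega>\<bar>} \<omega> \<partial>M"
  have "(?f \<longlongrightarrow> 0) at_top" using D by (simp add: class_D_def uniformly_integrable_def)
  then have "eventually (\<lambda>K. ?f K < ennreal e) at_top" using e by (intro order_tendstoD) auto
  then have "eventually (\<lambda>K. ?f K < ennreal e \<and> 0 \<le> K) at_top"
    using eventually_ge_at_top[of 0] by eventually_elim simp
  then obtain K where K: "?f K < ennreal e" "0 \<le> K" unfolding eventually_at_top_linorder by blast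
  have "(\<integral>\<omega>. max (\<bar>X t \<omega>\<bar> - K) 0 \<partial>M) \<le> e" if t: "0 \<le> t" for t
  proof -
    have "value_at X (\<lambda>_. 0) (\<lambda>_. ennreal t) = X t" using t by (simp add: value_at_def fun_eq_iff)
    then have XY: "X t \<in> ?Y"
      using is_stopping_time_const[of "ennreal t"] by (intro CollectI exI[of _ "\<lambda>_. ennreal t"]) auto
    have "ennreal (\<integral>\<omega>. max (\<bar>X t \<omega>\<bar> - K) 0 \<partial>M) = (\<integral>\<^sup>+\<omega>. ennreal (max (\<bar>X t \<omega>\<bar> - K) 0) \<partial>M)"
      by (rule nn_integral_eq_integral[symmetric, OF integrable_excess[OF X_integrable[OF t] K(2)]]) simp
    also have "\<dots> \<le> (\<integral>\<^sup>+\<omega>. ennreal \<bar>X t \<omega>\<bar> * indicator {\<omega>. K < \<bar>X t \<omega>\<bar>} \<omega> \<partial>M)"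
      using K(2) by (intro nn_integral_mono) (auto simp: max_def intro!: ennreal_leI split: split_indicator)
    also have "\<dots> \<le> ?f K" by (rule SUP_upper[OF XY])
    finally have "ennreal (\<integral>\<omega>. max (\<bar>X t \<omega>\<bar> - K) 0 \<partial>M) \<le> ennreal e" using K(1) by order
    then show ?thesis using e by (simp add: ennreal_le_iff)
  qed
  then show ?thesis using K(2) by blast
qed

lemma class_D_bounded:
  assumes D: "class_D M F X"
  shows "\<exists>C. \<forall>t\<ge>0. (\<integral>\<omega>. X t \<omega> \<partial>M) \<le> C"
proof -
  obtain K where K: "0 \<le> K" "\<And>t. 0 \<le> t \<Longrightarrow> (\<integral>\<omega>. max (\<bar>X t \<omega>\<bar> - K) 0 \<partial>M) \<le> 1"
    using class_D_tail[OF D, of 1] by auto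
  have "(\<integral>\<omega>. X t \<omega> \<partial>M) \<le> K + 1" if t: "0 \<le> t" for t
  proof -
    have int: "integrable M (\<lambda>\<omega>. max (\<bar>X t \<omega>\<bar> - K) 0)"
      by (rule integrable_excess[OF X_integrable[OF t] K(1)])
    have "(\<integral>\<omega>. X t \<omega> \<partial>M) \<le> (\<integral>\<omega>. K + max (\<bar>X t \<omega>\<bar> - K) 0 \<partial>M)"
      by (rule integral_mono[OF X_integrable[OF t]]) (use int in auto)
    also have "\<dots> = K + (\<integral>\<omega>. max (\<bar>X t \<omega>\<bar> - K) 0 \<partial>M)" using int by (simp add: prob_space)
    finally show ?thesis using K(2)[OF t] by simp
  qed
  then show ?thesis by blast
qed

text \<open>Bounded expectations of \<open>X\<close> bound those of \<open>A\<close>, since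
  \<open>N\<close> has constant expectation, and then those of
  \<open>\<bar>N\<bar> \<le> X + A\<close>. Martingale convergence handles \<open>N\<close>;
  monotone convergence makes the limit of the increasing \<open>A\<close> finite.\<close>

lemma X_converges:
  assumes D: "class_D M F X"
  shows "AE \<omega> in M. \<exists>l. ((\<lambda>t. X t \<omega>) \<longlongrightarrow> l) at_top"
proof -
  obtain C where C: "\<And>t. 0 \<le> t \<Longrightarrow> (\<integral>\<omega>. X t \<omega> \<partial>M) \<le> C" using class_D_bounded[OF D] by auto
  have Ni: "integrable M (N t)" if "0 \<le> t" for t using N_martingale that by (auto simp: martingale_def)
  have EN: "(\<integral>\<omega>. N t \<omega> \<partial>M) = (\<integral>\<omega>. N 0 \<omega> \<partial>M)" if "0 \<le> t" for t
    using martingale_integral_mult[OF N_martingale order_refl that, of "\<lambda>_. 1" 1] by simp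
  define CA where "CA = C - (\<integral>\<omega>. N 0 \<omega> \<partial>M)"
  have EA: "(\<integral>\<omega>. A t \<omega> \<partial>M) \<le> CA" if t: "0 \<le> t" for t
  proof -
    have "(\<integral>\<omega>. A t \<omega> \<partial>M) = (\<integral>\<omega>. X t \<omega> - N t \<omega> \<partial>M)"
      by (rule Bochner_Integration.integral_cong) (auto simp: X_eq t)
    also have "\<dots> = (\<integral>\<omega>. X t \<omega> \<partial>M) - (\<integral>\<omega>. N 0 \<omega> \<partial>M)" using X_integrable[OF t] Ni[OF t] EN[OF t] by simp
    finally show ?thesis using C[OF t] by (simp add: CA_def)
  qed
  have N_conv: "AE \<omega> in M. \<exists>l. ((\<lambda>t. N t \<omega>) \<longlongrightarrow> l) at_top"
  proof (rule martingale_convergence[OF N_martingale N_right])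
    fix t :: real assume t: "0 \<le> t"
    have "(\<integral>\<omega>. \<bar>N t \<omega>\<bar> \<partial>M) \<le> (\<integral>\<omega>. X t \<omega> + A t \<omega> \<partial>M)"
    proof (rule integral_mono)
      fix \<omega> assume "\<omega> \<in> space M"
      then show "\<bar>N t \<omega>\<bar> \<le> X t \<omega> + A t \<omega>"
        using X_eq[OF t] X_nonneg[OF t] A_nonneg[OF _ t] by (auto simp: abs_le_iff) (smt (verit))
    qed (use X_integrable[OF t] A_integrable[OF t] Ni[OF t] in auto)
    also have "\<dots> \<le> C + CA" using C[OF t] EA[OF t] X_integrable[OF t] A_integrable[OF t] by simp
    finally show "(\<integral>\<omega>. \<bar>N t \<omega>\<bar> \<partial>M) \<le> C + CA" .
  qed
  have "(\<integral>\<^sup>+\<omega>. (SUP n. ennreal (A (real n) \<omega>)) \<partial>M) = (SUP n. \<integral>\<^sup>+\<omega>. ennreal (A (real n) \<omega>) \<partial>M)"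
  proof (rule nn_integral_monotone_convergence_SUP_AE)
    show "AE \<omega> in M. ennreal (A (real n) \<omega>) \<le> ennreal (A (real (Suc n)) \<omega>)" for n
      by (intro AE_I2 ennreal_leI A_mono) auto
    show "(\<lambda>\<omega>. ennreal (A (real n) \<omega>)) \<in> borel_measurable M" for n using A_integrable[of "real n"] by auto
  qed
  also have "\<dots> \<le> ennreal CA"
  proof (rule SUP_least)
    fix n
    have "(\<integral>\<^sup>+\<omega>. ennreal (A (real n) \<omega>) \<partial>M) = ennreal (\<integral>\<omega>. A (real n) \<omega> \<partial>M)"
      by (rule nn_integral_eq_integral) (use A_integrable A_nonneg in \<open>auto intro!: AE_I2\<close>)
    then show "(\<integral>\<^sup>+\<omega>. ennreal (A (real n) \<omega>) \<partial>M) \<le> ennreal CA" using EA[of "real n"] by (simp add: ennreal_leI)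
  qed
  finally have fin: "(\<integral>\<^sup>+\<omega>. (SUP n. ennreal (A (real n) \<omega>)) \<partial>M) \<noteq> \<infinity>" by (auto simp: top_unique)
  have "AE \<omega> in M. (SUP n. ennreal (A (real n) \<omega>)) \<noteq> \<infinity>"
  proof (rule nn_integral_noteq_infinite[OF _ fin])
    show "(\<lambda>\<omega>. SUP n. ennreal (A (real n) \<omega>)) \<in> borel_measurable M"
      using A_integrable by (intro borel_measurable_SUP) auto
  qed
  then have A_conv: "AE \<omega> in M. \<exists>l. ((\<lambda>t. A t \<omega>) \<longlongrightarrow> l) at_top"
    using AE_space
  proof eventually_elim
    case (elim \<omega>)
    then obtain B where B: "(SUP n. ennreal (A (real n) \<omega>)) = ennreal B" "0 \<le> B"
      by (cases "SUP n. ennreal (A (real n) \<omega>)") auto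
    have "ennreal (A (real n) \<omega>) \<le> ennreal B" for n unfolding B(1)[symmetric] by (rule SUP_upper) simp
    then have AB: "A (real n) \<omega> \<le> B" for n using B(2) by (simp add: ennreal_le_iff)
    have bdd: "bdd_above (range (\<lambda>n. A (real n) \<omega>))" using AB by (intro bdd_aboveI[of _ B]) auto
    have "((\<lambda>t. A t \<omega>) \<longlongrightarrow> (SUP n. A (real n) \<omega>)) at_top"
    proof (rule increasing_tendsto)
      show "eventually (\<lambda>t. A t \<omega> \<le> (SUP n. A (real n) \<omega>)) at_top"
        using eventually_ge_at_top[of 0]
      proof eventually_elim
        case t: (elim t)
        obtain n :: nat where "t \<le> real n" using real_arch_simple by blast
        then have "A t \<omega> \<le> A (real n) \<omega>" using A_mono elim(2) t by auto
        also have "\<dots> \<le> (SUP n. A (real n) \<omega>)" by (rule cSUP_upper[OF _ bdd]) simp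
        finally show ?case .
      qed
      fix x assume "x < (SUP n. A (real n) \<omega>)"
      then obtain n where n: "x < A (real n) \<omega>" using less_cSUP_iff[OF _ bdd] by auto
      show "eventually (\<lambda>t. x < A t \<omega>) at_top"
        using eventually_ge_at_top[of "real n"]
      proof eventually_elim
        case t: (elim t)
        then show ?case using A_mono[of \<omega> "real n" t] elim(2) n by auto
      qed
    qed
    then show ?case by blast
  qed
  show ?thesis
    using N_conv A_conv AE_space
  proof eventually_elim
    case (elim \<omega>)
    then obtain l1 l2 where "((\<lambda>t. N t \<omega>) \<longlongrightarrow> l1) at_top" "((\<lambda>t. A t \<omega>) \<longlongrightarrow> l2) at_top" by blast
    then have "((\<lambda>t. N t \<omega> + A t \<omega>) \<longlongrightarrow> l1 + l2) at_top" by (rule tendsto_add)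
    moreover have "eventually (\<lambda>t. N t \<omega> + A t \<omega> = X t \<omega>) at_top"
      using eventually_ge_at_top[of 0] by eventually_elim (use X_eq elim(3) in auto)
    ultimately have "((\<lambda>t. X t \<omega>) \<longlongrightarrow> l1 + l2) at_top" by (simp add: tendsto_cong)
    then show ?case by blast
  qed
qed

text \<open>A version of the limit that is measurable for \<open>sigma_infinity\<close>, as needed
  for the value at an infinite stopping time to be known at that time. Integer times keep the
  measurability countable.\<close>

definition X_infinity :: "'a \<Rightarrow> real" where
  "X_infinity \<omega> = lim (\<lambda>n. X (real n) \<omega>)"

lemma X_infinity_measurable: "X_infinity \<in> borel_measurable (sigma_infinity (space M) F)"
  unfolding X_infinity_def
proof (rule borel_measurable_lim_metric)
  fix n :: nat
  have "subalgebra (sigma_infinity (space M) F) (F (real n))"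
    using sets_F_sigma_infinity[of "real n"] by (auto simp: subalgebra_def space_sigma_infinity space_F)
  then show "X (real n) \<in> borel_measurable (sigma_infinity (space M) F)"
    by (rule measurable_from_subalg) (use X_adapted in \<open>auto simp: adapted_def\<close>)
qed

lemma subalgebra_sigma_infinity: "subalgebra M (sigma_infinity (space M) F)"
  using sets_sigma_infinity_subset by (auto simp: subalgebra_def space_sigma_infinity)

lemma X_infinity_unique:
  assumes "((\<lambda>t. X t \<omega>) \<longlongrightarrow> l) at_top" shows "X_infinity \<omega> = l"
proof -
  have "(\<lambda>n. X (real n) \<omega>) \<longlonglongrightarrow> l"
    by (rule filterlim_compose[OF assms filterlim_real_sequentially])
  then show ?thesis unfolding X_infinity_def by (rule limI)
qed

lemma X_tendsto_X_infinity:
  assumes D: "class_D M F X"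
  shows "AE \<omega> in M. ((\<lambda>t. X t \<omega>) \<longlongrightarrow> X_infinity \<omega>) at_top"
  using X_converges[OF D] by eventually_elim (auto dest: X_infinity_unique)

text \<open>The tails of the process killed from \<open>q\<close> are dominated by those of
  \<open>X\<close>, so class (D) permits letting \<open>s\<close> tend to infinity in the martingale
  identity. The third claim makes the measure with density \<open>X_infinity\<close> satisfy the
  same law as the representing measure.\<close>

lemma class_D_limit:
  assumes D: "class_D M F X"
  shows "integrable M X_infinity" and "AE \<omega> in M. 0 \<le> X_infinity \<omega>"
    and "\<And>q \<Lambda>. 0 \<le> q \<Longrightarrow> \<Lambda> \<in> sets (F q) \<Longrightarrow>
      (\<integral>\<omega>. indicator {\<omega>\<in>\<Lambda>. zero_time q \<omega> = \<infinity>} \<omega> * X_infinity \<omega> \<partial>M) = (\<integral>\<omega>. indicator \<Lambda> \<omega> * X q \<omega> \<partial>M)"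
proof -
  have Xm: "X_infinity \<in> borel_measurable M"
    by (rule measurable_from_subalg[OF subalgebra_sigma_infinity X_infinity_measurable])
  have lim: "AE \<omega> in M. (\<lambda>n. X (real n) \<omega>) \<longlonglongrightarrow> X_infinity \<omega>"
    using X_tendsto_X_infinity[OF D] by eventually_elim (rule filterlim_compose[OF _ filterlim_real_sequentially])
  have ui: "\<exists>K\<ge>0. \<forall>n. (\<integral>\<omega>. max (\<bar>X (real n) \<omega>\<bar> - K) 0 \<partial>M) \<le> e" if "0 < e" for e
    using class_D_tail[OF D that] by auto
  show int: "integrable M X_infinity"
    by (rule vitali_convergence(1)[OF _ Xm lim ui]) (rule X_integrable, simp)
  show "AE \<omega> in M. 0 \<le> X_infinity \<omega>"
    using lim AE_space
  proof eventually_elim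
    case (elim \<omega>)
    then show ?case using X_nonneg by (intro LIMSEQ_le_const[OF elim(1)]) auto
  qed
  fix q \<Lambda> assume q: "0 \<le> q" and L: "\<Lambda> \<in> sets (F q)"
  have LM: "\<Lambda> \<in> sets M" by (rule sets_M[OF L q])
  obtain n0 :: nat where n0: "q \<le> real n0" using real_arch_simple by blast
  let ?B = "{\<omega>\<in>\<Lambda>. zero_time q \<omega> = \<infinity>}"
  let ?Y = "\<lambda>n \<omega>. indicator \<Lambda> \<omega> * killed q (real (n0 + n)) \<omega>"
  have B: "?B \<in> sets M" by (rule zero_time_infinite_Int_sets[OF q LM])
  have Yi: "integrable M (?Y n)" for n
    using integrable_real_mult_indicator[OF LM killed_integrable[OF q, of "real (n0 + n)"]] by (simp add: mult.commute)
  have Zm: "(\<lambda>\<omega>. indicator ?B \<omega> * X_infinity \<omega>) \<in> borel_measurable M" using B Xm by auto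
  have limY: "AE \<omega> in M. (\<lambda>n. ?Y n \<omega>) \<longlonglongrightarrow> indicator ?B \<omega> * X_infinity \<omega>"
    using lim
  proof eventually_elim
    case (elim \<omega>)
    have lim': "(\<lambda>n. X (real (n0 + n)) \<omega>) \<longlonglongrightarrow> X_infinity \<omega>"
      using LIMSEQ_ignore_initial_segment[OF elim, of n0] by (simp add: add.commute)
    show ?case
    proof (cases "zero_time q \<omega> = \<infinity>")
      case True
      then have "?Y n \<omega> = indicator ?B \<omega> * X (real (n0 + n)) \<omega>" for n
        by (auto simp: killed_def split: split_indicator)
      then show ?thesis using lim' by (simp only:) (intro tendsto_intros)
    next
      case False
      then obtain n1 where n1: "\<not> ennreal (real n1) < zero_time q \<omega>"
        using ennreal_eq_top_iff_less_nat by blast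
      have "eventually (\<lambda>n. ?Y n \<omega> = indicator ?B \<omega> * X_infinity \<omega>) sequentially"
        using eventually_ge_at_top[of n1]
      proof eventually_elim
        case n: (elim n)
        have "ennreal (real n1) \<le> ennreal (real (n0 + n))" by (rule ennreal_leI) (use n in simp)
        then have "\<not> ennreal (real (n0 + n)) < zero_time q \<omega>" using n1 by order
        then show ?case using False by (simp add: killed_def del: of_nat_add)
      qed
      then show ?thesis by (rule tendsto_eventually)
    qed
  qed
  have uiY: "\<exists>K\<ge>0. \<forall>n. (\<integral>\<omega>. max (\<bar>?Y n \<omega>\<bar> - K) 0 \<partial>M) \<le> e" if e: "0 < e" for e
  proof -
    obtain K where K: "0 \<le> K" "\<And>t. 0 \<le> t \<Longrightarrow> (\<integral>\<omega>. max (\<bar>X t \<omega>\<bar> - K) 0 \<partial>M) \<le> e"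
      using class_D_tail[OF D e] by auto
    have "(\<integral>\<omega>. max (\<bar>?Y n \<omega>\<bar> - K) 0 \<partial>M) \<le> e" for n
    proof -
      have "(\<integral>\<omega>. max (\<bar>?Y n \<omega>\<bar> - K) 0 \<partial>M) \<le> (\<integral>\<omega>. max (\<bar>X (real (n0 + n)) \<omega>\<bar> - K) 0 \<partial>M)"
      proof (rule integral_mono)
        show "integrable M (\<lambda>\<omega>. max (\<bar>?Y n \<omega>\<bar> - K) 0)"
          by (rule integrable_excess[OF Yi K(1)])
        show "integrable M (\<lambda>\<omega>. max (\<bar>X (real (n0 + n)) \<omega>\<bar> - K) 0)"
          by (rule integrable_excess[OF X_integrable K(1)]) simp
      qed (use K in \<open>auto simp: killed_def split: split_indicator\<close>)
      also have "\<dots> \<le> e" by (rule K(2)) simp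
      finally show ?thesis .
    qed
    then show ?thesis using K(1) by blast
  qed
  have "(\<lambda>n. \<integral>\<omega>. ?Y n \<omega> \<partial>M) \<longlonglongrightarrow> (\<integral>\<omega>. indicator ?B \<omega> * X_infinity \<omega> \<partial>M)"
    by (rule vitali_convergence(2)[OF Yi Zm limY uiY])
  moreover have "(\<integral>\<omega>. ?Y n \<omega> \<partial>M) = (\<integral>\<omega>. indicator \<Lambda> \<omega> * X q \<omega> \<partial>M)" for n
    using killed_integral_eq[OF q order_refl _ L, of "real (n0 + n)"] killed_integral_start[OF q L] n0 by simp
  ultimately show "(\<integral>\<omega>. indicator ?B \<omega> * X_infinity \<omega> \<partial>M) = (\<integral>\<omega>. indicator \<Lambda> \<omega> * X q \<omega> \<partial>M)"
    by (simp add: LIMSEQ_const_iff)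
qed

text \<open>On \<open>{T \<le> t}\<close> the value is that at the truncated time, known at every
  \<open>s > t\<close>; right-continuity of the filtration brings it back to \<open>t\<close>. On
  \<open>{T = \<infinity>}\<close> the value is \<open>d\<close>.\<close>

lemma value_at_measurable:
  assumes T: "is_stopping_time M F T" and d: "d \<in> borel_measurable (sigma_infinity (space M) F)"
  shows "value_at X d T \<in> borel_measurable (sigma_at M F T)"
proof (rule borel_measurableI_less)
  fix a
  let ?W = "value_at X d T"
  have cut: "{\<omega>\<in>space M. T \<omega> \<le> ennreal t \<and> ?W \<omega> < a} \<in> sets (F t)" if t: "0 \<le> t" for t
  proof (rule F_right_continuous[OF t])
    fix s assume s: "t < s"
    let ?T = "\<lambda>\<omega>. cut_time t (T \<omega>)"
    have s0: "0 \<le> s" using s t by simp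
    have "weak_stopping ?T t" by (intro weak_stopping_cut_time t stopping_time_less_sets T)
    then have [measurable]: "(\<lambda>\<omega>. X (?T \<omega>) \<omega>) \<in> borel_measurable (F s)"
      by (rule weak_stopping_value_measurable_after[OF _ t s X_adapted X_right])
    have "{\<omega>\<in>space (F s). X (?T \<omega>) \<omega> < a} \<in> sets (F s)" by measurable
    moreover have "{\<omega>\<in>space M. T \<omega> \<le> ennreal t} \<in> sets (F s)"
      using stopping_time_le_sets[OF T t] sets_F_mono[OF t, of s] s by auto
    ultimately have "{\<omega>\<in>space (F s). X (?T \<omega>) \<omega> < a} \<inter> {\<omega>\<in>space M. T \<omega> \<le> ennreal t} \<in> sets (F s)" by blast
    also have "{\<omega>\<in>space (F s). X (?T \<omega>) \<omega> < a} \<inter> {\<omega>\<in>space M. T \<omega> \<le> ennreal t} = {\<omega>\<in>space M. T \<omega> \<le> ennreal t \<and> ?W \<omega> < a}"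
      using space_F[OF s0] by (auto simp: cut_time_le_imp_eq value_at_def top_unique)
    finally show "{\<omega>\<in>space M. T \<omega> \<le> ennreal t \<and> ?W \<omega> < a} \<in> sets (F s)" .
  qed
  show "{\<omega>\<in>space (sigma_at M F T). ?W \<omega> < a} \<in> sets (sigma_at M F T)"
    unfolding sets_sigma_at[OF T]
  proof (intro CollectI allI)
    fix t :: ennreal
    show "{\<omega>\<in>{\<omega>\<in>space (sigma_at M F T). ?W \<omega> < a}. T \<omega> \<le> t} \<in> sets (extend_filtration (space M) F t)"
    proof (cases t)
      case (real r)
      have "{\<omega>\<in>{\<omega>\<in>space (sigma_at M F T). ?W \<omega> < a}. T \<omega> \<le> t} = {\<omega>\<in>space M. T \<omega> \<le> ennreal r \<and> ?W \<omega> < a}"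
        by (auto simp: space_sigma_at real)
      then show ?thesis using cut[of r] real by (simp add: extend_filtration_def)
    next
      case top
      let ?I = "sigma_infinity (space M) F"
      have 1: "{\<omega>\<in>space M. T \<omega> \<le> ennreal (real n) \<and> ?W \<omega> < a} \<in> sets ?I" for n
        using cut[of "real n"] sets_F_sigma_infinity[of "real n"] by auto
      have 2: "{\<omega>\<in>space M. T \<omega> \<le> ennreal (real n)} \<in> sets ?I" for n
        using stopping_time_le_sets[OF T, of "real n"] sets_F_sigma_infinity[of "real n"] by auto
      have "{\<omega>\<in>space ?I. d \<omega> < a} \<in> sets ?I" using d by measurable
      then have 3: "{\<omega>\<in>space M. d \<omega> < a} \<in> sets ?I" by (simp add: space_sigma_infinity)
      have fin: "(\<exists>n. T \<omega> \<le> ennreal (real n)) \<longleftrightarrow> T \<omega> \<noteq> \<infinity>" for \<omega>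
        using ennreal_eq_top_iff_less_nat[of "T \<omega>"] by (auto simp: not_less[symmetric])
      have "{\<omega>\<in>{\<omega>\<in>space (sigma_at M F T). ?W \<omega> < a}. T \<omega> \<le> t} =
        (\<Union>n. {\<omega>\<in>space M. T \<omega> \<le> ennreal (real n) \<and> ?W \<omega> < a}) \<union>
        ({\<omega>\<in>space M. d \<omega> < a} - (\<Union>n. {\<omega>\<in>space M. T \<omega> \<le> ennreal (real n)}))"
      proof (rule set_eqI)
        fix \<omega>
        show "\<omega> \<in> {\<omega>\<in>{\<omega>\<in>space (sigma_at M F T). ?W \<omega> < a}. T \<omega> \<le> t} \<longleftrightarrow>
          \<omega> \<in> (\<Union>n. {\<omega>\<in>space M. T \<omega> \<le> ennreal (real n) \<and> ?W \<omega> < a}) \<union>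
          ({\<omega>\<in>space M. d \<omega> < a} - (\<Union>n. {\<omega>\<in>space M. T \<omega> \<le> ennreal (real n)}))"
          using fin[of \<omega>] by (cases "T \<omega> = \<infinity>") (auto simp: space_sigma_at top value_at_def)
      qed
      also have "\<dots> \<in> sets ?I" using 1 2 3 by (intro sets.Un sets.Diff sets.countable_UN) auto
      finally show ?thesis using top by (simp add: extend_filtration_def)
    qed
  qed
qed

text \<open>\<open>\<Lambda>\<close> is exhausted by its parts with \<open>T \<le> n\<close>, where
  the result for bounded times applies to the measure with density \<open>d\<close>, together with
  the part with \<open>T = \<infinity>\<close>, where both integrands equal \<open>d\<close>.
  Cutting off at 0 makes \<open>d\<close> nonnegative everywhere, as a density should be.\<close>

lemma class_D_stopped_integral:
  assumes D: "class_D M F X" and T: "is_stopping_time M F T"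
  defines "d \<equiv> \<lambda>\<omega>. max 0 (X_infinity \<omega>)"
    and "B \<equiv> {\<omega>\<in>space M. T \<omega> = \<infinity> \<or> zero_free_after (enn2real (T \<omega>)) \<omega>}"
  shows "B \<in> sets M" "integrable M (value_at X d T)"
    "\<And>\<Lambda>. \<Lambda> \<in> sets (sigma_at M F T) \<Longrightarrow>
      (\<integral>\<omega>. indicator \<Lambda> \<omega> * value_at X d T \<omega> \<partial>M) = (\<integral>\<omega>. indicator \<Lambda> \<omega> * (d \<omega> * indicator B \<omega>) \<partial>M)"
proof -
  let ?W = "value_at X d T" and ?G = "sigma_at M F T"
  have dm: "d \<in> borel_measurable (sigma_infinity (space M) F)"
    unfolding d_def using X_infinity_measurable by measurable
  have dM: "d \<in> borel_measurable M" by (rule measurable_from_subalg[OF subalgebra_sigma_infinity dm])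
  have d0: "0 \<le> d \<omega>" for \<omega> by (simp add: d_def)
  have d_int: "integrable M d"
    unfolding d_def using class_D_limit(1)[OF D] by (intro integrable_max) auto
  have d_AE: "AE \<omega> in M. d \<omega> = X_infinity \<omega>"
    using class_D_limit(2)[OF D] by eventually_elim (simp add: d_def)
  have sub: "subalgebra M ?G" by (rule subalgebra_sigma_at[OF T])
  have GM: "\<Lambda> \<in> sets M" if "\<Lambda> \<in> sets ?G" for \<Lambda> using sub that by (auto simp: subalgebra_def)
  have WM: "?W \<in> borel_measurable M" by (rule measurable_from_subalg[OF sub value_at_measurable[OF T dm]])
  have W0: "0 \<le> ?W \<omega>" if "\<omega> \<in> space M" for \<omega> using that d0 X_nonneg by (auto simp: value_at_def)
  have TM: "T \<in> borel_measurable M" by (rule measurable_from_subalg[OF sub stopping_time_measurable_sigma_at[OF T]])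
  have zf: "{\<omega>\<in>space M. zero_free_after (enn2real (T \<omega>)) \<omega>} \<in> sets M"
    by (rule zero_free_after_sets) (use TM in auto)
  have Ttop: "{\<omega>\<in>space M. T \<omega> = \<infinity>} \<in> sets M" using TM by measurable
  have "B = {\<omega>\<in>space M. T \<omega> = \<infinity>} \<union> {\<omega>\<in>space M. zero_free_after (enn2real (T \<omega>)) \<omega>}" by (auto simp: B_def)
  then show B: "B \<in> sets M" using zf Ttop by simp
  define R where "R = density M (\<lambda>\<omega>. ennreal (d \<omega>))"
  have R: "sets R = sets M" by (simp add: R_def)
  have emR: "emeasure R \<Lambda> = ennreal (\<integral>\<omega>. indicator \<Lambda> \<omega> * d \<omega> \<partial>M)" if "\<Lambda> \<in> sets M" for \<Lambda>
    unfolding R_def by (rule emeasure_density_integral[OF d_int d0 that])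
  have law: "emeasure R {\<omega>\<in>\<Lambda>. zero_time q \<omega> = \<infinity>} = ennreal (\<integral>\<omega>. indicator \<Lambda> \<omega> * X q \<omega> \<partial>M)"
    if q: "0 \<le> q" and L: "\<Lambda> \<in> sets (F q)" for q \<Lambda>
  proof -
    have LM: "\<Lambda> \<in> sets M" by (rule sets_M[OF L q])
    have C: "{\<omega>\<in>\<Lambda>. zero_time q \<omega> = \<infinity>} \<in> sets M" by (rule zero_time_infinite_Int_sets[OF q LM])
    have "(\<integral>\<omega>. indicator {\<omega>\<in>\<Lambda>. zero_time q \<omega> = \<infinity>} \<omega> * d \<omega> \<partial>M) =
        (\<integral>\<omega>. indicator {\<omega>\<in>\<Lambda>. zero_time q \<omega> = \<infinity>} \<omega> * X_infinity \<omega> \<partial>M)"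
    proof (rule integral_cong_AE)
      show "AE \<omega> in M. indicator {\<omega>\<in>\<Lambda>. zero_time q \<omega> = \<infinity>} \<omega> * d \<omega> = indicator {\<omega>\<in>\<Lambda>. zero_time q \<omega> = \<infinity>} \<omega> * X_infinity \<omega>"
        using d_AE by eventually_elim simp
    qed (use C dM class_D_limit(1)[OF D] in auto)
    then show ?thesis using emR[OF C] class_D_limit(3)[OF D q L] by simp
  qed
  \<comment> \<open>The comparison is made between measures with values in
    \<open>[0, \<infinity>]\<close>, since integrability of the stopped value is not yet known; it
    follows by taking the whole space for \<open>\<Lambda>\<close>.\<close>
  let ?D1 = "density M (\<lambda>\<omega>. ennreal (?W \<omega>))" and ?D2 = "density M (\<lambda>\<omega>. ennreal (d \<omega> * indicator B \<omega>))"
  have em1: "emeasure ?D1 \<Lambda> = (\<integral>\<^sup>+\<omega>. ennreal (?W \<omega>) * indicator \<Lambda> \<omega> \<partial>M)" if "\<Lambda> \<in> sets M" for \<Lambda>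
    by (rule emeasure_density) (use WM that in auto)
  have em2: "emeasure ?D2 \<Lambda> = (\<integral>\<^sup>+\<omega>. ennreal (d \<omega> * indicator B \<omega>) * indicator \<Lambda> \<omega> \<partial>M)" if "\<Lambda> \<in> sets M" for \<Lambda>
    by (rule emeasure_density) (use dM B that in auto)
  have dB_int: "integrable M (\<lambda>\<omega>. d \<omega> * indicator B \<omega>)" by (rule integrable_real_mult_indicator[OF B d_int])
  have dB0: "0 \<le> d \<omega> * indicator B \<omega>" for \<omega> using d0 by simp
  have eq: "emeasure ?D1 \<Lambda> = emeasure ?D2 \<Lambda>" if L: "\<Lambda> \<in> sets ?G" for \<Lambda>
  proof -
    have LM: "\<Lambda> \<in> sets M" by (rule GM[OF L])
    have Lsp: "\<Lambda> \<subseteq> space M" using LM sets.sets_into_space by auto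
    define C where "C n = {\<omega>\<in>\<Lambda>. T \<omega> \<le> ennreal (real n)}" for n :: nat
    let ?E = "{\<omega>\<in>\<Lambda>. T \<omega> = \<infinity>}"
    have CF: "C n \<in> sets (F (real n))" for n
      using L unfolding sets_sigma_at[OF T] C_def
      by (auto simp: extend_filtration_def dest!: spec[of _ "ennreal (real n)"])
    have CM: "C n \<in> sets M" for n by (rule sets_M[OF CF]) simp
    have "?E = \<Lambda> \<inter> {\<omega>\<in>space M. T \<omega> = \<infinity>}" using Lsp by auto
    then have EM: "?E \<in> sets M" using LM Ttop by simp
    have C_eq: "emeasure ?D1 (C n) = emeasure ?D2 (C n)" for n
    proof -
      let ?T = "\<lambda>\<omega>. cut_time (real n) (T \<omega>)"
      have W: "weak_stopping ?T (real n)" by (intro weak_stopping_cut_time stopping_time_less_sets T) simp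
      have CT: "{\<omega>\<in>C n. ?T \<omega> < t} \<in> sets (F t)" if "0 \<le> t" for t
      proof (rule cut_time_sets[OF _ CF _ that])
        fix t :: real assume t: "0 \<le> t" "t \<le> real n"
        have "T \<omega> \<le> ennreal (real n)" if "T \<omega> < ennreal t" for \<omega>
          using that ennreal_leI[OF t(2)] by order
        then have "{\<omega>\<in>C n. T \<omega> < ennreal t} = {\<omega>\<in>\<Lambda>. T \<omega> < ennreal t}" by (auto simp: C_def)
        then show "{\<omega>\<in>C n. T \<omega> < ennreal t} \<in> sets (F t)" using sigma_at_less_sets[OF T L t(1)] by simp
      qed simp
      have Teq: "?T \<omega> = enn2real (T \<omega>)" "T \<omega> \<noteq> top" if "\<omega> \<in> C n" for \<omega>
        using that by (auto simp: C_def cut_time_le_imp_eq top_unique)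
      have "emeasure ?D1 (C n) = (\<integral>\<^sup>+\<omega>. ennreal (indicator (C n) \<omega> * X (?T \<omega>) \<omega>) \<partial>M)"
        unfolding em1[OF CM]
        by (intro nn_integral_cong) (auto simp: value_at_def Teq split: split_indicator)
      also have "\<dots> = ennreal (\<integral>\<omega>. indicator (C n) \<omega> * X (?T \<omega>) \<omega> \<partial>M)"
        by (rule nn_integral_eq_integral[OF stopped_value(2)[OF W _ CM CT]])
           (auto intro!: AE_I2 simp: X_nonneg cut_time_nonneg)
      also have "\<dots> = emeasure R {\<omega>\<in>C n. zero_free_after (?T \<omega>) \<omega>}"
        by (rule emeasure_zero_free_after[OF R law W _ CM CT, symmetric]) auto
      also have "{\<omega>\<in>C n. zero_free_after (?T \<omega>) \<omega>} = C n \<inter> B"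
        using Lsp by (auto simp: B_def Teq) (auto simp: C_def)
      also have "emeasure R (C n \<inter> B) = (\<integral>\<^sup>+\<omega>. ennreal (d \<omega>) * indicator (C n \<inter> B) \<omega> \<partial>M)"
        unfolding R_def by (rule emeasure_density) (use dM CM B in auto)
      also have "\<dots> = emeasure ?D2 (C n)"
        unfolding em2[OF CM] by (intro nn_integral_cong) (auto split: split_indicator)
      finally show ?thesis .
    qed
    have E_eq: "emeasure ?D1 ?E = emeasure ?D2 ?E"
      unfolding em1[OF EM] em2[OF EM]
      by (intro nn_integral_cong) (auto simp: value_at_def B_def split: split_indicator)
    have CE: "C n \<inter> ?E = {}" for n by (auto simp: C_def top_unique)
    have CE_eq: "emeasure ?D1 (C n \<union> ?E) = emeasure ?D2 (C n \<union> ?E)" for n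
    proof -
      have "emeasure ?D1 (C n \<union> ?E) = emeasure ?D1 (C n) + emeasure ?D1 ?E"
        by (rule plus_emeasure[symmetric]) (use CM EM CE in auto)
      also have "\<dots> = emeasure ?D2 (C n) + emeasure ?D2 ?E" by (simp only: C_eq E_eq)
      also have "\<dots> = emeasure ?D2 (C n \<union> ?E)"
        by (rule plus_emeasure) (use CM EM CE in auto)
      finally show ?thesis .
    qed
    have U: "(\<Union>n. C n \<union> ?E) = \<Lambda>"
      using ennreal_eq_top_iff_less_nat by (auto simp: C_def not_less)
    have inc: "incseq (\<lambda>n. C n \<union> ?E)"
      unfolding incseq_def
    proof (intro allI impI Un_mono order_refl subsetI)
      fix m n \<omega> assume "m \<le> n" and \<omega>: "\<omega> \<in> C m"
      then have "ennreal (real m) \<le> ennreal (real n)" by (intro ennreal_leI) simp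
      then show "\<omega> \<in> C n" using \<omega> unfolding C_def by (auto intro: order_trans)
    qed
    have CE_sets: "range (\<lambda>n. C n \<union> ?E) \<subseteq> sets (density M f)" for f using CM EM by auto
    have "emeasure ?D1 \<Lambda> = (SUP n. emeasure ?D1 (C n \<union> ?E))"
      using SUP_emeasure_incseq[OF CE_sets inc] unfolding U by simp
    also have "\<dots> = (SUP n. emeasure ?D2 (C n \<union> ?E))" by (simp only: CE_eq)
    also have "\<dots> = emeasure ?D2 \<Lambda>"
      using SUP_emeasure_incseq[OF CE_sets inc] unfolding U by simp
    finally show ?thesis .
  qed
  have spG: "space M \<in> sets ?G" using sets.top[of ?G] by (simp add: space_sigma_at)
  show W_int: "integrable M ?W"
  proof (rule integrableI_bounded[OF WM])
    have "(\<integral>\<^sup>+\<omega>. ennreal (norm (?W \<omega>)) \<partial>M) = emeasure ?D1 (space M)"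
      unfolding em1[OF GM[OF spG]] using W0 by (intro nn_integral_cong) auto
    also have "\<dots> = emeasure ?D2 (space M)" by (rule eq[OF spG])
    also have "\<dots> < \<infinity>" by (simp add: emeasure_density_integral[OF dB_int dB0 GM[OF spG]])
    finally show "(\<integral>\<^sup>+\<omega>. ennreal (norm (?W \<omega>)) \<partial>M) < \<infinity>" .
  qed
  fix \<Lambda> assume L: "\<Lambda> \<in> sets ?G"
  have "ennreal (\<integral>\<omega>. indicator \<Lambda> \<omega> * ?W \<omega> \<partial>M) = ennreal (\<integral>\<omega>. indicator \<Lambda> \<omega> * (d \<omega> * indicator B \<omega>) \<partial>M)"
    using eq[OF L] emeasure_density_integral[OF W_int W0 GM[OF L]] emeasure_density_integral[OF dB_int dB0 GM[OF L]]
    by simp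
  moreover have "0 \<le> (\<integral>\<omega>. indicator \<Lambda> \<omega> * ?W \<omega> \<partial>M)" using W0 by (intro integral_nonneg_AE AE_I2) auto
  moreover have "0 \<le> (\<integral>\<omega>. indicator \<Lambda> \<omega> * (d \<omega> * indicator B \<omega>) \<partial>M)" using dB0 by (intro integral_nonneg_AE AE_I2) auto
  ultimately show "(\<integral>\<omega>. indicator \<Lambda> \<omega> * ?W \<omega> \<partial>M) = (\<integral>\<omega>. indicator \<Lambda> \<omega> * (d \<omega> * indicator B \<omega>) \<partial>M)"
    by simp
qed

text \<open>The given limit \<open>Y\<close> need not be measurable for
  \<open>sigma_infinity\<close>, so the conditional expectation is identified with the value formed
  from the version \<open>d\<close>, which is known at \<open>T\<close>, and \<open>Y\<close> is
  substituted almost surely at the end. The completion appears because the event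
  \<open>last_zero \<le> T\<close> may be nonmeasurable.\<close>

lemma class_D_conditional_expectation:
  assumes D: "class_D M F X" and T: "is_stopping_time M F T"
    and Y: "Y \<in> borel_measurable M" "AE \<omega> in M. ((\<lambda>t. X t \<omega>) \<longlongrightarrow> Y \<omega>) at_top"
  shows "integrable (completion M) (\<lambda>\<omega>. Y \<omega> * indicator {\<omega>. last_zero X \<omega> \<le> T \<omega>} \<omega>)"
    and "AE \<omega> in M. value_at X Y T \<omega> = real_cond_exp (completion M) (sigma_at M F T)
      (\<lambda>\<omega>. Y \<omega> * indicator {\<omega>. last_zero X \<omega> \<le> T \<omega>} \<omega>) \<omega>"
proof -
  define d where "d = (\<lambda>\<omega>. max 0 (X_infinity \<omega>))"
  define B where "B = {\<omega>\<in>space M. T \<omega> = \<infinity> \<or> zero_free_after (enn2real (T \<omega>)) \<omega>}"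
  let ?W = "value_at X d T" and ?G = "sigma_at M F T" and ?C = "{\<omega>. last_zero X \<omega> \<le> T \<omega>}"
  note st = class_D_stopped_integral[OF D T, folded d_def B_def]
  have dm: "d \<in> borel_measurable (sigma_infinity (space M) F)"
    unfolding d_def using X_infinity_measurable by measurable
  have d_int: "integrable M d"
    unfolding d_def using class_D_limit(1)[OF D] by (intro integrable_max) auto
  have Yd: "AE \<omega> in M. Y \<omega> = d \<omega>"
    using Y(2) class_D_limit(2)[OF D] by eventually_elim (auto simp: d_def dest: X_infinity_unique)
  have Y_int: "integrable M Y"
    using integrable_cong_AE[of Y M d] Y(1) d_int Yd by auto
  have att: "AE \<omega> in M. zeros_attained \<omega>" by (rule AE_zeros_attained) auto
  have BC: "AE \<omega> in M. \<omega> \<in> B \<longleftrightarrow> \<omega> \<in> ?C"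
    using att AE_space
  proof eventually_elim
    case (elim \<omega>)
    show ?case
    proof (cases "T \<omega> = \<infinity>")
      case False
      then have "ennreal (enn2real (T \<omega>)) = T \<omega>" by (simp add: less_top)
      then show ?thesis using last_zero_le_iff[OF elim(2,1), of "enn2real (T \<omega>)"] elim(2) False by (simp add: B_def)
    qed (use elim in \<open>simp add: B_def\<close>)
  qed
  have sub: "subalgebra M ?G" by (rule subalgebra_sigma_at[OF T])
  have GM: "\<Lambda> \<in> sets M" if "\<Lambda> \<in> sets ?G" for \<Lambda> using sub that by (auto simp: subalgebra_def)
  have WG: "?W \<in> borel_measurable ?G" by (rule value_at_measurable[OF T dm])
  have WM: "?W \<in> borel_measurable M" by (rule measurable_from_subalg[OF sub WG])
  have hb: "has_bochner_integral (completion M) (\<lambda>\<omega>. (indicator \<Lambda> \<omega> * Y \<omega>) * indicator ?C \<omega>)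
      (\<integral>\<omega>. indicator \<Lambda> \<omega> * ?W \<omega> \<partial>M)" if L: "\<Lambda> \<in> sets ?G" for \<Lambda>
  proof (rule has_bochner_integral_completion_cong[OF _ _ st(1) BC])
    have m: "(\<lambda>\<omega>. (indicator \<Lambda> \<omega> * Y \<omega>) * indicator B \<omega>) \<in> borel_measurable M" using Y(1) GM[OF L] st(1) by auto
    have "integrable M (\<lambda>\<omega>. (indicator \<Lambda> \<omega> * Y \<omega>) * indicator B \<omega>)"
      by (rule Bochner_Integration.integrable_bound[OF Y_int m]) (auto split: split_indicator)
    moreover have "(\<integral>\<omega>. (indicator \<Lambda> \<omega> * Y \<omega>) * indicator B \<omega> \<partial>M) = (\<integral>\<omega>. indicator \<Lambda> \<omega> * (d \<omega> * indicator B \<omega>) \<partial>M)"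
    proof (rule integral_cong_AE[OF m])
      show "(\<lambda>\<omega>. indicator \<Lambda> \<omega> * (d \<omega> * indicator B \<omega>)) \<in> borel_measurable M"
        using d_int GM[OF L] st(1) by auto
      show "AE \<omega> in M. (indicator \<Lambda> \<omega> * Y \<omega>) * indicator B \<omega> = indicator \<Lambda> \<omega> * (d \<omega> * indicator B \<omega>)"
        using Yd by eventually_elim simp
    qed
    ultimately show "has_bochner_integral M (\<lambda>\<omega>. (indicator \<Lambda> \<omega> * Y \<omega>) * indicator B \<omega>) (\<integral>\<omega>. indicator \<Lambda> \<omega> * ?W \<omega> \<partial>M)"
      using st(3)[OF L] by (simp add: has_bochner_integral_iff d_def)
    show "(\<lambda>\<omega>. indicator \<Lambda> \<omega> * Y \<omega>) \<in> borel_measurable M" using Y(1) GM[OF L] by auto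
  qed
  have spG: "space M \<in> sets ?G" using sets.top[of ?G] by (simp add: space_sigma_at)
  have "integrable (completion M) (\<lambda>\<omega>. (indicator (space M) \<omega> * Y \<omega>) * indicator ?C \<omega>)"
    using hb[OF spG] by (simp add: has_bochner_integral_iff)
  then show int: "integrable (completion M) (\<lambda>\<omega>. Y \<omega> * indicator ?C \<omega>)"
    by (rule Bochner_Integration.integrable_cong[THEN iffD1, rotated 2]) auto
  have subc: "subalgebra (completion M) ?G" using sub by (auto simp: subalgebra_def)
  have "prob_space (completion M)"
    by (rule prob_spaceI) (simp add: emeasure_space_1)
  then interpret c: prob_space "completion M" .
  interpret c: finite_measure_subalgebra "completion M" ?G by unfold_locales (rule subc)
  have "AE \<omega> in completion M. real_cond_exp (completion M) ?G (\<lambda>\<omega>. Y \<omega> * indicator ?C \<omega>) \<omega> = ?W \<omega>"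
  proof (rule c.real_cond_exp_charact[OF _ int _ WG])
    show "integrable (completion M) ?W" using st(2) integrable_completion[OF WM] by simp
    fix \<Lambda> assume L: "\<Lambda> \<in> sets ?G"
    have m: "(\<lambda>\<omega>. indicator \<Lambda> \<omega> * ?W \<omega>) \<in> borel_measurable M" using WM GM[OF L] by auto
    show "(\<integral>\<omega>\<in>\<Lambda>. Y \<omega> * indicator ?C \<omega> \<partial>completion M) = (\<integral>\<omega>\<in>\<Lambda>. ?W \<omega> \<partial>completion M)"
      using hb[OF L] integral_completion[OF m]
      by (simp add: set_lebesgue_integral_def has_bochner_integral_iff mult.assoc)
  qed
  then have "AE \<omega> in M. real_cond_exp (completion M) ?G (\<lambda>\<omega>. Y \<omega> * indicator ?C \<omega>) \<omega> = ?W \<omega>"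
    by (simp only: AE_completion_iff)
  then show "AE \<omega> in M. value_at X Y T \<omega> = real_cond_exp (completion M) ?G (\<lambda>\<omega>. Y \<omega> * indicator ?C \<omega>) \<omega>"
    using Yd by eventually_elim (auto simp: value_at_def)
qed

end

lemma usual_assumptions_right_continuous:
  assumes "usual_assumptions M F" "0 \<le> t" "\<And>s. t < s \<Longrightarrow> B \<in> sets (F s)"
  shows "B \<in> sets (F t)"
proof -
  have "sets (F t) = (\<Inter>s\<in>{t<..}. sets (F s))" using assms(1,2) unfolding usual_assumptions_def by blast
  then show ?thesis using assms(3) by auto
qed

lemma property_P_right_continuous:
  assumes P: "property_P M F" and t: "0 \<le> t" and B: "\<And>s. t < s \<Longrightarrow> B \<in> sets (F s)"
  shows "B \<in> sets (F t)"
proof -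
  obtain G where G: "\<forall>t\<ge>0. sets (F t) = (\<Inter>s\<in>{t<..}. sets (G s))"
    using P unfolding property_P_def by (elim conjE exE)
  have "B \<in> sets (G s)" if s: "t < s" for s
  proof -
    \<comment> \<open>The midpoint leaves room on both sides: \<open>B\<close> is in
      \<open>F\<close> there, because it lies after \<open>t\<close>, and therefore in
      \<open>G s\<close>, because \<open>s\<close> lies after it.\<close>
    have "sets (F ((t + s) / 2)) = (\<Inter>r\<in>{(t + s) / 2<..}. sets (G r))" using G t s by auto
    moreover have "B \<in> sets (F ((t + s) / 2))" using s by (intro B) simp
    ultimately show ?thesis using s by auto
  qed
  then show ?thesis using G t by auto
qed

theorem corollary2p6:
  fixes M :: "'a measure" and F :: "real \<Rightarrow> 'a measure" and X :: "real \<Rightarrow> 'a \<Rightarrow> real"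
  assumes "filtered_prob_space M F"
    and "class_Sigma M F X"
  shows "(property_P M F \<longrightarrow>
           (\<exists>!Q. sets Q = sets M \<and> sigma_finite_measure Q \<and> represents M F X Q)) \<and>
         (class_D M F X \<and> (usual_assumptions M F \<or> property_P M F) \<longrightarrow>
           (\<exists>Xinf\<in>borel_measurable M. AE \<omega> in M. ((\<lambda>t. X t \<omega>) \<longlongrightarrow> Xinf \<omega>) at_top) \<and>
           (\<forall>Xinf\<in>borel_measurable M. (AE \<omega> in M. ((\<lambda>t. X t \<omega>) \<longlongrightarrow> Xinf \<omega>) at_top) \<longrightarrow>
             (\<forall>T. is_stopping_time M F T \<longrightarrow>
                integrable (completion M)
                  (\<lambda>\<omega>. Xinf \<omega> * indicator {\<omega>. last_zero X \<omega> \<le> T \<omega>} \<omega>) \<and>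
                (AE \<omega> in M. value_at X Xinf T \<omega> =
                   real_cond_exp (completion M) (sigma_at M F T)
                     (\<lambda>\<omega>. Xinf \<omega> * indicator {\<omega>. last_zero X \<omega> \<le> T \<omega>} \<omega>) \<omega>))))"
proof -
  interpret filtered_prob_space M F by fact
  have X: "submartingale M F X" "\<forall>t\<ge>0. \<forall>\<omega>\<in>space M. 0 \<le> X t \<omega>"
    using assms(2) unfolding class_Sigma_def by auto
  obtain N A where NA: "\<forall>t\<ge>0. \<forall>\<omega>\<in>space M. X t \<omega> = N t \<omega> + A t \<omega>"
        "martingale M F N" "\<forall>\<omega>\<in>space M. cadlag (\<lambda>t. N t \<omega>)"
        "adapted F A"
        "\<forall>\<omega>\<in>space M. A 0 \<omega> = 0 \<and> continuous_on {0..} (\<lambda>t. A t \<omega>) \<and> mono_on {0..} (\<lambda>t. A t \<omega>)"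
        "AE \<omega> in M. AE t in stieltjes (\<lambda>t. A t \<omega>). t \<in> {t. 0 \<le> t \<and> X t \<omega> = 0}"
    using assms(2) unfolding class_Sigma_def by blast
  have process: "Sigma_process M F X N A"
    if "\<And>t B. 0 \<le> t \<Longrightarrow> (\<And>s. t < s \<Longrightarrow> B \<in> sets (F s)) \<Longrightarrow> B \<in> sets (F t)"
  proof -
    have sub: "adapted F X" "\<And>t. 0 \<le> t \<Longrightarrow> integrable M (X t)"
      using X(1) by (simp_all add: submartingale_def)
    have X': "\<And>t \<omega>. 0 \<le> t \<Longrightarrow> \<omega> \<in> space M \<Longrightarrow> X t \<omega> = N t \<omega> + A t \<omega>"
      "\<And>t \<omega>. 0 \<le> t \<Longrightarrow> \<omega> \<in> space M \<Longrightarrow> 0 \<le> X t \<omega>"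
      using NA(1) X(2) by blast+
    have A': "\<And>\<omega>. \<omega> \<in> space M \<Longrightarrow> A 0 \<omega> = 0" "\<And>\<omega>. \<omega> \<in> space M \<Longrightarrow> continuous_on {0..} (\<lambda>t. A t \<omega>)"
      "\<And>\<omega>. \<omega> \<in> space M \<Longrightarrow> mono_on {0..} (\<lambda>t. A t \<omega>)"
      using NA(5) by blast+
    have N': "\<And>\<omega>. \<omega> \<in> space M \<Longrightarrow> cadlag (\<lambda>t. N t \<omega>)" using NA(3) by blast
    have carried: "AE \<omega> in M. AE t in stieltjes (\<lambda>t. A t \<omega>). 0 \<le> t \<and> X t \<omega> = 0"
      using NA(6) by (simp only: mem_Collect_eq)
    show ?thesis
      by unfold_locales (fact X' sub NA(2) N' NA(4) A' carried that)+
  qed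
  have part1: "\<exists>!Q. sets Q = sets M \<and> sigma_finite_measure Q \<and> represents M F X Q" if P: "property_P M F"
  proof -
    interpret Sigma_process M F X N A by (rule process[OF property_P_right_continuous[OF P]])
    obtain Q where "sets Q = sets M \<and> sigma_finite_measure Q \<and> represents M F X Q"
      using exists_representing_measure[OF P] by blast
    then show ?thesis
      by (rule ex1I) (use \<open>sets Q = sets M \<and> sigma_finite_measure Q \<and> represents M F X Q\<close> in
        \<open>auto intro: representing_measure_unique[OF P]\<close>)
  qed
  have part2: "(\<exists>Xinf\<in>borel_measurable M. AE \<omega> in M. ((\<lambda>t. X t \<omega>) \<longlongrightarrow> Xinf \<omega>) at_top) \<and>
           (\<forall>Xinf\<in>borel_measurable M. (AE \<omega> in M. ((\<lambda>t. X t \<omega>) \<longlongrightarrow> Xinf \<omega>) at_top) \<longrightarrow>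
             (\<forall>T. is_stopping_time M F T \<longrightarrow>
                integrable (completion M)
                  (\<lambda>\<omega>. Xinf \<omega> * indicator {\<omega>. last_zero X \<omega> \<le> T \<omega>} \<omega>) \<and>
                (AE \<omega> in M. value_at X Xinf T \<omega> =
                   real_cond_exp (completion M) (sigma_at M F T)
                     (\<lambda>\<omega>. Xinf \<omega> * indicator {\<omega>. last_zero X \<omega> \<le> T \<omega>} \<omega>) \<omega>)))"
    if D: "class_D M F X" and UP: "usual_assumptions M F \<or> property_P M F"
  proof -
    interpret Sigma_process M F X N A
      by (rule process) (use UP usual_assumptions_right_continuous property_P_right_continuous in metis)
    show ?thesis
    proof (intro conjI ballI impI allI)
      show "\<exists>Xinf\<in>borel_measurable M. AE \<omega> in M. ((\<lambda>t. X t \<omega>) \<longlongrightarrow> Xinf \<omega>) at_top"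
        using X_tendsto_X_infinity[OF D] class_D_limit(1)[OF D] by (intro bexI[of _ X_infinity]) auto
    qed (rule class_D_conditional_expectation[OF D]; assumption)+
  qed
  show ?thesis using part1 part2 by blast
qed

end
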